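(* Let $m=2k+1\ge5$ be an odd integer, let $G=\langle s,t\mid \Pi(s,t,m)=\Pi(t,s,m)\rangle$ be the Artin group of type $I_2(m)$, let $M$ be the submonoid of $G$ generated by $\{s,t\}$, let $\Omega=\Pi(s,t,m)=(st)^ks=(ts)^kt$ and $\Delta=\Omega^2$. Let $G_1$ (resp. $M_1$) be the subgroup (resp. submonoid) generated by $t$ and let $H$ (resp. $N$) be the subgroup (resp. submonoid) generated by $s$. Let $r_1,\dots,r_{2k}$ be the standard generators of the braid group $\mathcal B_{2k+1}$ and let $\iota:G\to\mathcal B_{2k+1}$ be the (injective) homomorphism with $\iota(s)=\prod_{i=0}^{k-1}r_{2i+1}$ and $\iota(t)=\prod_{i=1}^{k}r_{2i}$. Let $\alpha\in G$. Then $\alpha$ is $(H,G_1)$-negative (with respect to the Garside structure $(G,M,\Delta)$) if and only if $\iota(\alpha)$ is $r_1$-negative.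
   Context: $\Pi(s,t,m)$ denotes the alternating word $sts\cdots$ of length $m$. The braid group is $\mathcal B_{2k+1}=\langle r_1,\dots,r_{2k}\mid r_ir_jr_i=r_jr_ir_j\text{ for }|i-j|=1,\ r_ir_j=r_jr_i\text{ for }|i-j|\ge2\rangle$. An element $\beta\in\mathcal B_{2k+1}$ is $r_1$-negative if it can be written $\beta=\beta_0r_1^{-1}\beta_1\cdots r_1^{-1}\beta_q$ with $q\ge1$ and $\beta_0,\dots,\beta_q\in\langle r_2,\dots,r_{2k}\rangle$. By a theorem of Crisp, $\iota$ is a well-defined injective homomorphism. For $\alpha,\beta\in G$: $\alpha\le_R\beta$ iff $\beta\alpha^{-1}\in M$. It is known that $(G,M,\Delta)$ is a Garside structure with $\Delta$ central in $G$, and that $(G_1,M_1,t^2)$ and $(H,N,s^2)$ are parabolic substructures of it. An element $a\in M$ is unmovable if $\Delta\not\le_R a$. Every $\alpha\in G$ is uniquely $\alpha=a\Delta^j$ with $a\in M$ unmovable and $j\in\mathbb Z$ (the $\Delta$-form of $\alpha$). Depth. For $K\in\{M_1,N\}$ and $a\in M$, $\tau_K(a)$ denotes the unique $b\in K$ with $\{c\in K\mid c\le_R a\}=\{c\in K\mid c\le_R b\}$. Every $a\in M\setminus\{1\}$ is uniquely $a=a_p\cdots a_2a_1$ with $a_p\ne1$, $a_i=\tau_{M_1}(a_p\cdots a_i)$ for $i$ odd and $a_i=\tau_N(a_p\cdots a_i)$ for $i$ even; set $\mathrm{bh}(a)=p$ and $\mathrm{bh}(1)=1$. The depth is $\mathrm{dpt}(a)=(\mathrm{bh}(a)-1)/2$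 if $\mathrm{bh}(a)$ is odd and $\mathrm{bh}(a)/2$ if $\mathrm{bh}(a)$ is even. An element $\alpha\in G$ with $\Delta$-form $\alpha=a\Delta^{-j}$ is $(H,G_1)$-negative if $j\ge1$ and $\mathrm{dpt}(a)<\mathrm{dpt}(\Delta^j)$. *)

theory Defs
  imports "HOL.Hull" "HOL-Algebra.Generated_Groups"
begin

section \<open>Groups given by a presentation\<close>

text \<open>A word is a list of letters; \<open>(x, True)\<close> stands for the generator \<open>x\<close> and \<open>(x, False)\<close>
  for its formal inverse.  A relation \<open>u = v\<close> is a pair of words \<open>(u, v)\<close>.\<close>

type_synonym 'a word = "('a \<times> bool) list"

definition words :: "'a set \<Rightarrow> 'a word set" where
  "words S = lists (S \<times> UNIV)"

definition pos_word :: "'a list \<Rightarrow> 'a word" where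
  "pos_word xs = map (\<lambda>x. (x, True)) xs"

inductive_set pres_cong :: "'a set \<Rightarrow> ('a word \<times> 'a word) set \<Rightarrow> ('a word \<times> 'a word) set"
  for S :: "'a set" and R :: "('a word \<times> 'a word) set" where
  refl: "u \<in> words S \<Longrightarrow> (u, u) \<in> pres_cong S R"
| sym: "(u, v) \<in> pres_cong S R \<Longrightarrow> (v, u) \<in> pres_cong S R"
| trans: "(u, v) \<in> pres_cong S R \<Longrightarrow> (v, w) \<in> pres_cong S R \<Longrightarrow> (u, w) \<in> pres_cong S R"
| cancel: "u \<in> words S \<Longrightarrow> v \<in> words S \<Longrightarrow> x \<in> S
    \<Longrightarrow> (u @ [(x, b), (x, \<not> b)] @ v, u @ v) \<in> pres_cong S R"
| rel: "u \<in> words S \<Longrightarrow> v \<in> words S \<Longrightarrow> l \<in> words S \<Longrightarrow> r \<in> words S \<Longrightarrow> (l, r) \<in> R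
    \<Longrightarrow> (u @ l @ v, u @ r @ v) \<in> pres_cong S R"

definition presented_group ::
    "'a set \<Rightarrow> ('a word \<times> 'a word) set \<Rightarrow> 'a word set monoid" where
  "presented_group S R =
    \<lparr> carrier = words S // pres_cong S R,
      mult = (\<lambda>A B. pres_cong S R `` {u @ v | u v. u \<in> A \<and> v \<in> B}),
      one = pres_cong S R `` {[]} \<rparr>"

definition pres_gen :: "'a set \<Rightarrow> ('a word \<times> 'a word) set \<Rightarrow> 'a \<Rightarrow> 'a word set" where
  "pres_gen S R x = pres_cong S R `` {pos_word [x]}"


section \<open>Products of lists and generated submonoids\<close>

definition list_prod :: "('a, 'b) monoid_scheme \<Rightarrow> 'a list \<Rightarrow> 'a" where
  "list_prod G xs = foldr (\<otimes>\<^bsub>G\<^esub>) xs \<one>\<^bsub>G\<^esub>"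

definition gen_submonoid :: "('a, 'b) monoid_scheme \<Rightarrow> 'a set \<Rightarrow> 'a set" where
  "gen_submonoid G X = (\<lambda>K. submonoid K G) hull X"


section \<open>Depth and negativity\<close>

definition le_R :: "('a, 'b) monoid_scheme \<Rightarrow> 'a set \<Rightarrow> 'a \<Rightarrow> 'a \<Rightarrow> bool" where
  "le_R G M \<alpha> \<beta> \<longleftrightarrow> \<beta> \<otimes>\<^bsub>G\<^esub> inv\<^bsub>G\<^esub> \<alpha> \<in> M"

definition unmovable :: "('a, 'b) monoid_scheme \<Rightarrow> 'a set \<Rightarrow> 'a \<Rightarrow> 'a \<Rightarrow> bool" where
  "unmovable G M \<Delta> a \<longleftrightarrow> a \<in> M \<and> \<not> le_R G M \<Delta> a"

definition is_Delta_form :: "('a, 'b) monoid_scheme \<Rightarrow> 'a set \<Rightarrow> 'a \<Rightarrow> 'a \<Rightarrow> 'a \<Rightarrow> int \<Rightarrow> bool" where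
  "is_Delta_form G M \<Delta> \<alpha> a j \<longleftrightarrow> unmovable G M \<Delta> a \<and> \<alpha> = a \<otimes>\<^bsub>G\<^esub> \<Delta> [^]\<^bsub>G\<^esub> j"

definition tau :: "('a, 'b) monoid_scheme \<Rightarrow> 'a set \<Rightarrow> 'a set \<Rightarrow> 'a \<Rightarrow> 'a" where
  "tau G M K a = (THE b. b \<in> K \<and> {c \<in> K. le_R G M c a} = {c \<in> K. le_R G M c b})"

text \<open>The list \<open>as\<close> is \<open>[a\<^sub>1, a\<^sub>2, \<dots>, a\<^sub>p]\<close>, while the product is taken in the order
  \<open>a\<^sub>p \<cdots> a\<^sub>2 a\<^sub>1\<close>.  Since list positions start at 0, the odd indices of the mathematical
  notation are the even positions, and \<open>list_prod G (rev (drop i as))\<close> is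
  \<open>a\<^sub>p \<cdots> a\<^bsub>i+1\<^esub>\<close>.\<close>

definition is_alternating_form ::
    "('a, 'b) monoid_scheme \<Rightarrow> 'a set \<Rightarrow> 'a set \<Rightarrow> 'a set \<Rightarrow> 'a \<Rightarrow> 'a list \<Rightarrow> bool" where
  "is_alternating_form G M M1 N a as \<longleftrightarrow>
     as \<noteq> [] \<and> last as \<noteq> \<one>\<^bsub>G\<^esub> \<and> a = list_prod G (rev as) \<and>
     (\<forall>i < length as. as ! i = tau G M (if even i then M1 else N) (list_prod G (rev (drop i as))))"

definition bh :: "('a, 'b) monoid_scheme \<Rightarrow> 'a set \<Rightarrow> 'a set \<Rightarrow> 'a set \<Rightarrow> 'a \<Rightarrow> nat" where
  "bh G M M1 N a =
     (if a = \<one>\<^bsub>G\<^esub> then 1 else length (THE as. is_alternating_form G M M1 N a as))"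

definition dpt :: "('a, 'b) monoid_scheme \<Rightarrow> 'a set \<Rightarrow> 'a set \<Rightarrow> 'a set \<Rightarrow> 'a \<Rightarrow> nat" where
  "dpt G M M1 N a =
     (let p = bh G M M1 N a in if odd p then (p - 1) div 2 else p div 2)"

text \<open>\<open>(H, G\<^sub>1)\<close>-negativity; the parabolic substructures \<open>G\<^sub>1\<close> and \<open>H\<close> enter
  through their positive monoids \<open>M\<^sub>1\<close> and \<open>N\<close> only.\<close>

definition HG1_negative ::
    "('a, 'b) monoid_scheme \<Rightarrow> 'a set \<Rightarrow> 'a \<Rightarrow> 'a set \<Rightarrow> 'a set \<Rightarrow> 'a \<Rightarrow> bool" where
  "HG1_negative G M \<Delta> N M1 \<alpha> \<longleftrightarrow>
     (\<exists>a (j::int). is_Delta_form G M \<Delta> \<alpha> a (- j) \<and> j \<ge> 1 \<and>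
        dpt G M M1 N a < dpt G M M1 N (\<Delta> [^]\<^bsub>G\<^esub> j))"


section \<open>The Artin group of type \<open>I\<^sub>2(m)\<close>\<close>

fun alt_word :: "'a \<Rightarrow> 'a \<Rightarrow> nat \<Rightarrow> 'a list" where
  "alt_word x y 0 = []"
| "alt_word x y (Suc n) = x # alt_word y x n"

datatype st = gen_s | gen_t

definition artin_rels :: "nat \<Rightarrow> (st word \<times> st word) set" where
  "artin_rels m = {(pos_word (alt_word gen_s gen_t m), pos_word (alt_word gen_t gen_s m))}"

definition artin_I2 :: "nat \<Rightarrow> st word set monoid" where
  "artin_I2 m = presented_group UNIV (artin_rels m)"

definition artin_s :: "nat \<Rightarrow> st word set" where
  "artin_s m = pres_gen UNIV (artin_rels m) gen_s"

definition artin_t :: "nat \<Rightarrow> st word set" where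
  "artin_t m = pres_gen UNIV (artin_rels m) gen_t"

definition artin_M :: "nat \<Rightarrow> st word set set" where
  "artin_M m = gen_submonoid (artin_I2 m) {artin_s m, artin_t m}"

definition artin_M1 :: "nat \<Rightarrow> st word set set" where
  "artin_M1 m = gen_submonoid (artin_I2 m) {artin_t m}"

definition artin_N :: "nat \<Rightarrow> st word set set" where
  "artin_N m = gen_submonoid (artin_I2 m) {artin_s m}"

definition artin_Omega :: "nat \<Rightarrow> st word set" where
  "artin_Omega m = list_prod (artin_I2 m) (alt_word (artin_s m) (artin_t m) m)"

definition artin_Delta :: "nat \<Rightarrow> st word set" where
  "artin_Delta m = artin_Omega m [^]\<^bsub>artin_I2 m\<^esub> (2::nat)"


section \<open>The braid group on \<open>n\<close> strands\<close>

definition braid_rels :: "nat \<Rightarrow> (nat word \<times> nat word) set" where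
  "braid_rels n =
     {(pos_word [i, j, i], pos_word [j, i, j]) | i j.
        i \<in> {1..<n} \<and> j \<in> {1..<n} \<and> \<bar>int i - int j\<bar> = 1} \<union>
     {(pos_word [i, j], pos_word [j, i]) | i j.
        i \<in> {1..<n} \<and> j \<in> {1..<n} \<and> \<bar>int i - int j\<bar> \<ge> 2}"

definition braid_group :: "nat \<Rightarrow> nat word set monoid" where
  "braid_group n = presented_group {1..<n} (braid_rels n)"

definition braid_gen :: "nat \<Rightarrow> nat \<Rightarrow> nat word set" where
  "braid_gen n i = pres_gen {1..<n} (braid_rels n) i"

text \<open>The list \<open>\<beta>0 # \<beta>s\<close> is \<open>[\<beta>\<^sub>0, \<dots>, \<beta>\<^sub>q]\<close>.\<close>

definition r1_negative :: "nat \<Rightarrow> nat word set \<Rightarrow> bool" where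
  "r1_negative n \<beta> \<longleftrightarrow>
     (\<exists>\<beta>0 \<beta>s. \<beta>s \<noteq> [] \<and>
        set (\<beta>0 # \<beta>s) \<subseteq> generate (braid_group n) (braid_gen n ` {2..<n}) \<and>
        \<beta> = \<beta>0 \<otimes>\<^bsub>braid_group n\<^esub>
          list_prod (braid_group n)
            (map (\<lambda>b. inv\<^bsub>braid_group n\<^esub> (braid_gen n 1) \<otimes>\<^bsub>braid_group n\<^esub> b) \<beta>s))"

end

(* Let K = <r_2, ..., r_2k> and u = Omega t, so that s = u t u^-1 and G modulo its centre is the
   free product of the groups of order 2 and 2k + 1 generated by Omega and u.

   (1) r_1-negative braids are disjoint from K (Larue's argument, carried out in the free product of
   groups of order two): r_1^-1 sends x_1 to a longer reduced word ending in x_1, and r_1^-1 and all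
   r_i^{+-1} with i > 1 preserve the set of such words.
   (2) A product of at most (2k - 1) j blocks of s, separated by powers of t, with arbitrary integer
   exponents, times Delta^-j is r_1-negative.  One follows the first arc of the punctured disc:
   modulo K on the left, every further block moves it strictly below the next term of an explicit
   sequence of arcs, and after 2k - 1 pairs of blocks this sequence reaches the full twist.
   (3) The alternating form of a in M is a word whose prefixes at block boundaries are not divisible
   by the next letter, and dpt a counts its s-blocks.  Such a word contains no factor Omega, so
   rewriting it in t and v = u^-1 never gets stuck, and it yields a positive word in v and t^{+-1};
   this shows that with d > (2k - 1) j blocks the word times Delta^-j is a power of t, or its
   inverse is of the form in (2).
   Applying (2) and (3) to Delta^j itself gives dpt (Delta^j) = (2k - 1) j + 1, and the theorem
   follows. *)

theory Submission
  imports Defs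
begin

section \<open>Presented groups\<close>

text \<open>The threshold (2k - 1) j arises twice, for different reasons, and the proof lives on the
  agreement. In braids, the full twist corresponds to an arc described by 4k letters. Each block
  gains one letter, except that the first block and the block crossing the doubled top letter gain
  two. Hence 4k - 2 blocks, that is 2k - 1 pairs, stay below it, whatever their exponents. In G,
  adjoin formally a central z with z^(2k-1) = Delta and put w = v z^k. A nontrivial word as in (3)
  with d blocks of s, ending in s and followed by one t, equals a word in w and t^{+-1}, without
  inverses of w, times z^(d-1). Multiplying by Delta^-j leaves z^f with f = d - 1 - (2k-1) j. For f
  >= 0 this is a positive power of w or 1, because z = w^(2k+1), so no inverse of w is left. Pairs
  of w then turn back into blocks of s, to whose inverse the braid estimate applies.\<close>

lemma words_Nil [simp]: "[] \<in> words S"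
  by (simp add: words_def)

lemma words_Cons [simp]: "p # u \<in> words S \<longleftrightarrow> fst p \<in> S \<and> u \<in> words S"
  by (cases p) (auto simp: words_def)

lemma words_append [simp]: "u @ v \<in> words S \<longleftrightarrow> u \<in> words S \<and> v \<in> words S"
  by (auto simp: words_def)

lemma pres_cong_words:
  "(u, v) \<in> pres_cong S R \<Longrightarrow> u \<in> words S \<and> v \<in> words S"
  by (induction rule: pres_cong.induct) auto

lemma equiv_pres_cong: "equiv (words S) (pres_cong S R)"
  by (rule equivI)
    (auto simp: refl_on_def sym_def trans_def dest: pres_cong_words
      intro: pres_cong.refl pres_cong.sym pres_cong.trans)

lemma pres_cong_append_left:
  "(u, v) \<in> pres_cong S R \<Longrightarrow> w \<in> words S \<Longrightarrow> (w @ u, w @ v) \<in> pres_cong S R"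
proof (induction rule: pres_cong.induct)
  case (cancel u v x b)
  then show ?case
    using pres_cong.cancel[of "w @ u" S v x b R] by simp
next
  case (rel u v l r)
  then show ?case
    using pres_cong.rel[of "w @ u" S v l r R] by simp
qed (auto intro: pres_cong.refl pres_cong.sym pres_cong.trans)

lemma pres_cong_append_right:
  "(u, v) \<in> pres_cong S R \<Longrightarrow> w \<in> words S \<Longrightarrow> (u @ w, v @ w) \<in> pres_cong S R"
proof (induction rule: pres_cong.induct)
  case (cancel u v x b)
  then show ?case
    using pres_cong.cancel[of u S "v @ w" x b R] by simp
next
  case (rel u v l r)
  then show ?case
    using pres_cong.rel[of u S "v @ w" l r R] by simp
qed (auto intro: pres_cong.refl pres_cong.sym pres_cong.trans)

lemma pres_cong_append:
  assumes "(u, u') \<in> pres_cong S R" "(v, v') \<in> pres_cong S R"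
  shows "(u @ v, u' @ v') \<in> pres_cong S R"
  using pres_cong_append_left[OF assms(2), of u] pres_cong_append_right[OF assms(1), of v']
    pres_cong_words assms pres_cong.trans by metis

definition word_class :: "'a set \<Rightarrow> ('a word \<times> 'a word) set \<Rightarrow> 'a word \<Rightarrow> 'a word set" where
  "word_class S R u = pres_cong S R `` {u}"

lemma word_class_eq_iff:
  "u \<in> words S \<Longrightarrow> v \<in> words S \<Longrightarrow> word_class S R u = word_class S R v \<longleftrightarrow> (u, v) \<in> pres_cong S R"
  unfolding word_class_def using eq_equiv_class_iff[OF equiv_pres_cong] by metis

lemma carrier_presented_group:
  "carrier (presented_group S R) = word_class S R ` words S"
  by (auto simp: presented_group_def quotient_def word_class_def)

lemma one_presented_group: "\<one>\<^bsub>presented_group S R\<^esub> = word_class S R []"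
  by (simp add: presented_group_def word_class_def)

lemma mult_word_class:
  assumes "u \<in> words S" "v \<in> words S"
  shows "word_class S R u \<otimes>\<^bsub>presented_group S R\<^esub> word_class S R v = word_class S R (u @ v)"
proof -
  have "pres_cong S R `` {a @ b | a b. a \<in> word_class S R u \<and> b \<in> word_class S R v}
      = word_class S R (u @ v)"
    unfolding word_class_def
    using assms by (auto intro: pres_cong.refl pres_cong.trans dest: pres_cong_append)
  then show ?thesis
    by (simp add: presented_group_def)
qed

definition inv_word :: "'a word \<Rightarrow> 'a word" where
  "inv_word u = rev (map (\<lambda>(x, b). (x, \<not> b)) u)"

lemma inv_word_simps [simp]:
  "inv_word [] = []" "inv_word (p # u) = inv_word u @ [(fst p, \<not> snd p)]"
  by (auto simp: inv_word_def split: prod.split)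

lemma inv_word_in_words [simp]: "u \<in> words S \<Longrightarrow> inv_word u \<in> words S"
  by (induction u) auto

lemma inv_word_cancel:
  "u \<in> words S \<Longrightarrow> (inv_word u @ u, []) \<in> pres_cong S R"
proof (induction u)
  case Nil
  show ?case by (simp add: pres_cong.refl)
next
  case (Cons p u)
  have "(inv_word u @ [(fst p, \<not> snd p), (fst p, \<not> \<not> snd p)] @ u, inv_word u @ u) \<in> pres_cong S R"
    using Cons.prems by (intro pres_cong.cancel) auto
  then show ?case
    using Cons by (auto intro: pres_cong.trans)
qed

lemma group_presented_group: "group (presented_group S R)"
proof (rule groupI)
  fix x assume "x \<in> carrier (presented_group S R)"
  then obtain u where u: "u \<in> words S" "x = word_class S R u"
    by (auto simp: carrier_presented_group)
  have "word_class S R (inv_word u) \<otimes>\<^bsub>presented_group S R\<^esub> x = \<one>\<^bsub>presented_group S R\<^esub>"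
    using u by (simp add: mult_word_class one_presented_group word_class_eq_iff inv_word_cancel)
  then show "\<exists>y\<in>carrier (presented_group S R).
      y \<otimes>\<^bsub>presented_group S R\<^esub> x = \<one>\<^bsub>presented_group S R\<^esub>"
    using u(1) by (auto simp: carrier_presented_group)
qed (auto simp: carrier_presented_group mult_word_class one_presented_group)

lemma pres_gen_eq: "pres_gen S R x = word_class S R [(x, True)]"
  by (simp add: pres_gen_def word_class_def pos_word_def)

lemma pres_gen_closed: "x \<in> S \<Longrightarrow> pres_gen S R x \<in> carrier (presented_group S R)"
  by (auto simp: pres_gen_eq carrier_presented_group)

lemma inv_pres_gen:
  assumes "x \<in> S"
  shows "inv\<^bsub>presented_group S R\<^esub> pres_gen S R x = word_class S R [(x, False)]"
proof -
  interpret group "presented_group S R" by (rule group_presented_group)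
  have "word_class S R [(x, False)] \<otimes>\<^bsub>presented_group S R\<^esub> pres_gen S R x = \<one>\<^bsub>presented_group S R\<^esub>"
    using assms inv_word_cancel[of "[(x, True)]" S R]
    by (simp add: pres_gen_eq mult_word_class one_presented_group word_class_eq_iff)
  then show ?thesis
    using assms pres_gen_closed[OF assms, of R]
    by (intro inv_equality) (auto simp: carrier_presented_group[of S R])
qed

lemma list_prod_simps [simp]:
  "list_prod G [] = \<one>\<^bsub>G\<^esub>" "list_prod G (x # xs) = x \<otimes>\<^bsub>G\<^esub> list_prod G xs"
  by (simp_all add: list_prod_def)

lemma (in monoid) list_prod_closed [simp]:
  "set xs \<subseteq> carrier G \<Longrightarrow> list_prod G xs \<in> carrier G"
  by (induction xs) auto

lemma (in monoid) list_prod_append: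
  "set xs \<subseteq> carrier G \<Longrightarrow> set ys \<subseteq> carrier G
    \<Longrightarrow> list_prod G (xs @ ys) = list_prod G xs \<otimes> list_prod G ys"
  by (induction xs) (auto simp: m_assoc)

lemma word_class_pos_word:
  "set xs \<subseteq> S \<Longrightarrow> word_class S R (pos_word xs) = list_prod (presented_group S R) (map (pres_gen S R) xs)"
proof (induction xs)
  case Nil
  show ?case by (simp add: pos_word_def one_presented_group)
next
  case (Cons x xs)
  have w: "pos_word xs \<in> words S"
    using Cons.prems by (induction xs) (auto simp: pos_word_def)
  have "word_class S R (pos_word (x # xs))
      = pres_gen S R x \<otimes>\<^bsub>presented_group S R\<^esub> word_class S R (pos_word xs)"
    using Cons.prems w by (simp add: pres_gen_eq mult_word_class pos_word_def)
  then show ?case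
    using Cons by simp
qed

lemma presented_group_relation:
  assumes "(pos_word xs, pos_word ys) \<in> R" "set xs \<subseteq> S" "set ys \<subseteq> S"
  shows "list_prod (presented_group S R) (map (pres_gen S R) xs)
    = list_prod (presented_group S R) (map (pres_gen S R) ys)"
proof -
  have w: "set zs \<subseteq> S \<Longrightarrow> pos_word zs \<in> words S" for zs
    by (induction zs) (auto simp: pos_word_def)
  have "(pos_word xs, pos_word ys) \<in> pres_cong S R"
    using pres_cong.rel[of "[]" S "[]" "pos_word xs" "pos_word ys" R] w assms by simp
  then show ?thesis
    using assms w by (simp flip: word_class_pos_word add: word_class_eq_iff)
qed

lemma carrier_presented_group_generate:
  "carrier (presented_group S R) = generate (presented_group S R) (pres_gen S R ` S)"
proof -
  interpret group "presented_group S R" by (rule group_presented_group)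
  have gens: "pres_gen S R ` S \<subseteq> carrier (presented_group S R)"
    by (auto simp: pres_gen_closed)
  have "u \<in> words S \<Longrightarrow> word_class S R u \<in> generate (presented_group S R) (pres_gen S R ` S)" for u
  proof (induction u)
    case Nil
    then show ?case by (simp flip: one_presented_group add: generate.one)
  next
    case (Cons p u)
    obtain x b where p: "p = (x, b)" by (cases p)
    have "word_class S R (p # u) = word_class S R [p] \<otimes>\<^bsub>presented_group S R\<^esub> word_class S R u"
      using Cons.prems by (simp add: mult_word_class)
    moreover have "word_class S R [p] \<in> generate (presented_group S R) (pres_gen S R ` S)"
    proof (cases b)
      case True
      then show ?thesis
        using Cons.prems p by (auto simp flip: pres_gen_eq intro: generate.incl)
    next
      case False
      then show ?thesis
        using Cons.prems p by (auto simp flip: inv_pres_gen intro: generate.inv)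
    qed
    ultimately show ?case
      using Cons by (auto intro: generate.eng)
  qed
  then show ?thesis
    using generate_incl[OF gens] by (auto simp: carrier_presented_group)
qed

text \<open>Only the letters are restricted to \<open>T\<close>; the class is still taken over
  \<open>S\<close>. Elements of the subgroup \<open>K\<close> below are thus represented by braid
  words that avoid the letter 1.\<close>

lemma generate_pres_gen_word:
  assumes "T \<subseteq> S" "\<beta> \<in> generate (presented_group S R) (pres_gen S R ` T)"
  shows "\<exists>u \<in> words T. \<beta> = word_class S R u"
  using assms(2)
proof (induction rule: generate.induct)
  case one
  then show ?case
    using one_presented_group words_Nil by metis
next
  case (incl h)
  then show ?case
    by (force simp: pres_gen_eq)
next
  case (inv h)
  then obtain x where "x \<in> T" "h = pres_gen S R x" by auto
  then show ?case
    using assms(1) inv_pres_gen[of x S R]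
    by (intro bexI[of _ "[(x, False)]"]) auto
next
  case (eng h1 h2)
  then obtain u v where uv: "u \<in> words T" "h1 = word_class S R u" "v \<in> words T" "h2 = word_class S R v"
    by auto
  moreover have "words T \<subseteq> words S"
    using assms(1) unfolding words_def by (intro lists_mono) auto
  ultimately show ?case
    using mult_word_class[of u S v R] by (intro bexI[of _ "u @ v"]) auto
qed

text \<open>The universal property of a presentation, phrased without quotients: mutually inverse
  maps on \<open>X\<close> that satisfy the relations let words act through their classes. It serves
  for the braid action on reduced words and, on the integers, for the exponent sum.\<close>

lemma pres_cong_action:
  assumes "(u, v) \<in> pres_cong S R"
    and closed: "\<And>x b p. x \<in> S \<Longrightarrow> p \<in> X \<Longrightarrow> f (x, b) p \<in> X"
    and inverse: "\<And>x b p. x \<in> S \<Longrightarrow> p \<in> X \<Longrightarrow> f (x, b) (f (x, \<not> b) p) = p"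
    and rel: "\<And>l r p. (l, r) \<in> R \<Longrightarrow> l \<in> words S \<Longrightarrow> r \<in> words S \<Longrightarrow> p \<in> X
      \<Longrightarrow> foldr f l p = foldr f r p"
    and "p \<in> X"
  shows "foldr f u p = foldr f v p"
proof -
  have cl: "u \<in> words S \<Longrightarrow> p \<in> X \<Longrightarrow> foldr f u p \<in> X" for u p
    by (induction u) (auto simp: closed)
  show ?thesis
    using assms(1) \<open>p \<in> X\<close>
    by (induction arbitrary: p rule: pres_cong.induct)
      (simp_all add: cl inverse rel)
qed

section \<open>The braid action on a free product of groups of order two\<close>

text \<open>Reduced words in the free product of groups of order two are lists without equal neighbours;
  \<open>push\<close> multiplies by a generator on the left.\<close>

definition reduced :: "nat list \<Rightarrow> bool" where
  "reduced w \<longleftrightarrow> distinct_adj w"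

definition push :: "nat \<Rightarrow> nat list \<Rightarrow> nat list" where
  "push a w = (if w \<noteq> [] \<and> hd w = a then tl w else a # w)"

lemma reduced_simps [simp]:
  "reduced []" "reduced [a]" "reduced (a # b # w) \<longleftrightarrow> a \<noteq> b \<and> reduced (b # w)"
  by (simp_all add: reduced_def)

lemma reduced_tl: "reduced (a # w) \<Longrightarrow> reduced w"
  by (cases w) auto

lemma reduced_push: "reduced w \<Longrightarrow> reduced (push a w)"
  by (cases w) (auto simp: push_def dest: reduced_tl)

lemma push_push: "reduced w \<Longrightarrow> push a (push a w) = w"
proof (cases w)
  case (Cons b v)
  assume "reduced w"
  then show ?thesis
    using Cons by (cases v) (auto simp: push_def)
qed (simp add: push_def)

lemma reduced_foldr_push: "reduced w \<Longrightarrow> reduced (foldr push u w)"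
  by (induction u) (auto simp: reduced_push)

lemma foldr_push_reduced: "reduced w \<Longrightarrow> foldr push w [] = w"
proof (induction w)
  case (Cons a w)
  then show ?case
    by (cases w) (auto simp: push_def dest: reduced_tl)
qed simp

text \<open>Artin's automorphism on the generators; its inverse exchanges the roles of \<open>a\<close> and \<open>b\<close>.\<close>

definition twist :: "nat \<Rightarrow> nat \<Rightarrow> nat \<Rightarrow> nat list" where
  "twist a b x = (if x = a then [a, b, a] else if x = b then [a] else [x])"

definition twist_word :: "nat \<Rightarrow> nat \<Rightarrow> nat list \<Rightarrow> nat list" where
  "twist_word a b w = foldr (\<lambda>x. foldr push (twist a b x)) w []"

text \<open>Each image \<open>twist a b x\<close> is a palindrome, hence of order two in the free
  product. This is why \<open>twist_word\<close> respects the cancellations made by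
  \<open>push\<close>.\<close>

lemma foldr_push_twist_cancel:
  "reduced w \<Longrightarrow> foldr push (twist a b x) (foldr push (twist a b x) w) = w"
  by (simp add: twist_def push_push reduced_push)

lemma foldr_twist_push:
  assumes "reduced w" "reduced v"
  shows "foldr (\<lambda>x. foldr push (twist a b x)) (push c v) w
    = foldr push (twist a b c) (foldr (\<lambda>x. foldr push (twist a b x)) v w)"
proof -
  have red: "reduced (foldr (\<lambda>x. foldr push (twist a b x)) u w)" for u
    by (induction u) (auto simp: assms reduced_foldr_push)
  show ?thesis
  proof (cases "v \<noteq> [] \<and> hd v = c")
    case True
    then obtain v' where "v = c # v'" by (cases v) auto
    then show ?thesis
      by (simp add: push_def foldr_push_twist_cancel red)
  qed (auto simp: push_def)
qed

lemma reduced_twist_word: "reduced (twist_word a b w)"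
  unfolding twist_word_def by (induction w) (auto simp: reduced_foldr_push)

lemma twist_word_push:
  "reduced w \<Longrightarrow> twist_word a b (push c w) = foldr push (twist a b c) (twist_word a b w)"
  unfolding twist_word_def by (simp add: foldr_twist_push)

lemma twist_word_Nil [simp]: "twist_word a b [] = []"
  by (simp add: twist_word_def)

lemma twist_word_Cons [simp]:
  "twist_word a b (x # w) = foldr push (twist a b x) (twist_word a b w)"
  by (simp add: twist_word_def)

text \<open>The homomorphism property. With it the inverse, commutation and braid laws reduce to a
  check on single generators.\<close>

lemma twist_word_foldr_push:
  "reduced w \<Longrightarrow> twist_word a b (foldr push u w)
    = foldr (\<lambda>x. foldr push (twist a b x)) u (twist_word a b w)"
  by (induction u) (simp_all add: twist_word_push reduced_foldr_push)

lemma twist_word_inverse: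
  assumes "a \<noteq> b" "reduced w"
  shows "twist_word a b (twist_word b a w) = w"
  using assms(2)
proof (induction w)
  case (Cons x w)
  have IH: "twist_word a b (twist_word b a w) = w"
    using Cons reduced_tl by blast
  have red: "reduced w"
    using Cons.prems reduced_tl by blast
  have "foldr (\<lambda>x. foldr push (twist a b x)) (twist b a x) w = push x w"
    using assms(1) red by (auto simp: twist_def push_push reduced_push)
  then show ?case
    using IH Cons.prems foldr_push_reduced[of "x # w"] foldr_push_reduced[OF red]
    by (simp add: twist_word_foldr_push reduced_twist_word)
qed simp

lemma twist_word_commute:
  assumes "{a, b} \<inter> {c, d} = {}" "reduced w"
  shows "twist_word a b (twist_word c d w) = twist_word c d (twist_word a b w)"
proof (induction w)
  case (Cons x w)
  then show ?case
    using assms(1)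
    by (auto simp: twist_word_foldr_push reduced_twist_word twist_def)
qed simp

lemma twist_word_braid:
  assumes "a \<noteq> b" "b \<noteq> c" "a \<noteq> c"
  shows "twist_word a b (twist_word b c (twist_word a b w))
    = twist_word b c (twist_word a b (twist_word b c w))"
proof (induction w)
  case (Cons x w)
  then show ?case
    using assms
    by (simp add: twist_word_foldr_push reduced_twist_word reduced_foldr_push)
      (simp add: twist_def push_push reduced_push reduced_twist_word twist_word_push)
qed simp

text \<open>The claim on the last letter is not inductive by itself: a new first letter multiplies
  by up to three generators, and only knowledge of how the image begins shows that cancellation
  stops before its end. With \<open>b = 1\<close> the final 1 could be sent to
  \<open>a\<close>.\<close>

lemma twist_word_last:
  assumes "reduced w" "w \<noteq> []" "last w = 1" "a \<noteq> b" "b \<noteq> 1"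
  shows "twist_word a b w \<noteq> [] \<and> last (twist_word a b w) = 1 \<and>
    (if hd w = a then \<exists>y. twist_word a b w = a # b # y
     else if hd w = b then (\<exists>y. twist_word a b w = b # y) \<or>
       (\<exists>c y. twist_word a b w = a # c # y \<and> c \<noteq> a \<and> c \<noteq> b)
     else twist_word a b w = hd w # twist_word a b (tl w))"
  using assms(1-3)
proof (induction w)
  case (Cons x w)
  show ?case
  proof (cases w)
    case Nil
    then show ?thesis
      using Cons.prems assms(4,5) by (auto simp: twist_def push_def)
  next
    case (Cons y v)
    then have r: "reduced w" "w \<noteq> []" "last w = 1" "hd w = y" "x \<noteq> y"
      using Cons.prems by auto
    note IH = Cons.IH[OF r(1-3)]
    consider "y = a" | "y = b" | "y \<noteq> a" "y \<noteq> b" by blast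
    then show ?thesis
    proof cases
      case 1
      then show ?thesis
        using IH r assms(4,5) by (auto simp: twist_def push_def)
    next
      case 2
      then show ?thesis
        using IH r assms(4,5) by (auto simp: twist_def push_def split: if_splits)
    next
      case 3
      then show ?thesis
        using IH r assms(4,5) by (auto simp: twist_def push_def)
    qed
  qed
qed simp

text \<open>Only the third case of \<open>twist_word_last\<close> could give \<open>[1]\<close>.
  Then the tail would have empty image, which the same lemma excludes because the tail again ends in
  1.\<close>

lemma twist_word_last_ne:
  assumes "reduced w" "w \<noteq> []" "last w = 1" "a \<noteq> b" "b \<noteq> 1" "w \<noteq> [1] \<or> a = 1"
  shows "twist_word a b w \<noteq> [1]"
proof
  assume *: "twist_word a b w = [1]"
  note L = twist_word_last[OF assms(1-5)]
  have "hd w \<noteq> a" "hd w \<noteq> b" "twist_word a b (tl w) = []"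
    using * L assms(4,5) by (auto split: if_splits)
  moreover have "tl w \<noteq> []"
  proof
    assume "tl w = []"
    then have "w = [1]"
      using assms(2,3) by (cases w) auto
    then show False
      using assms(6) \<open>hd w \<noteq> a\<close> by simp
  qed
  moreover have "reduced (tl w)" "last (tl w) = 1"
    using assms(1-3) \<open>tl w \<noteq> []\<close> by (cases w; auto dest: reduced_tl)+
  ultimately show False
    using twist_word_last[of "tl w" a b] assms(4,5) by blast
qed

lemma (in group) int_pow_intertwine:
  fixes e :: int
  assumes "a \<otimes> y = y \<otimes> b" and cl [simp]: "a \<in> carrier G" "b \<in> carrier G" "y \<in> carrier G"
  shows "a [^] e \<otimes> y = y \<otimes> b [^] e"
proof -
  have nat: "a [^] (k::nat) \<otimes> y = y \<otimes> b [^] k" for k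
  proof (induction k)
    case (Suc k)
    have "a [^] Suc k \<otimes> y = a [^] k \<otimes> (a \<otimes> y)"
      by (simp add: m_assoc)
    also have "\<dots> = (a [^] k \<otimes> y) \<otimes> b"
      unfolding assms(1) by (simp add: m_assoc)
    finally show ?case
      unfolding Suc by (simp add: m_assoc)
  qed simp
  show ?thesis
  proof (cases e)
    case (nonneg k)
    then show ?thesis by (simp add: int_pow_int nat)
  next
    case (neg k)
    define A B where AB: "A = a [^] Suc k" "B = b [^] Suc k"
    have [simp]: "A \<in> carrier G" "B \<in> carrier G"
      by (simp_all add: AB)
    have "inv A \<otimes> y = inv A \<otimes> (y \<otimes> B) \<otimes> inv B"
      by (simp add: m_assoc)
    also have "\<dots> = inv A \<otimes> (A \<otimes> y) \<otimes> inv B"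
      using nat[of "Suc k"] unfolding AB by (simp only:)
    also have "\<dots> = y \<otimes> inv B"
      by (simp add: m_assoc[symmetric])
    finally show ?thesis
      unfolding neg AB by (simp add: int_pow_neg_int del: nat_pow_Suc of_nat_Suc)
  qed
qed

section \<open>Negative elements of groups generated like the braid group\<close>

text \<open>The computations with arcs are consequences of the braid relations and are done for any
  elements satisfying them. The actual braid group enters through its action on reduced words, which
  separates \<open>Neg\<close> from \<open>K\<close>.\<close>

locale braid_like = group B for B (structure) +
  fixes r :: "nat \<Rightarrow> 'a" and n :: nat
  assumes n_ge: "n \<ge> 3"
    and r_closed: "1 \<le> i \<Longrightarrow> i < n \<Longrightarrow> r i \<in> carrier B"
    and r_braid: "1 \<le> i \<Longrightarrow> Suc i < n
      \<Longrightarrow> r i \<otimes> r (Suc i) \<otimes> r i = r (Suc i) \<otimes> r i \<otimes> r (Suc i)"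
    and r_comm: "1 \<le> i \<Longrightarrow> i + 2 \<le> j \<Longrightarrow> j < n \<Longrightarrow> r i \<otimes> r j = r j \<otimes> r i"
begin

definition K :: "'a set" where
  "K = generate B (r ` {2..<n})"

inductive_set Neg :: "'a set" where
  base: "\<kappa> \<in> K \<Longrightarrow> \<kappa>' \<in> K \<Longrightarrow> \<kappa> \<otimes> inv r 1 \<otimes> \<kappa>' \<in> Neg"
| step: "\<kappa> \<in> K \<Longrightarrow> \<nu> \<in> Neg \<Longrightarrow> \<kappa> \<otimes> inv r 1 \<otimes> \<nu> \<in> Neg"

lemma r1_closed [simp]: "r (Suc 0) \<in> carrier B"
  using r_closed[of 1] n_ge by simp

lemma subgroup_K: "subgroup K B"
  unfolding K_def by (intro generate_is_subgroup) (auto intro: r_closed)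

lemma K_carrier [simp]: "\<kappa> \<in> K \<Longrightarrow> \<kappa> \<in> carrier B"
  using subgroup.subset[OF subgroup_K] by blast

lemma K_one [simp]: "\<one> \<in> K"
  by (rule subgroup.one_closed[OF subgroup_K])

lemma K_mult [simp]: "\<kappa> \<in> K \<Longrightarrow> \<kappa>' \<in> K \<Longrightarrow> \<kappa> \<otimes> \<kappa>' \<in> K"
  by (rule subgroup.m_closed[OF subgroup_K])

lemma K_inv [simp]: "\<kappa> \<in> K \<Longrightarrow> inv \<kappa> \<in> K"
  by (rule subgroup.m_inv_closed[OF subgroup_K])

lemma K_pow [simp]: "\<kappa> \<in> K \<Longrightarrow> \<kappa> [^] (e::int) \<in> K"
  by (rule subgroup_int_pow_closed[OF subgroup_K])

lemma r_in_K: "2 \<le> i \<Longrightarrow> i < n \<Longrightarrow> r i \<in> K"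
  unfolding K_def by (auto intro: generate.incl)

lemma Neg_carrier [simp]: "\<nu> \<in> Neg \<Longrightarrow> \<nu> \<in> carrier B"
  by (induction rule: Neg.induct) auto

lemma Neg_K_left: "\<nu> \<in> Neg \<Longrightarrow> \<kappa> \<in> K \<Longrightarrow> \<kappa> \<otimes> \<nu> \<in> Neg"
proof (induction rule: Neg.induct)
  case (base \<kappa>1 \<kappa>2)
  then show ?case using Neg.base[of "\<kappa> \<otimes> \<kappa>1" \<kappa>2] by (simp add: m_assoc)
next
  case (step \<kappa>1 \<nu>)
  then show ?case using Neg.step[of "\<kappa> \<otimes> \<kappa>1" \<nu>] by (simp add: m_assoc)
qed

lemma Neg_K_right: "\<nu> \<in> Neg \<Longrightarrow> \<kappa> \<in> K \<Longrightarrow> \<nu> \<otimes> \<kappa> \<in> Neg"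
proof (induction rule: Neg.induct)
  case (base \<kappa>1 \<kappa>2)
  then show ?case using Neg.base[of \<kappa>1 "\<kappa>2 \<otimes> \<kappa>"] by (simp add: m_assoc)
next
  case (step \<kappa>1 \<nu>)
  then show ?case using Neg.step[of \<kappa>1 "\<nu> \<otimes> \<kappa>"] by (simp add: m_assoc)
qed

lemma Neg_mult: "\<nu> \<in> Neg \<Longrightarrow> \<nu>' \<in> Neg \<Longrightarrow> \<nu> \<otimes> \<nu>' \<in> Neg"
proof (induction rule: Neg.induct)
  case (base \<kappa>1 \<kappa>2)
  then show ?case using Neg.step[of \<kappa>1 "\<kappa>2 \<otimes> \<nu>'"] by (simp add: m_assoc Neg_K_left)
next
  case (step \<kappa>1 \<nu>)
  then show ?case using Neg.step[of \<kappa>1 "\<nu> \<otimes> \<nu>'"] by (simp add: m_assoc)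
qed

lemma Neg_iff_list:
  "\<beta> \<in> Neg \<longleftrightarrow> (\<exists>\<beta>0 \<beta>s. \<beta>s \<noteq> [] \<and> set (\<beta>0 # \<beta>s) \<subseteq> K \<and>
     \<beta> = \<beta>0 \<otimes> list_prod B (map (\<lambda>b. inv r 1 \<otimes> b) \<beta>s))" (is "_ \<longleftrightarrow> ?R \<beta>")
proof
  assume "\<beta> \<in> Neg"
  then show "?R \<beta>"
  proof (induction rule: Neg.induct)
    case (base \<kappa> \<kappa>')
    then show ?case
      by (intro exI[of _ \<kappa>] exI[of _ "[\<kappa>']"]) (auto simp: m_assoc)
  next
    case (step \<kappa> \<nu>)
    then obtain \<beta>0 \<beta>s where *: "\<beta>s \<noteq> []" "set (\<beta>0 # \<beta>s) \<subseteq> K"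
      "\<nu> = \<beta>0 \<otimes> list_prod B (map (\<lambda>b. inv r 1 \<otimes> b) \<beta>s)" by blast
    then have "list_prod B (map (\<lambda>b. inv r 1 \<otimes> b) \<beta>s) \<in> carrier B"
      by (intro list_prod_closed) auto
    then show ?case
      using * step(1) by (intro exI[of _ \<kappa>] exI[of _ "\<beta>0 # \<beta>s"]) (auto simp: m_assoc)
  qed
next
  have "\<beta>s \<noteq> [] \<Longrightarrow> set (\<beta>0 # \<beta>s) \<subseteq> K \<Longrightarrow>
     \<beta>0 \<otimes> list_prod B (map (\<lambda>b. inv r 1 \<otimes> b) \<beta>s) \<in> Neg" for \<beta>0 \<beta>s
  proof (induction \<beta>s arbitrary: \<beta>0)
    case (Cons b \<beta>s)
    show ?case
    proof (cases "\<beta>s = []")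
      case True
      then show ?thesis
        using Cons.prems Neg.base[of \<beta>0 b] by (simp add: m_assoc)
    next
      case False
      then have "b \<otimes> list_prod B (map (\<lambda>b. inv r 1 \<otimes> b) \<beta>s) \<in> Neg"
        using Cons by auto
      moreover have "list_prod B (map (\<lambda>b. inv r 1 \<otimes> b) \<beta>s) \<in> carrier B"
        using Cons.prems by (intro list_prod_closed) auto
      ultimately show ?thesis
        using Cons.prems Neg.step[of \<beta>0] by (simp add: m_assoc)
    qed
  qed simp
  then show "?R \<beta> \<Longrightarrow> \<beta> \<in> Neg" by blast
qed

text \<open>The arcs from the base point that pass below the punctures and return above them:
  \<open>\<rho> i\<close> is the product of the first \<open>i\<close> letters of
  \<open>r\<^sub>1 \<cdots> r\<^bsub>n-1\<^esub> r\<^bsub>n-1\<^esub> \<cdots> r\<^sub>1\<close>.\<close>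

definition letter :: "nat \<Rightarrow> nat" where
  "letter i = (if i < n then i else 2 * n - 1 - i)"

fun \<rho> :: "nat \<Rightarrow> 'a" where
  "\<rho> 0 = \<one>"
| "\<rho> (Suc i) = \<rho> i \<otimes> r (letter (Suc i))"

lemma letter_low [simp]: "i < n \<Longrightarrow> letter i = i"
  by (simp add: letter_def)

lemma letter_high: "n \<le> i \<Longrightarrow> Suc i \<le> 2 * n \<Longrightarrow> letter i + Suc i = 2 * n"
  by (simp add: letter_def)

lemma letter_range:
  assumes "1 \<le> i" "i \<le> 2 * n - 2"
  shows "1 \<le> letter i \<and> letter i < n"
proof (cases "i < n")
  case False
  then show ?thesis using letter_high[of i] assms n_ge by linarith
qed (use assms in simp)

lemma letter_adjacent:
  assumes "Suc i \<le> 2 * n - 2"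
  shows "letter (Suc i) = letter i \<or> letter (Suc i) = Suc (letter i)
    \<or> letter i = Suc (letter (Suc i))"
proof -
  have le: "Suc i + 2 \<le> 2 * n" using assms n_ge by linarith
  consider "Suc i < n" | "Suc i = n" | "n \<le> i" by linarith
  then show ?thesis
  proof cases
    case 2
    then show ?thesis using le letter_high[of "Suc i"] by simp
  next
    case 3
    then show ?thesis using le letter_high[of i] letter_high[of "Suc i"] by linarith
  qed simp
qed

text \<open>The letters rise to \<open>n - 1\<close>, which occurs twice in a row, and fall again. A
  window of three consecutive positions meets the doubled letter in its last two places, in its
  first two, or not at all.\<close>

lemma letter_cases:
  assumes "Suc (Suc i) \<le> 2 * n - 1"
  obtains
    (ascend) "letter (Suc (Suc i)) = Suc (letter (Suc i))" "letter (Suc i) = Suc (letter i)"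
      "letter i = i" "Suc (Suc i) \<noteq> n"
  | (top) "letter (Suc (Suc i)) = letter (Suc i)" "letter (Suc i) = Suc (letter i)"
      "letter i = i" "Suc (Suc i) = n"
  | (turn) "letter (Suc i) = Suc (letter (Suc (Suc i)))" "letter (Suc i) = letter i"
      "letter i = i" "Suc i = n"
  | (descend) "letter (Suc i) = Suc (letter (Suc (Suc i)))" "letter i = Suc (letter (Suc i))"
      "n \<le> i"
proof -
  have le: "Suc (Suc i) + 1 \<le> 2 * n" using assms n_ge by linarith
  consider "Suc (Suc i) < n" | "Suc (Suc i) = n" | "Suc i = n" | "n \<le> i" by linarith
  then show thesis
  proof cases
    case 1
    then show ?thesis by (intro ascend) simp_all
  next
    case 2
    then have "letter i = i" "letter (Suc i) = Suc i" "letter (Suc (Suc i)) = Suc i"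
      using le letter_low[of i] letter_low[of "Suc i"] letter_high[of "Suc (Suc i)"] by linarith+
    with 2 show ?thesis by (intro top) linarith+
  next
    case 3
    then have "letter (Suc i) = Suc (letter (Suc (Suc i)))" "letter i = i" "letter (Suc i) = i"
      using le letter_low[of i] letter_high[of "Suc (Suc i)"] letter_high[of "Suc i"] by linarith+
    with 3 show ?thesis by (intro turn) linarith+
  next
    case 4
    then have "letter (Suc i) = Suc (letter (Suc (Suc i)))" "letter i = Suc (letter (Suc i))"
      using le letter_high[of "Suc (Suc i)"] letter_high[of "Suc i"] letter_high[of i] by linarith+
    with 4 show ?thesis by (intro descend)
  qed
qed

lemma letter_adjacent_ne:
  assumes "Suc i \<le> 2 * n - 2" "j = Suc (letter (Suc i)) \<or> letter (Suc i) = Suc j"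
    "j \<noteq> letter (Suc (Suc i))" "1 \<le> j" "j < n"
  shows "i \<noteq> 0 \<and> j = letter i"
proof -
  have le: "Suc (Suc i) \<le> 2 * n - 1" using assms(1) n_ge by linarith
  then have "j = letter i"
    by (cases rule: letter_cases) (use assms(2-5) in linarith)+
  then show ?thesis
    using assms(4) n_ge by (cases "i = 0") simp_all
qed

lemma letter_no_return:
  assumes "Suc (Suc i) \<le> 2 * n - 2" "letter (Suc (Suc i)) \<noteq> letter (Suc i)"
  shows "letter (Suc (Suc i)) \<noteq> letter i
    \<and> (letter (Suc (Suc i)) < letter i \<longleftrightarrow> letter (Suc (Suc i)) < letter (Suc i))"
proof -
  have le: "Suc (Suc i) \<le> 2 * n - 1" using assms(1) by linarith
  then show ?thesis
    by (cases rule: letter_cases) (use assms(2) in linarith)+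
qed

lemma letter_adjacent_turn:
  assumes "Suc (Suc i) \<le> 2 * n - 2" "Suc i \<noteq> n - 1"
  shows "letter (Suc i) = Suc (letter (Suc (Suc i))) \<or> letter (Suc (Suc i)) = Suc (letter (Suc i))"
proof -
  have le: "Suc (Suc i) \<le> 2 * n - 1" using assms(1) by linarith
  then show ?thesis
    by (cases rule: letter_cases) (use assms(2) in linarith)+
qed

lemma r_letter_closed [simp]: "1 \<le> i \<Longrightarrow> i \<le> 2 * n - 2 \<Longrightarrow> r (letter i) \<in> carrier B"
  using letter_range r_closed by blast

lemma \<rho>_closed [simp]: "i \<le> 2 * n - 2 \<Longrightarrow> \<rho> i \<in> carrier B"
  by (induction i) auto

lemma r_comm': "1 \<le> i \<Longrightarrow> 1 \<le> j \<Longrightarrow> i < n \<Longrightarrow> j < n \<Longrightarrow> i \<noteq> Suc j \<Longrightarrow> j \<noteq> Suc i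
    \<Longrightarrow> r i \<otimes> r j = r j \<otimes> r i"
  using r_comm[of i j] r_comm[of j i] by (cases i j rule: linorder_cases) auto

text \<open>Geometrically \<open>r j\<close> misses the end of the arc and is only relabelled when
  moved through. The added bounds place the new index between 2 and \<open>n - 1\<close>, so that
  the relabelled generator lies in \<open>K\<close>.\<close>

lemma \<rho>_pull:
  assumes "i \<le> 2 * n - 2" "1 \<le> j" "j < n" "j \<noteq> letter i" "j \<noteq> letter (Suc i)"
  shows "\<rho> i \<otimes> r j = r (if j < letter i then Suc j else j) \<otimes> \<rho> i \<and>
    (j < letter i \<longrightarrow> Suc j < n) \<and> (letter i < j \<longrightarrow> 2 \<le> j)"
  using assms
proof (induction i arbitrary: j rule: less_induct)
  case (less i)
  show ?case
  proof (cases i)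
    case 0
    then show ?thesis
      using less.prems n_ge r_closed[of j] by (auto simp: letter_def)
  next
    case (Suc i')
    let ?c = "letter i"
    have c: "1 \<le> ?c" "?c < n"
      using letter_range[of i] less.prems Suc by auto
    have cl: "\<rho> i' \<in> carrier B" "r ?c \<in> carrier B" "r j \<in> carrier B"
      using less.prems Suc c r_closed by auto
    show ?thesis
    proof (cases "j = Suc ?c \<or> ?c = Suc j")
      case False
      then have cm: "r ?c \<otimes> r j = r j \<otimes> r ?c"
        using r_comm' c less.prems by blast
      have "j \<noteq> letter i'" "j \<noteq> letter (Suc i')" "j < letter i' \<longleftrightarrow> j < ?c"
        using False less.prems Suc letter_adjacent[of i'] by auto
      then have IH: "\<rho> i' \<otimes> r j = r (if j < ?c then Suc j else j) \<otimes> \<rho> i'"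
        "j < ?c \<longrightarrow> Suc j < n" "letter i' < j \<longrightarrow> 2 \<le> j"
        using less.IH[of i' j] less.prems Suc by auto
      let ?j' = "if j < ?c then Suc j else j"
      have j': "r ?j' \<in> carrier B"
        using IH less.prems r_closed by auto
      have "\<rho> i \<otimes> r j = \<rho> i' \<otimes> (r ?c \<otimes> r j)"
        using cl Suc by (simp add: m_assoc)
      also have "\<dots> = (\<rho> i' \<otimes> r j) \<otimes> r ?c"
        unfolding cm using cl by (simp add: m_assoc)
      also have "\<dots> = r ?j' \<otimes> \<rho> i"
        unfolding IH(1) using cl j' Suc by (simp add: m_assoc)
      finally show ?thesis
        using IH(2) c by auto
    next
      case True
      \<comment> \<open>A neighbour of the last letter \<open>?c\<close> that is not the next letter
        must be the previous one. So \<open>\<rho> i\<close> ends in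
        \<open>r j \<otimes> r ?c\<close>, the braid relation exchanges the roles of
        \<open>j\<close> and \<open>?c\<close>, and the induction continues with \<open>r ?c\<close>
        two letters earlier.\<close>
      then have "i' \<noteq> 0" "j = letter i'"
        using less.prems Suc True letter_adjacent_ne[of i' j] by auto
      then obtain i'' where i'': "i' = Suc i''" "j = letter i'"
        by (cases i') auto
      have adj: "j = Suc ?c \<or> ?c = Suc j" by (rule True)
      have ne: "?c \<noteq> letter i''" "?c \<noteq> letter (Suc i'')" "?c < letter i'' \<longleftrightarrow> ?c < j"
        using adj less.prems Suc i'' letter_no_return[of i''] by auto
      let ?c' = "if ?c < j then Suc ?c else ?c"
      have IH: "\<rho> i'' \<otimes> r ?c = r ?c' \<otimes> \<rho> i''" "?c < j \<longrightarrow> Suc ?c < n"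
        using less.IH[of i'' ?c] less.prems Suc i'' c ne by auto
      have c': "?c' = (if j < ?c then Suc j else j)"
        using adj by auto
      have cl2: "\<rho> i'' \<in> carrier B" "r ?c' \<in> carrier B"
        using less.prems Suc i'' c IH(2) r_closed by auto
      have br: "r j \<otimes> r ?c \<otimes> r j = r ?c \<otimes> r j \<otimes> r ?c"
        using adj r_braid[of j] r_braid[of ?c] less.prems c by auto
      have "\<rho> i \<otimes> r j = \<rho> i'' \<otimes> (r j \<otimes> r ?c \<otimes> r j)"
        using cl cl2 Suc i'' by (simp add: m_assoc)
      also have "\<dots> = (\<rho> i'' \<otimes> r ?c) \<otimes> (r j \<otimes> r ?c)"
        unfolding br using cl cl2 by (simp add: m_assoc)
      also have "\<dots> = r ?c' \<otimes> \<rho> i"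
        unfolding IH(1) using cl cl2 Suc i'' by (simp add: m_assoc)
      finally show ?thesis
        using c' c less.prems by auto
    qed
  qed
qed

lemma \<rho>_pull_K:
  assumes "i \<le> 2 * n - 2" "1 \<le> j" "j < n" "j \<noteq> letter i" "j \<noteq> letter (Suc i)"
  shows "\<exists>\<kappa>\<in>K. \<rho> i \<otimes> r j = \<kappa> \<otimes> \<rho> i"
proof -
  have "2 \<le> (if j < letter i then Suc j else j)" "(if j < letter i then Suc j else j) < n"
    using \<rho>_pull[OF assms] assms by (auto split: if_splits)
  then show ?thesis
    using \<rho>_pull[OF assms] r_in_K by blast
qed

text \<open>Lengthening the arc by one letter costs one \<open>r 1\<close> up to \<open>K\<close> on
  both sides. For consecutive letters a, b the braid relation gives a b a^-1 = b^-1 a b, and b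
  passes \<open>\<rho> i\<close> into \<open>K\<close>; so conjugating b by
  \<open>\<rho> (Suc i)\<close> gives the same double coset as conjugating a by
  \<open>\<rho> i\<close>.\<close>

lemma \<rho>_conj_letter:
  assumes "Suc i \<le> 2 * n - 2"
  shows "\<exists>\<kappa>\<in>K. \<exists>\<kappa>'\<in>K. \<rho> (Suc i) = \<kappa> \<otimes> r 1 \<otimes> \<kappa>' \<otimes> \<rho> i"
  using assms
proof (induction i)
  case 0
  have "letter 1 = 1" using n_ge by (simp add: letter_def)
  then show ?case
    by (intro bexI[of _ \<one>]) auto
next
  case (Suc i)
  then obtain \<kappa> \<kappa>' where k: "\<kappa> \<in> K" "\<kappa>' \<in> K" "\<rho> (Suc i) = \<kappa> \<otimes> r 1 \<otimes> \<kappa>' \<otimes> \<rho> i"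
    by auto
  let ?a = "r (letter (Suc i))" and ?b = "r (letter (Suc (Suc i)))"
  have cl: "\<rho> i \<in> carrier B" "?a \<in> carrier B" "?b \<in> carrier B" "\<kappa> \<in> carrier B" "\<kappa>' \<in> carrier B"
    using Suc.prems k by auto
  show ?case
  proof (cases "Suc i = n - 1")
    \<comment> \<open>At the doubled top letter the arc grows twice by the same factor on the
      left.\<close>
    case True
    then have eq: "letter (Suc (Suc i)) = letter (Suc i)"
      using n_ge letter_high[of "Suc (Suc i)"] letter_low[of "Suc i"] by linarith
    have "\<rho> (Suc (Suc i)) = (\<kappa> \<otimes> r 1 \<otimes> \<kappa>' \<otimes> \<rho> i) \<otimes> ?a"
      unfolding \<rho>.simps(2)[of "Suc i"] eq k(3) ..
    also have "\<dots> = \<kappa> \<otimes> r 1 \<otimes> \<kappa>' \<otimes> \<rho> (Suc i)"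
      using cl by (simp add: m_assoc)
    finally show ?thesis using k by blast
  next
    case False
    have adj: "letter (Suc i) = Suc (letter (Suc (Suc i))) \<or> letter (Suc (Suc i)) = Suc (letter (Suc i))"
      by (rule letter_adjacent_turn[OF Suc.prems False])
    have ne: "letter (Suc (Suc i)) \<noteq> letter i"
      using adj Suc.prems letter_no_return[of i] by auto
    obtain \<kappa>2 where k2: "\<kappa>2 \<in> K" "\<rho> i \<otimes> ?b = \<kappa>2 \<otimes> \<rho> i"
      using \<rho>_pull_K[of i "letter (Suc (Suc i))"] letter_range[of "Suc (Suc i)"] ne adj Suc.prems
      by auto
    have br: "?a \<otimes> ?b \<otimes> ?a = ?b \<otimes> ?a \<otimes> ?b"
      using adj r_braid[of "letter (Suc i)"] r_braid[of "letter (Suc (Suc i))"]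
        letter_range[of "Suc i"] letter_range[of "Suc (Suc i)"] Suc.prems by auto
    have "\<kappa>2 \<otimes> \<rho> (Suc (Suc i)) = (\<kappa>2 \<otimes> \<rho> i) \<otimes> ?a \<otimes> ?b"
      using cl k2 by (simp add: m_assoc)
    also have "\<dots> = \<rho> i \<otimes> (?a \<otimes> ?b \<otimes> ?a)"
      unfolding k2(2)[symmetric] br using cl by (simp add: m_assoc)
    also have "\<dots> = \<rho> (Suc i) \<otimes> ?b \<otimes> ?a"
      using cl by (simp add: m_assoc)
    also have "\<dots> = \<kappa> \<otimes> r 1 \<otimes> \<kappa>' \<otimes> (\<rho> i \<otimes> ?b) \<otimes> ?a"
      unfolding k(3) using cl by (simp add: m_assoc)
    also have "\<dots> = \<kappa> \<otimes> r 1 \<otimes> \<kappa>' \<otimes> \<kappa>2 \<otimes> \<rho> (Suc i)"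
      unfolding k2(2) using cl k2(1) by (simp add: m_assoc)
    finally have e: "\<kappa>2 \<otimes> \<rho> (Suc (Suc i)) = \<kappa> \<otimes> r 1 \<otimes> \<kappa>' \<otimes> \<kappa>2 \<otimes> \<rho> (Suc i)" .
    have "\<rho> (Suc (Suc i)) = inv \<kappa>2 \<otimes> (\<kappa>2 \<otimes> \<rho> (Suc (Suc i)))"
      using cl k2(1) Suc.prems by (simp flip: m_assoc)
    also have "\<dots> = (inv \<kappa>2 \<otimes> \<kappa>) \<otimes> r 1 \<otimes> (\<kappa>' \<otimes> \<kappa>2) \<otimes> \<rho> (Suc i)"
      unfolding e using cl k2(1) by (simp add: m_assoc)
    finally show ?thesis
      using k k2(1) by (intro bexI[of _ "inv \<kappa>2 \<otimes> \<kappa>"] bexI[of _ "\<kappa>' \<otimes> \<kappa>2"]) auto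
  qed
qed

text \<open>That \<open>e\<close> is arbitrary is the crux. For the next two letters a, b of the
  arc, a^e = (a b)^-1 b^e (a b) moves the exponent to b, which passes \<open>\<rho> i\<close> as an
  element of \<open>K\<close>. There remain a^-1, which brings in one inverse of \<open>r 1\<close>,
  and a b, which completes the longer arc. At the excluded index a and b coincide.\<close>

lemma \<rho>_pow_Neg:
  fixes e :: int
  assumes "Suc (Suc i) \<le> 2 * n - 2" "Suc i \<noteq> n - 1"
  shows "\<exists>\<nu>\<in>Neg. \<rho> i \<otimes> r (letter (Suc i)) [^] e = \<nu> \<otimes> \<rho> (Suc (Suc i))"
proof -
  let ?a = "r (letter (Suc i))" and ?b = "r (letter (Suc (Suc i)))"
  obtain \<kappa> \<kappa>' where k: "\<kappa> \<in> K" "\<kappa>' \<in> K" "\<rho> (Suc i) = \<kappa> \<otimes> r 1 \<otimes> \<kappa>' \<otimes> \<rho> i"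
    using \<rho>_conj_letter[of i] assms by auto
  have cl: "\<rho> i \<in> carrier B" "?a \<in> carrier B" "?b \<in> carrier B" "\<kappa> \<in> carrier B" "\<kappa>' \<in> carrier B"
    using assms k by auto
  have adj: "letter (Suc i) = Suc (letter (Suc (Suc i))) \<or> letter (Suc (Suc i)) = Suc (letter (Suc i))"
    by (rule letter_adjacent_turn[OF assms])
  have ne: "letter (Suc (Suc i)) \<noteq> letter i"
    using adj assms letter_no_return[of i] by auto
  obtain \<kappa>2 where k2: "\<kappa>2 \<in> K" "\<rho> i \<otimes> ?b = \<kappa>2 \<otimes> \<rho> i"
    using \<rho>_pull_K[of i "letter (Suc (Suc i))"] letter_range[of "Suc (Suc i)"] ne adj assms
    by auto
  have br: "?a \<otimes> ?b \<otimes> ?a = ?b \<otimes> ?a \<otimes> ?b"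
    using adj r_braid[of "letter (Suc i)"] r_braid[of "letter (Suc (Suc i))"]
      letter_range[of "Suc i"] letter_range[of "Suc (Suc i)"] assms by auto
  have cl2: "\<kappa>2 \<in> carrier B" using k2 by simp
  let ?X = "\<rho> i"
  have ab: "?a [^] e = inv (?a \<otimes> ?b) \<otimes> (?b [^] e \<otimes> (?a \<otimes> ?b))"
  proof -
    have "?b [^] e \<otimes> (?a \<otimes> ?b) = ?a \<otimes> ?b \<otimes> ?a [^] e"
      using int_pow_intertwine[of ?b "?a \<otimes> ?b" ?a e] br cl by (simp add: m_assoc)
    then show ?thesis
      using cl inv_solve_left[of "?a [^] e" "?a \<otimes> ?b" "?b [^] e \<otimes> (?a \<otimes> ?b)"] by simp
  qed
  have Xb: "?X \<otimes> inv ?b = inv \<kappa>2 \<otimes> ?X"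
    using int_pow_intertwine[of \<kappa>2 ?X ?b "-1"] k2 cl by (simp add: int_pow_neg)
  have Xa: "?X \<otimes> inv ?a = inv \<kappa>' \<otimes> inv r 1 \<otimes> inv \<kappa> \<otimes> ?X"
  proof -
    have "?X = (\<kappa> \<otimes> r 1 \<otimes> \<kappa>' \<otimes> ?X) \<otimes> inv ?a"
      unfolding k(3)[symmetric] using cl by (simp add: m_assoc)
    then have "?X = (\<kappa> \<otimes> r 1 \<otimes> \<kappa>') \<otimes> (?X \<otimes> inv ?a)"
      using cl by (simp add: m_assoc)
    then have "?X \<otimes> inv ?a = inv (\<kappa> \<otimes> r 1 \<otimes> \<kappa>') \<otimes> ?X"
      using cl inv_solve_left[of "?X \<otimes> inv ?a" "\<kappa> \<otimes> r 1 \<otimes> \<kappa>'" ?X] by simp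
    then show ?thesis
      using cl by (simp add: inv_mult_group m_assoc)
  qed
  have Xbe: "?X \<otimes> ?b [^] e = \<kappa>2 [^] e \<otimes> ?X"
    using int_pow_intertwine[of \<kappa>2 ?X ?b e] k2 cl by simp
  let ?\<nu> = "(inv \<kappa>2 \<otimes> inv \<kappa>') \<otimes> inv r 1 \<otimes> (inv \<kappa> \<otimes> \<kappa>2 [^] e)"
  have "?X \<otimes> ?a [^] e = (?X \<otimes> inv ?b) \<otimes> inv ?a \<otimes> ?b [^] e \<otimes> (?a \<otimes> ?b)"
    unfolding ab using cl by (simp add: m_assoc inv_mult_group)
  also have "\<dots> = inv \<kappa>2 \<otimes> (?X \<otimes> inv ?a) \<otimes> ?b [^] e \<otimes> (?a \<otimes> ?b)"
    unfolding Xb using cl cl2 by (simp add: m_assoc)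
  also have "\<dots> = inv \<kappa>2 \<otimes> inv \<kappa>' \<otimes> inv r 1 \<otimes> inv \<kappa> \<otimes> (?X \<otimes> ?b [^] e) \<otimes> (?a \<otimes> ?b)"
    unfolding Xa using cl cl2 by (simp add: m_assoc)
  also have "\<dots> = ?\<nu> \<otimes> \<rho> (Suc (Suc i))"
    unfolding Xbe using cl cl2 by (simp add: m_assoc)
  finally show ?thesis
    using k k2 by (intro bexI[of _ ?\<nu>]) (simp, intro Neg.base K_mult K_inv K_pow)
qed

end

section \<open>Products of all odd and of all even generators, and their effect on the arcs\<close>

locale braid_like_odd = braid_like +
  fixes k :: nat
  assumes n_eq: "n = 2 * k + 1" and k_ge: "k \<ge> 2"
begin

definition parity_prod :: "bool \<Rightarrow> 'a" where
  "parity_prod p = list_prod B (map r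
     (if p then map (\<lambda>i. 2 * i + 1) [0..<k] else map (\<lambda>i. 2 * i) [1..<k + 1]))"

lemma list_prod_r_closed:
  "set js \<subseteq> {1..<n} \<Longrightarrow> list_prod B (map r js) \<in> carrier B"
  using r_closed by (intro list_prod_closed) auto

lemma list_prod_r_comm:
  assumes "set js \<subseteq> {1..<n}" "1 \<le> c" "c < n" "\<And>j. j \<in> set js \<Longrightarrow> j \<noteq> Suc c \<and> c \<noteq> Suc j"
  shows "list_prod B (map r js) \<otimes> r c = r c \<otimes> list_prod B (map r js)"
  using assms(1,4)
proof (induction js)
  case Nil
  then show ?case using r_closed assms by simp
next
  case (Cons j js)
  then have cl: "r j \<in> carrier B" "r c \<in> carrier B" "list_prod B (map r js) \<in> carrier B"
    using r_closed assms list_prod_r_closed by auto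
  have "list_prod B (map r (j # js)) \<otimes> r c = r j \<otimes> (list_prod B (map r js) \<otimes> r c)"
    using cl by (simp add: m_assoc)
  also have "\<dots> = (r j \<otimes> r c) \<otimes> list_prod B (map r js)"
    using Cons cl by (simp add: m_assoc)
  also have "r j \<otimes> r c = r c \<otimes> r j"
    using Cons.prems assms(2,3) by (intro r_comm') auto
  finally show ?case
    using cl by (simp add: m_assoc)
qed

lemma \<rho>_pull_list:
  assumes "i \<le> 2 * n - 2" "set js \<subseteq> {1..<n}" "letter i \<notin> set js" "letter (Suc i) \<notin> set js"
  shows "\<exists>\<kappa>\<in>K. \<rho> i \<otimes> list_prod B (map r js) = \<kappa> \<otimes> \<rho> i"
  using assms(2-4)
proof (induction js)
  case Nil
  then show ?case using assms(1) by (intro bexI[of _ \<one>]) auto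
next
  case (Cons j js)
  have "j \<noteq> letter i" "j \<noteq> letter (Suc i)" "1 \<le> j" "j < n"
    using Cons.prems by auto
  then obtain \<kappa>1 where 1: "\<kappa>1 \<in> K" "\<rho> i \<otimes> r j = \<kappa>1 \<otimes> \<rho> i"
    using \<rho>_pull_K[OF assms(1)] by blast
  obtain \<kappa>2 where 2: "\<kappa>2 \<in> K" "\<rho> i \<otimes> list_prod B (map r js) = \<kappa>2 \<otimes> \<rho> i"
    using Cons by auto
  have cl: "r j \<in> carrier B" "\<rho> i \<in> carrier B" "list_prod B (map r js) \<in> carrier B"
    using r_closed assms Cons.prems list_prod_r_closed by auto
  have "\<rho> i \<otimes> list_prod B (map r (j # js)) = (\<rho> i \<otimes> r j) \<otimes> list_prod B (map r js)"
    using cl by (simp add: m_assoc)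
  also have "\<dots> = \<kappa>1 \<otimes> (\<rho> i \<otimes> list_prod B (map r js))"
    unfolding 1(2) using cl 1(1) by (simp add: m_assoc)
  also have "\<dots> = (\<kappa>1 \<otimes> \<kappa>2) \<otimes> \<rho> i"
    unfolding 2(2) using cl 1(1) 2(1) by (simp add: m_assoc)
  finally show ?case using 1 2 by (intro bexI[of _ "\<kappa>1 \<otimes> \<kappa>2"]) auto
qed

lemma K_intertwine_pow:
  fixes e :: int
  assumes "\<kappa> \<in> K" "x \<otimes> y = \<kappa> \<otimes> x" "x \<in> carrier B" "y \<in> carrier B"
  shows "x \<otimes> y [^] e = \<kappa> [^] e \<otimes> x"
  using int_pow_intertwine[of \<kappa> x y e] assms by simp

definition parity_list :: "bool \<Rightarrow> nat list" where
  "parity_list p = (if p then map (\<lambda>i. 2 * i + 1) [0..<k] else map (\<lambda>i. 2 * i) [1..<k + 1])"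

lemma parity_prod_eq: "parity_prod p = list_prod B (map r (parity_list p))"
  by (simp add: parity_prod_def parity_list_def)

lemma set_parity_list: "set (parity_list p) = {j. 1 \<le> j \<and> j < n \<and> odd j = p}"
proof (rule Set.set_eqI)
  fix j
  have "(\<exists>i<k. j = 2 * i + 1) \<longleftrightarrow> 1 \<le> j \<and> j < n \<and> odd j"
    using n_eq by presburger
  moreover have "(\<exists>i. 1 \<le> i \<and> i < k + 1 \<and> j = 2 * i) \<longleftrightarrow> 1 \<le> j \<and> j < n \<and> even j"
    using n_eq by presburger
  moreover have "j \<in> set (parity_list p) \<longleftrightarrow>
      (if p then \<exists>i<k. j = 2 * i + 1 else \<exists>i. 1 \<le> i \<and> i < k + 1 \<and> j = 2 * i)"
    by (auto simp: parity_list_def)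
  ultimately show "j \<in> set (parity_list p) \<longleftrightarrow> j \<in> {j. 1 \<le> j \<and> j < n \<and> odd j = p}"
    by (cases p) simp_all
qed

lemma distinct_parity_list: "distinct (parity_list p)"
  by (auto simp: parity_list_def distinct_map inj_on_def)

lemma parity_prod_closed [simp]: "parity_prod p \<in> carrier B"
  unfolding parity_prod_eq by (rule list_prod_r_closed) (auto simp: set_parity_list)

text \<open>Positions 0 and \<open>2 * n - 1\<close> carry the letter 0, which stands for no
  generator; hence the alternatives with 0 here and below.\<close>

lemma \<rho>_parity_prod_none:
  assumes "i \<le> 2 * n - 2" "letter i = 0 \<or> odd (letter i) \<noteq> p"
    "letter (Suc i) = 0 \<or> odd (letter (Suc i)) \<noteq> p"
  shows "\<exists>\<kappa>\<in>K. \<rho> i \<otimes> parity_prod p = \<kappa> \<otimes> \<rho> i"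
  unfolding parity_prod_eq using assms by (intro \<rho>_pull_list) (auto simp: set_parity_list)

text \<open>Generators of equal parity commute, so a power of the product splits off
  \<open>r c [^] e\<close>. All other factors differ from the two letters at the end of the arc and
  pass into \<open>K\<close>.\<close>

lemma \<rho>_parity_prod_pow:
  fixes e :: int
  assumes "i \<le> 2 * n - 2" "1 \<le> c" "c < n" "odd c = p"
    "letter i \<in> {0, c} \<or> odd (letter i) \<noteq> p" "letter (Suc i) \<in> {0, c} \<or> odd (letter (Suc i)) \<noteq> p"
  shows "\<exists>\<kappa>\<in>K. \<rho> i \<otimes> parity_prod p [^] e = \<kappa> \<otimes> (\<rho> i \<otimes> r c [^] e)"
proof -
  have "c \<in> set (parity_list p)"
    using assms by (simp add: set_parity_list)
  then obtain us vs where uv: "parity_list p = us @ c # vs"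
    by (meson split_list)
  define js where "js = us @ vs"
  have js: "set js = set (parity_list p) - {c}"
    using distinct_parity_list[of p] unfolding uv js_def by auto
  have mem: "1 \<le> j \<and> j < n \<and> odd j = p" if "j \<in> set us \<union> set vs" for j
  proof -
    have "j \<in> set (parity_list p)" using that uv by auto
    then show ?thesis unfolding set_parity_list by blast
  qed
  have sets: "set js \<subseteq> {1..<n}" "set us \<subseteq> {1..<n}" "set vs \<subseteq> {1..<n}"
    using mem unfolding js_def by auto
  let ?R = "list_prod B (map r js)"
  have cl: "r c \<in> carrier B" "?R \<in> carrier B" "\<rho> i \<in> carrier B"
    "list_prod B (map r us) \<in> carrier B" "list_prod B (map r vs) \<in> carrier B"
    by (rule r_closed[OF assms(2,3)] \<rho>_closed[OF assms(1)] list_prod_r_closed[OF sets(1)]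
      list_prod_r_closed[OF sets(2)] list_prod_r_closed[OF sets(3)])+
  have carr: "set (map r us) \<subseteq> carrier B" "set (map r vs) \<subseteq> carrier B"
    using r_closed sets by (auto simp: subset_iff)
  have par: "j \<noteq> Suc c \<and> c \<noteq> Suc j" if "odd j = p" for j
    using that assms(4) by auto
  have parvs: "odd j = p" if "j \<in> set vs \<union> set js" for j
    using that mem[of j] unfolding js_def by auto
  have cm1: "?R \<otimes> r c = r c \<otimes> ?R"
  proof (rule list_prod_r_comm[OF sets(1) assms(2,3)])
    show "j \<noteq> Suc c \<and> c \<noteq> Suc j" if "j \<in> set js" for j
      by (rule par) (use that parvs in blast)
  qed
  have cm2: "list_prod B (map r vs) \<otimes> r c = r c \<otimes> list_prod B (map r vs)"
  proof (rule list_prod_r_comm[OF sets(3) assms(2,3)])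
    show "j \<noteq> Suc c \<and> c \<noteq> Suc j" if "j \<in> set vs" for j
      by (rule par) (use that parvs in blast)
  qed
  have "set (map r (c # vs)) \<subseteq> carrier B"
    using carr(2) cl(1) by simp
  then have "parity_prod p = list_prod B (map r us) \<otimes> list_prod B (map r (c # vs))"
    unfolding parity_prod_eq uv map_append by (rule list_prod_append[OF carr(1)])
  also have "\<dots> = list_prod B (map r us) \<otimes> (list_prod B (map r vs) \<otimes> r c)"
    by (simp only: list.map list_prod_simps cm2)
  also have "\<dots> = ?R \<otimes> r c"
    unfolding js_def map_append list_prod_append[OF carr] by (rule m_assoc[OF cl(4,5,1), symmetric])
  finally have pow: "parity_prod p [^] e = ?R [^] e \<otimes> r c [^] e"
    using int_pow_mult_distrib[OF cm1 cl(2,1)] by simp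
  have "letter i \<notin> set js" "letter (Suc i) \<notin> set js"
    using assms(5,6) unfolding js set_parity_list by auto
  then obtain \<kappa> where \<kappa>: "\<kappa> \<in> K" "\<rho> i \<otimes> ?R = \<kappa> \<otimes> \<rho> i"
    using \<rho>_pull_list[OF assms(1) sets(1)] by blast
  have "\<rho> i \<otimes> parity_prod p [^] e = (\<rho> i \<otimes> ?R [^] e) \<otimes> r c [^] e"
    unfolding pow using cl(1-3) by (simp only: m_assoc int_pow_closed)
  also have "\<rho> i \<otimes> ?R [^] e = \<kappa> [^] e \<otimes> \<rho> i"
    by (rule K_intertwine_pow[OF \<kappa> cl(3,2)])
  also have "\<kappa> [^] e \<otimes> \<rho> i \<otimes> r c [^] e = \<kappa> [^] e \<otimes> (\<rho> i \<otimes> r c [^] e)"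
    by (rule m_assoc) (use \<kappa>(1) cl in simp_all)
  finally show ?thesis
    using K_pow[OF \<kappa>(1)] by blast
qed

lemma \<rho>_parity_prod:
  assumes "Suc i \<le> 2 * n - 2" "odd (letter (Suc i)) = p"
    "letter i = 0 \<or> letter i = letter (Suc i) \<or> odd (letter i) \<noteq> p"
  shows "\<exists>\<kappa>\<in>K. \<rho> i \<otimes> parity_prod p = \<kappa> \<otimes> \<rho> (Suc i)"
  using \<rho>_parity_prod_pow[of i "letter (Suc i)" p 1] letter_range[of "Suc i"] assms by auto

abbreviation "S \<equiv> parity_prod True"
abbreviation "T \<equiv> parity_prod False"

lemma K_step:
  assumes "\<exists>\<kappa>\<in>K. x \<otimes> a = \<kappa> \<otimes> y" "\<exists>\<kappa>\<in>K. y \<otimes> b = \<kappa> \<otimes> z"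
    and [simp]: "x \<in> carrier B" "y \<in> carrier B" "z \<in> carrier B" "a \<in> carrier B" "b \<in> carrier B"
  shows "\<exists>\<kappa>\<in>K. x \<otimes> (a \<otimes> b) = \<kappa> \<otimes> z"
proof -
  from assms obtain \<kappa>1 \<kappa>2 where 1: "\<kappa>1 \<in> K" "x \<otimes> a = \<kappa>1 \<otimes> y" and 2: "\<kappa>2 \<in> K" "y \<otimes> b = \<kappa>2 \<otimes> z"
    by blast
  have "x \<otimes> (a \<otimes> b) = \<kappa>1 \<otimes> (y \<otimes> b)"
    using 1 by (simp add: m_assoc[symmetric])
  also have "\<dots> = (\<kappa>1 \<otimes> \<kappa>2) \<otimes> z"
    unfolding 2(2) using 1 2(1) by (simp add: m_assoc)
  finally show ?thesis
    using 1 2 by (intro bexI[of _ "\<kappa>1 \<otimes> \<kappa>2"]) auto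
qed

text \<open>On the rising half the letters alternate between odd and even, so each factor
  contributes exactly the next letter of the arc and otherwise only elements of
  \<open>K\<close>.\<close>

lemma \<rho>_ST: "j \<le> k \<Longrightarrow> \<exists>\<kappa>\<in>K. \<one> \<otimes> (S \<otimes> T) [^] j = \<kappa> \<otimes> \<rho> (2 * j)"
proof (induction j)
  case 0
  show ?case by (rule bexI[of _ \<one>]) simp_all
next
  case (Suc j)
  have le: "Suc (Suc (2 * j)) \<le> 2 * n - 2" "Suc (2 * j) \<le> 2 * n - 2" "2 * j \<le> 2 * n - 2"
    "Suc (Suc (2 * j)) < n" "j \<le> k"
    using Suc.prems n_eq by linarith+
  then have l: "letter (2 * j) = 2 * j" "letter (Suc (2 * j)) = Suc (2 * j)"
    "letter (Suc (Suc (2 * j))) = Suc (Suc (2 * j))"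
    by simp_all
  have 1: "\<exists>\<kappa>\<in>K. \<rho> (2 * j) \<otimes> S = \<kappa> \<otimes> \<rho> (Suc (2 * j))"
    by (rule \<rho>_parity_prod[OF le(2)]) (simp_all add: l)
  have 2: "\<exists>\<kappa>\<in>K. \<rho> (Suc (2 * j)) \<otimes> T = \<kappa> \<otimes> \<rho> (Suc (Suc (2 * j)))"
    by (rule \<rho>_parity_prod[OF le(1)]) (simp_all add: l)
  note cl = \<rho>_closed[OF le(1)] \<rho>_closed[OF le(2)] \<rho>_closed[OF le(3)]
  have 3: "\<exists>\<kappa>\<in>K. \<rho> (2 * j) \<otimes> (S \<otimes> T) = \<kappa> \<otimes> \<rho> (Suc (Suc (2 * j)))"
    by (rule K_step[OF 1 2 cl(3,2,1)]) simp_all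
  have "\<exists>\<kappa>\<in>K. \<one> \<otimes> ((S \<otimes> T) [^] j \<otimes> (S \<otimes> T)) = \<kappa> \<otimes> \<rho> (Suc (Suc (2 * j)))"
    by (rule K_step[OF Suc.IH[OF le(5)] 3 one_closed cl(3,1)]) simp_all
  then show ?case by (simp only: nat_pow_Suc mult_Suc_right add_2_eq_Suc)
qed

text \<open>The falling half starts with the second copy of the even letter \<open>2 * k\<close>,
  hence the opposite order of the factors.\<close>

lemma \<rho>_TS: "j \<le> k \<Longrightarrow> \<exists>\<kappa>\<in>K. \<rho> (2 * k) \<otimes> (T \<otimes> S) [^] j = \<kappa> \<otimes> \<rho> (2 * j + 2 * k)"
proof (induction j)
  case 0
  have "\<rho> (2 * k) \<in> carrier B"
    by (rule \<rho>_closed) (use n_eq in linarith)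
  then show ?case by (intro bexI[of _ \<one>]) simp_all
next
  case (Suc j)
  let ?i = "2 * j + 2 * k"
  have le: "Suc (Suc ?i) \<le> 2 * n - 2" "Suc ?i \<le> 2 * n - 2" "?i \<le> 2 * n - 2" "2 * k \<le> 2 * n - 2"
    "j \<le> k"
    using Suc.prems n_eq by linarith+
  have l1: "letter (Suc ?i) + Suc (Suc ?i) = 4 * k + 2"
    using letter_high[of "Suc ?i"] n_eq Suc.prems by linarith
  have l2: "letter (Suc (Suc ?i)) + Suc (Suc (Suc ?i)) = 4 * k + 2"
    using letter_high[of "Suc (Suc ?i)"] n_eq Suc.prems by linarith
  have l0: "letter ?i = letter (Suc ?i) \<or> odd (letter ?i)"
  proof (cases "j = 0")
    case True
    then have "letter ?i = ?i" using n_eq by (intro letter_low) linarith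
    then show ?thesis using l1 True by linarith
  next
    case False
    then have "letter ?i + Suc ?i = 4 * k + 2"
      using letter_high[of ?i] n_eq Suc.prems by linarith
    then show ?thesis by presburger
  qed
  have odd: "even (letter (Suc ?i))" "odd (letter (Suc (Suc ?i)))"
    using l1 l2 by presburger+
  have 1: "\<exists>\<kappa>\<in>K. \<rho> ?i \<otimes> T = \<kappa> \<otimes> \<rho> (Suc ?i)"
    by (rule \<rho>_parity_prod[OF le(2)]) (use odd l0 in simp_all)
  have 2: "\<exists>\<kappa>\<in>K. \<rho> (Suc ?i) \<otimes> S = \<kappa> \<otimes> \<rho> (Suc (Suc ?i))"
    by (rule \<rho>_parity_prod[OF le(1)]) (use odd in simp_all)
  note cl = \<rho>_closed[OF le(1)] \<rho>_closed[OF le(2)] \<rho>_closed[OF le(3)] \<rho>_closed[OF le(4)]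
  have 3: "\<exists>\<kappa>\<in>K. \<rho> ?i \<otimes> (T \<otimes> S) = \<kappa> \<otimes> \<rho> (Suc (Suc ?i))"
    by (rule K_step[OF 1 2 cl(3,2,1)]) simp_all
  have "\<exists>\<kappa>\<in>K. \<rho> (2 * k) \<otimes> ((T \<otimes> S) [^] j \<otimes> (T \<otimes> S)) = \<kappa> \<otimes> \<rho> (Suc (Suc ?i))"
    by (rule K_step[OF Suc.IH[OF le(5)] 3 cl(4,3,1)]) simp_all
  then show ?case by (simp only: nat_pow_Suc mult_Suc_right add_2_eq_Suc add_Suc)
qed

text \<open>The product on the left is the full twist; \<open>K\<close> is the stabiliser of the first arc.\<close>

lemma full_twist:
  "\<exists>\<kappa>\<in>K. ((S \<otimes> T) [^] k \<otimes> S) \<otimes> ((T \<otimes> S) [^] k \<otimes> T) = \<kappa> \<otimes> \<rho> (2 * n - 2)"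
proof -
  have e: "2 * n - 2 = 2 * k + 2 * k" using n_eq by linarith
  have cl: "\<rho> (2 * k) \<in> carrier B" "\<rho> (2 * n - 2) \<in> carrier B"
    by (rule \<rho>_closed, use n_eq in linarith)+
  have "2 * k < n" using n_eq by linarith
  then have "letter (2 * k) = 2 * k" by (rule letter_low)
  moreover have "letter (Suc (2 * k)) = 2 * k" "letter (2 * n - 2) = 1" "letter (Suc (2 * n - 2)) = 0"
    using n_eq n_ge letter_high[of "Suc (2 * k)"] letter_high[of "2 * n - 2"]
      letter_high[of "Suc (2 * n - 2)"] by linarith+
  ultimately have l: "letter (2 * k) = 2 * k" "letter (Suc (2 * k)) = 2 * k"
    "letter (2 * n - 2) = 1" "letter (Suc (2 * n - 2)) = 0" .
  have 1: "\<exists>\<kappa>\<in>K. \<one> \<otimes> (S \<otimes> T) [^] k = \<kappa> \<otimes> \<rho> (2 * k)"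
    by (rule \<rho>_ST) simp
  \<comment> \<open>At the top both adjacent letters are \<open>2 * k\<close>, so the odd product is
    absorbed by \<open>K\<close>; so is the final \<open>T\<close>, where the adjacent letters are 1
    and 0. Only the two alternating powers move the arc.\<close>
  have 2: "\<exists>\<kappa>\<in>K. \<rho> (2 * k) \<otimes> S = \<kappa> \<otimes> \<rho> (2 * k)"
    using l cl by (intro \<rho>_parity_prod_none) (use n_eq in linarith, auto)
  have 3: "\<exists>\<kappa>\<in>K. \<rho> (2 * k) \<otimes> (T \<otimes> S) [^] k = \<kappa> \<otimes> \<rho> (2 * n - 2)"
    unfolding e by (rule \<rho>_TS) simp
  have 4: "\<exists>\<kappa>\<in>K. \<rho> (2 * n - 2) \<otimes> T = \<kappa> \<otimes> \<rho> (2 * n - 2)"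
    using l by (intro \<rho>_parity_prod_none) auto
  have "\<exists>\<kappa>\<in>K. \<one> \<otimes> (((S \<otimes> T) [^] k \<otimes> S) \<otimes> ((T \<otimes> S) [^] k \<otimes> T)) = \<kappa> \<otimes> \<rho> (2 * n - 2)"
    using K_step[OF K_step[OF 1 2 one_closed cl(1,1)] K_step[OF 3 4 cl(1,2,2)] one_closed cl(1,2)]
    by simp
  then show ?thesis by simp
qed

text \<open>After \<open>b\<close> blocks of a word \<open>S\<^sup>* T\<^sup>* S\<^sup>* \<cdots>\<close> the first arc has not passed \<open>\<rho> (bound b)\<close>.\<close>

definition bound :: "nat \<Rightarrow> nat" where
  "bound b = (if b = 0 then 0 else if b \<le> n - 2 then b + 1 else b + 2)"

text \<open>Here the arc already ends in the letter that is raised to a power. That letter joins the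
  exponent, so the gain is one letter instead of two.\<close>

lemma \<rho>_Suc_pow_Neg:
  fixes e :: int
  assumes "Suc (Suc i) \<le> 2 * n - 2" "Suc i \<noteq> n - 1"
  shows "\<exists>\<nu>\<in>Neg. \<rho> (Suc i) \<otimes> r (letter (Suc i)) [^] e = \<nu> \<otimes> \<rho> (Suc (Suc i))"
proof -
  have cl: "\<rho> i \<in> carrier B" "r (letter (Suc i)) \<in> carrier B"
    using assms by auto
  have "\<rho> (Suc i) \<otimes> r (letter (Suc i)) [^] e = \<rho> i \<otimes> r (letter (Suc i)) [^] (1 + e)"
    using cl int_pow_mult[of "r (letter (Suc i))" 1 e] by (simp add: m_assoc)
  then show ?thesis
    using \<rho>_pow_Neg[OF assms, of "1 + e"] by simp
qed

text \<open>Modulo \<open>K\<close> a block is a power of the one generator that touches the end of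
  the arc. The gain is two letters for \<open>b = 0\<close> and \<open>b = n - 2\<close> and one
  letter otherwise, which explains the shape of \<open>bound\<close>.\<close>

lemma bound_step:
  fixes e :: int
  assumes "Suc b \<le> 2 * n - 4"
  shows "\<exists>\<nu>\<in>Neg. \<rho> (bound b) \<otimes> parity_prod (even b) [^] e = \<nu> \<otimes> \<rho> (bound (Suc b))"
proof -
  have red: ?thesis if prem: "1 \<le> c" "c < n" "odd c = even b" "bound b \<le> 2 * n - 2"
    "letter (bound b) \<in> {0, c} \<or> odd (letter (bound b)) \<noteq> even b"
    "letter (Suc (bound b)) \<in> {0, c} \<or> odd (letter (Suc (bound b))) \<noteq> even b"
    and N: "\<exists>\<nu>\<in>Neg. \<rho> (bound b) \<otimes> r c [^] e = \<nu> \<otimes> \<rho> (bound (Suc b))"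
    and le: "bound (Suc b) \<le> 2 * n - 2" for c
  proof -
    obtain \<kappa> where \<kappa>: "\<kappa> \<in> K" "\<rho> (bound b) \<otimes> parity_prod (even b) [^] e = \<kappa> \<otimes> (\<rho> (bound b) \<otimes> r c [^] e)"
      using \<rho>_parity_prod_pow[OF prem(4,1-3,5,6)] by blast
    obtain \<nu> where \<nu>: "\<nu> \<in> Neg" "\<rho> (bound b) \<otimes> r c [^] e = \<nu> \<otimes> \<rho> (bound (Suc b))"
      using N by blast
    have "\<kappa> \<otimes> (\<nu> \<otimes> \<rho> (bound (Suc b))) = (\<kappa> \<otimes> \<nu>) \<otimes> \<rho> (bound (Suc b))"
      using \<kappa>(1) \<nu>(1) le by (simp add: m_assoc)
    then show ?thesis
      using \<kappa> \<nu> Neg_K_left by metis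
  qed
  consider "b = 0" | "1 \<le> b" "b \<le> n - 3" | "b = n - 2" | "n - 1 \<le> b" by linarith
  then show ?thesis
  proof cases
    case 1
    have "1 < n" "2 \<le> 2 * n - 2" "Suc 0 \<noteq> n - 1" "1 \<le> n - 2" using n_eq k_ge by linarith+
    then show ?thesis
      using 1 \<rho>_pow_Neg[of 0 e] by (intro red[of 1]) (auto simp: bound_def numeral_2_eq_2)
  next
    case 2
    have le: "Suc (Suc b) < n" "b \<le> n - 2" "Suc b \<le> n - 2" "Suc (Suc b) \<le> 2 * n - 2" "Suc b \<noteq> n - 1"
      using 2 n_eq k_ge by linarith+
    then have b: "bound b = Suc b" "bound (Suc b) = Suc (Suc b)" "letter (Suc b) = Suc b"
      "letter (Suc (Suc b)) = Suc (Suc b)"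
      using 2 by (auto simp: bound_def)
    show ?thesis
      using 2 le \<rho>_Suc_pow_Neg[of b e] b by (intro red[of "Suc b"]) auto
  next
    \<comment> \<open>The arc ends between the two copies of the top letter.
      \<open>\<rho>_Suc_pow_Neg\<close> fails at this index, but \<open>\<rho>_pow_Neg\<close>
      applies with the second copy as first new letter and gains two.\<close>
    case 3
    have le: "2 * k < n" "2 * k \<le> 2 * n - 2" "Suc (Suc (2 * k)) \<le> 2 * n - 2" "Suc (2 * k) \<noteq> n - 1"
      "1 \<le> 2 * k" "b \<noteq> 0" "\<not> Suc b \<le> n - 2" "b + 1 = 2 * k"
      using 3 n_eq k_ge by linarith+
    have b: "bound b = 2 * k" "bound (Suc b) = Suc (Suc (2 * k))"
      using 3 le by (auto simp: bound_def)
    have l: "letter (2 * k) = 2 * k" "letter (Suc (2 * k)) = 2 * k"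
      using le letter_low[of "2 * k"] letter_high[of "Suc (2 * k)"] n_eq by linarith+
    have "odd b" using le(8) by presburger
    then show ?thesis
      using le b l \<rho>_pow_Neg[of "2 * k" e] by (intro red[of "2 * k"]) auto
  next
    case 4
    define c where "c = letter (Suc (Suc b))"
    have le: "b \<noteq> 0" "\<not> b \<le> n - 2" "\<not> Suc b \<le> n - 2" "Suc (Suc b) \<le> 2 * n - 2"
      "Suc (Suc (Suc b)) \<le> 2 * n - 2" "Suc (Suc b) \<noteq> n - 1"
      using 4 assms n_eq k_ge by linarith+
    then have b: "bound b = Suc (Suc b)" "bound (Suc b) = Suc (Suc (Suc b))"
      by (auto simp: bound_def)
    have c: "c + b + 3 = 2 * n" "letter (Suc (Suc (Suc b))) + b + 4 = 2 * n"
      using 4 assms n_ge letter_high[of "Suc (Suc b)"] letter_high[of "Suc (Suc (Suc b))"]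
      unfolding c_def by linarith+
    have "1 \<le> c" "c < n" using c(1) 4 assms n_ge by linarith+
    moreover have "odd (c + b)" "even (letter (Suc (Suc (Suc b))) + b)"
      using c by presburger+
    ultimately show ?thesis
      using le \<rho>_Suc_pow_Neg[of "Suc b" e]
      by (intro red[of c]) (auto simp: c_def[symmetric] b)
  qed
qed

lemma bound_chain:
  fixes ps :: "(int \<times> int) list"
  assumes "ps \<noteq> []" "2 * d + 2 * length ps \<le> 2 * n - 4"
  shows "\<exists>\<nu>\<in>Neg. \<rho> (bound (2 * d)) \<otimes> list_prod B (map (\<lambda>(x, y). S [^] x \<otimes> T [^] y) ps)
    = \<nu> \<otimes> \<rho> (bound (2 * d + 2 * length ps))"
  using assms
proof (induction ps arbitrary: d)
  case (Cons p ps)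
  obtain x y where p: "p = (x, y)" by (cases p)
  have bnd: "b \<le> 2 * n - 4 \<Longrightarrow> \<rho> (bound b) \<in> carrier B" for b
    unfolding bound_def by (intro \<rho>_closed) (use n_ge in \<open>simp split: if_split\<close>, linarith)
  let ?P = "list_prod B (map (\<lambda>(x, y). S [^] x \<otimes> T [^] y) ps)"
  have P: "?P \<in> carrier B"
    by (intro list_prod_closed) auto
  have cl: "\<rho> (bound (2 * d)) \<in> carrier B" "\<rho> (bound (Suc (2 * d))) \<in> carrier B"
    "\<rho> (bound (2 * Suc d)) \<in> carrier B" "\<rho> (bound (2 * Suc d + 2 * length ps)) \<in> carrier B"
    by (rule bnd, use Cons.prems in simp)+
  obtain \<nu>1 where 1: "\<nu>1 \<in> Neg" "\<rho> (bound (2 * d)) \<otimes> S [^] x = \<nu>1 \<otimes> \<rho> (bound (Suc (2 * d)))"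
    using bound_step[of "2 * d" x] Cons.prems by auto
  obtain \<nu>2 where 2: "\<nu>2 \<in> Neg" "\<rho> (bound (Suc (2 * d))) \<otimes> T [^] y = \<nu>2 \<otimes> \<rho> (bound (2 * Suc d))"
    using bound_step[of "Suc (2 * d)" y] Cons.prems by auto
  have "\<rho> (bound (2 * d)) \<otimes> (S [^] x \<otimes> T [^] y) = (\<nu>1 \<otimes> \<nu>2) \<otimes> \<rho> (bound (2 * Suc d))"
  proof -
    have "\<rho> (bound (2 * d)) \<otimes> (S [^] x \<otimes> T [^] y) = \<nu>1 \<otimes> (\<rho> (bound (Suc (2 * d))) \<otimes> T [^] y)"
      using 1 cl by (simp add: m_assoc[symmetric])
    then show ?thesis
      unfolding 2(2) using 1(1) 2(1) cl by (simp add: m_assoc)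
  qed
  then have first: "\<rho> (bound (2 * d)) \<otimes> list_prod B (map (\<lambda>(x, y). S [^] x \<otimes> T [^] y) (p # ps))
      = (\<nu>1 \<otimes> \<nu>2) \<otimes> (\<rho> (bound (2 * Suc d)) \<otimes> ?P)"
    using 1(1) 2(1) cl P p by (simp add: m_assoc[symmetric])
  show ?case
  proof (cases "ps = []")
    case True
    then show ?thesis
      using first 1 2 cl Neg_mult by auto
  next
    case False
    then obtain \<nu>3 where 3: "\<nu>3 \<in> Neg"
      "\<rho> (bound (2 * Suc d)) \<otimes> ?P = \<nu>3 \<otimes> \<rho> (bound (2 * Suc d + 2 * length ps))"
      using Cons.IH[of "Suc d"] Cons.prems by auto
    have "(\<nu>1 \<otimes> \<nu>2) \<otimes> (\<rho> (bound (2 * Suc d)) \<otimes> ?P)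
        = (\<nu>1 \<otimes> \<nu>2 \<otimes> \<nu>3) \<otimes> \<rho> (bound (2 * Suc d + 2 * length ps))"
      unfolding 3(2) using 1(1) 2(1) 3(1) cl by (simp add: m_assoc)
    then show ?thesis
      using first 1 2 3 Neg_mult by (intro bexI[of _ "\<nu>1 \<otimes> \<nu>2 \<otimes> \<nu>3"]) auto
  qed
qed simp

text \<open>The count is exact: \<open>bound (4 * k - 2)\<close> is \<open>4 * k\<close>, which is
  \<open>2 * n - 2\<close>, the arc of the full twist. This common arc cancels in the quotient, and
  the leftover factor from \<open>K\<close> does no harm.\<close>

lemma blocks_below_full_twist:
  fixes ps :: "(int \<times> int) list"
  assumes "length ps = 2 * k - 1"
  shows "list_prod B (map (\<lambda>(x, y). S [^] x \<otimes> T [^] y) ps)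
    \<otimes> inv (((S \<otimes> T) [^] k \<otimes> S) \<otimes> ((T \<otimes> S) [^] k \<otimes> T)) \<in> Neg"
proof -
  let ?P = "list_prod B (map (\<lambda>(x, y). S [^] x \<otimes> T [^] y) ps)"
  let ?D = "((S \<otimes> T) [^] k \<otimes> S) \<otimes> ((T \<otimes> S) [^] k \<otimes> T)"
  have cl: "?P \<in> carrier B" "\<rho> (2 * n - 2) \<in> carrier B" "?D \<in> carrier B"
    by (intro list_prod_closed) auto
  have le: "2 * length ps \<noteq> 0" "\<not> 2 * length ps \<le> n - 2" "2 * length ps + 2 = 2 * n - 2"
    "2 * 0 + 2 * length ps \<le> 2 * n - 4" "ps \<noteq> []"
    using assms n_eq k_ge by (linarith+, auto)
  then have "bound (2 * length ps) = 2 * n - 2" "bound 0 = 0"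
    unfolding bound_def by simp_all
  then obtain \<nu> where \<nu>: "\<nu> \<in> Neg" "?P = \<nu> \<otimes> \<rho> (2 * n - 2)"
    using bound_chain[OF le(5,4)] cl by auto
  obtain \<kappa> where \<kappa>: "\<kappa> \<in> K" "?D = \<kappa> \<otimes> \<rho> (2 * n - 2)"
    using full_twist by blast
  have "?P \<otimes> inv ?D = \<nu> \<otimes> \<rho> (2 * n - 2) \<otimes> inv (\<kappa> \<otimes> \<rho> (2 * n - 2))"
    using \<nu>(2) \<kappa>(2) by simp
  also have "\<dots> = \<nu> \<otimes> inv \<kappa>"
    using cl(2) \<nu>(1) \<kappa>(1) by (simp add: inv_mult_group m_assoc) (simp add: m_assoc[symmetric])
  finally show ?thesis
    using \<nu> \<kappa> Neg_K_right by simp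
qed

end

section \<open>The braid group\<close>

lemma braid_gen_relation:
  assumes "(pos_word xs, pos_word ys) \<in> braid_rels n" "set xs \<subseteq> {1..<n}" "set ys \<subseteq> {1..<n}"
  shows "list_prod (braid_group n) (map (braid_gen n) xs) = list_prod (braid_group n) (map (braid_gen n) ys)"
  using presented_group_relation[OF assms] by (simp add: braid_group_def braid_gen_def[abs_def])

lemma braid_like_braid_group:
  assumes "n \<ge> 3"
  shows "braid_like (braid_group n) (braid_gen n) n"
proof -
  interpret group "braid_group n"
    unfolding braid_group_def by (rule group_presented_group)
  have cl: "1 \<le> i \<Longrightarrow> i < n \<Longrightarrow> braid_gen n i \<in> carrier (braid_group n)" for i
    by (simp add: braid_group_def braid_gen_def pres_gen_closed)
  show ?thesis
  proof (unfold_locales)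
    fix i assume i: "1 \<le> i" "Suc i < n"
    then have "(pos_word [i, Suc i, i], pos_word [Suc i, i, Suc i]) \<in> braid_rels n"
      unfolding braid_rels_def
      by (intro UnI1 CollectI exI[of _ i] exI[of _ "Suc i"] conjI) simp_all
    from braid_gen_relation[OF this] show "braid_gen n i \<otimes>\<^bsub>braid_group n\<^esub> braid_gen n (Suc i) \<otimes>\<^bsub>braid_group n\<^esub> braid_gen n i
      = braid_gen n (Suc i) \<otimes>\<^bsub>braid_group n\<^esub> braid_gen n i \<otimes>\<^bsub>braid_group n\<^esub> braid_gen n (Suc i)"
      using i cl[of i] cl[of "Suc i"] by (simp add: m_assoc)
  next
    fix i j assume i: "1 \<le> i" "i + 2 \<le> j" "j < n"
    then have "(pos_word [i, j], pos_word [j, i]) \<in> braid_rels n"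
      unfolding braid_rels_def
      by (intro UnI2 CollectI exI[of _ i] exI[of _ j] conjI) simp_all
    from braid_gen_relation[OF this] show "braid_gen n i \<otimes>\<^bsub>braid_group n\<^esub> braid_gen n j
      = braid_gen n j \<otimes>\<^bsub>braid_group n\<^esub> braid_gen n i"
      using i cl[of i] cl[of j] by simp
  qed (use assms cl in auto)
qed

text \<open>The braid generator \<open>r\<^sub>x\<close> acts by the inverse of the usual Artin automorphism, so that it is
  \<open>r\<^sub>1\<inverse>\<close> that lengthens the word \<open>[1]\<close>.\<close>

definition braid_act :: "nat \<times> bool \<Rightarrow> nat list \<Rightarrow> nat list" where
  "braid_act p = (if snd p then twist_word (Suc (fst p)) (fst p) else twist_word (fst p) (Suc (fst p)))"

lemma braid_act_cong:
  assumes "(u, v) \<in> pres_cong {1..<n} (braid_rels n)" "reduced w"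
  shows "foldr braid_act u w = foldr braid_act v w"
proof (rule pres_cong_action[OF assms(1), where X = "{w. reduced w}"])
  fix l r :: "nat word" and p
  assume lr: "(l, r) \<in> braid_rels n" and p: "p \<in> {w. reduced w}"
  from lr show "foldr braid_act l p = foldr braid_act r p"
    unfolding braid_rels_def
  proof (elim UnE CollectE exE conjE)
    fix i j :: nat
    assume lr: "(l, r) = (pos_word [i, j, i], pos_word [j, i, j])" and "\<bar>int i - int j\<bar> = 1"
    then have "j = Suc i \<or> i = Suc j" by linarith
    then show ?thesis
      using lr twist_word_braid[of "Suc (Suc i)" "Suc i" i p] twist_word_braid[of "Suc (Suc j)" "Suc j" j p]
      by (elim disjE) (simp_all add: pos_word_def braid_act_def)
  next
    fix i j :: nat
    assume lr: "(l, r) = (pos_word [i, j], pos_word [j, i])" and "2 \<le> \<bar>int i - int j\<bar>"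
    then have "{Suc i, i} \<inter> {Suc j, j} = {}" by auto
    then show ?thesis
      using lr twist_word_commute[of "Suc i" i "Suc j" j p] p by (simp add: pos_word_def braid_act_def)
  qed
qed (use assms(2) in \<open>auto simp: braid_act_def reduced_twist_word twist_word_inverse\<close>)

definition good_word :: "nat list \<Rightarrow> bool" where
  "good_word w \<longleftrightarrow> reduced w \<and> w \<noteq> [] \<and> last w = 1 \<and> w \<noteq> [1]"

text \<open>The condition \<open>b \<noteq> 1\<close> admits both signs of all generators above the
  first and the inverse of the first, but not the first generator itself. The second alternative is
  the moment when that inverse lengthens \<open>[1]\<close> to \<open>[1, 2, 1]\<close>.\<close>

lemma good_word_twist:
  assumes "good_word w \<or> a = 1 \<and> w = [1]" "a \<noteq> b" "b \<noteq> 1"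
  shows "good_word (twist_word a b w)"
proof -
  have "reduced w" "w \<noteq> []" "last w = 1" "w \<noteq> [1] \<or> a = 1"
    using assms(1) by (auto simp: good_word_def)
  then show ?thesis
    unfolding good_word_def
    using twist_word_last[of w a b] twist_word_last_ne[of w a b] assms(2,3) reduced_twist_word by blast
qed

lemma foldr_braid_act_fix:
  "u \<in> words {2..<n} \<Longrightarrow> foldr braid_act u [1] = [1]"
  by (induction u) (auto simp: braid_act_def twist_def push_def)

lemma foldr_braid_act_good:
  "u \<in> words {2..<n} \<Longrightarrow> good_word w \<Longrightarrow> good_word (foldr braid_act u w)"
  by (induction u) (auto simp: braid_act_def intro!: good_word_twist)

context
  fixes n :: nat
  assumes n3: "n \<ge> 3"
begin

interpretation braid_like "braid_group n" "braid_gen n" n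
  by (rule braid_like_braid_group[OF n3])

lemma K_word:
  assumes "\<kappa> \<in> K"
  shows "\<exists>u. u \<in> words {2..<n} \<and> u \<in> words {1..<n} \<and> \<kappa> = word_class {1..<n} (braid_rels n) u"
proof -
  have sub: "{2..<n} \<subseteq> {1..<n}" by auto
  then have "words {2..<n} \<subseteq> words {1..<n}"
    unfolding words_def by (intro lists_mono) auto
  moreover have "\<kappa> \<in> generate (presented_group {1..<n} (braid_rels n)) (pres_gen {1..<n} (braid_rels n) ` {2..<n})"
    using assms[unfolded K_def] unfolding braid_group_def braid_gen_def[abs_def] .
  then obtain u where "u \<in> words {2..<n}" "\<kappa> = word_class {1..<n} (braid_rels n) u"
    using generate_pres_gen_word[OF sub] by blast
  ultimately show ?thesis by blast
qed

lemma mult_braid_class: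
  "u \<in> words {1..<n} \<Longrightarrow> v \<in> words {1..<n} \<Longrightarrow>
    word_class {1..<n} (braid_rels n) u \<otimes>\<^bsub>braid_group n\<^esub> word_class {1..<n} (braid_rels n) v
    = word_class {1..<n} (braid_rels n) (u @ v)"
  unfolding braid_group_def by (rule mult_word_class)

lemma inv_braid_gen_1:
  "inv\<^bsub>braid_group n\<^esub> braid_gen n 1 = word_class {1..<n} (braid_rels n) [(1, False)]"
  unfolding braid_group_def braid_gen_def by (rule inv_pres_gen) (use n3 in simp)

text \<open>Letters further right act first: those of the last factor from \<open>K\<close> fix
  \<open>[1]\<close>, the last inverse of the first generator makes the word good, and everything to
  its left keeps it good.\<close>

lemma Neg_word:
  "\<nu> \<in> Neg \<Longrightarrow> \<exists>u. u \<in> words {1..<n} \<and> \<nu> = word_class {1..<n} (braid_rels n) u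
    \<and> good_word (foldr braid_act u [1])"
proof (induction rule: Neg.induct)
  case (base \<kappa> \<kappa>')
  obtain u v where u: "u \<in> words {2..<n}" "u \<in> words {1..<n}" "\<kappa> = word_class {1..<n} (braid_rels n) u"
    and v: "v \<in> words {2..<n}" "v \<in> words {1..<n}" "\<kappa>' = word_class {1..<n} (braid_rels n) v"
    using K_word[OF base(1)] K_word[OF base(2)] by blast
  have w: "[(1, False)] \<in> words {1..<n}" using n3 by simp
  have "good_word (foldr braid_act (u @ [(1, False)] @ v) [1])"
    using foldr_braid_act_fix[OF v(1)] good_word_twist[of "[1]" 1 2] foldr_braid_act_good[OF u(1)]
    by (simp add: braid_act_def numeral_2_eq_2)
  moreover have "\<kappa> \<otimes>\<^bsub>braid_group n\<^esub> inv\<^bsub>braid_group n\<^esub> braid_gen n 1 \<otimes>\<^bsub>braid_group n\<^esub> \<kappa>'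
      = word_class {1..<n} (braid_rels n) (u @ [(1, False)] @ v)"
    unfolding inv_braid_gen_1 u(3) v(3)
    using u(2) v(2) w by (simp only: mult_braid_class words_append append_assoc)
  ultimately show ?case
    using u(2) v(2) w by (intro exI[of _ "u @ [(1, False)] @ v"] conjI) (simp_all only: words_append)
next
  case (step \<kappa> \<nu>)
  obtain u v where u: "u \<in> words {2..<n}" "u \<in> words {1..<n}" "\<kappa> = word_class {1..<n} (braid_rels n) u"
    and v: "good_word (foldr braid_act v [1])" "v \<in> words {1..<n}" "\<nu> = word_class {1..<n} (braid_rels n) v"
    using K_word[OF step(1)] step(3) by blast
  have w: "[(1, False)] \<in> words {1..<n}" using n3 by simp
  have "good_word (foldr braid_act (u @ [(1, False)] @ v) [1])"
    using v(1) good_word_twist[of "foldr braid_act v [1]" 1 2] foldr_braid_act_good[OF u(1)]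
    by (simp add: braid_act_def numeral_2_eq_2)
  moreover have "\<kappa> \<otimes>\<^bsub>braid_group n\<^esub> inv\<^bsub>braid_group n\<^esub> braid_gen n 1 \<otimes>\<^bsub>braid_group n\<^esub> \<nu>
      = word_class {1..<n} (braid_rels n) (u @ [(1, False)] @ v)"
    unfolding inv_braid_gen_1 u(3) v(3)
    using u(2) v(2) w by (simp only: mult_braid_class words_append append_assoc)
  ultimately show ?case
    using u(2) v(2) w by (intro exI[of _ "u @ [(1, False)] @ v"] conjI) (simp_all only: words_append)
qed

lemma Neg_not_K:
  assumes "\<nu> \<in> Neg"
  shows "\<nu> \<notin> K"
proof
  assume "\<nu> \<in> K"
  then obtain u where u: "u \<in> words {2..<n}" "u \<in> words {1..<n}"
    "\<nu> = word_class {1..<n} (braid_rels n) u"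
    using K_word by blast
  obtain v where v: "v \<in> words {1..<n}" "\<nu> = word_class {1..<n} (braid_rels n) v"
    "good_word (foldr braid_act v [1])"
    using Neg_word[OF assms] by blast
  have "(u, v) \<in> pres_cong {1..<n} (braid_rels n)"
    using u(3) v(2) word_class_eq_iff[OF u(2) v(1)] by blast
  then have "foldr braid_act u [1] = foldr braid_act v [1]"
    by (rule braid_act_cong) simp
  then show False
    using v(3) foldr_braid_act_fix[OF u(1)] by (simp add: good_word_def)
qed

lemma r1_negative_iff: "r1_negative n \<beta> \<longleftrightarrow> \<beta> \<in> Neg"
  unfolding r1_negative_def Neg_iff_list K_def ..

end

section \<open>Artin groups of odd dihedral type\<close>

lemma (in monoid) pow_mult_shift:
  assumes "x \<in> carrier G" "y \<in> carrier G"
  shows "(x \<otimes> y) [^] (j::nat) \<otimes> x = x \<otimes> (y \<otimes> x) [^] j"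
proof (induction j)
  case (Suc j)
  have "(x \<otimes> y) [^] Suc j \<otimes> x = ((x \<otimes> y) [^] j \<otimes> x) \<otimes> (y \<otimes> x)"
    using assms by (simp add: m_assoc)
  then show ?case
    unfolding Suc using assms by (simp add: m_assoc)
qed (use assms in simp)

lemma (in monoid) list_prod_alt_word:
  assumes "x \<in> carrier G" "y \<in> carrier G"
  shows "list_prod G (alt_word x y (2 * j)) = (x \<otimes> y) [^] j"
    and "list_prod G (alt_word x y (2 * j + 1)) = (x \<otimes> y) [^] j \<otimes> x"
proof -
  show even: "list_prod G (alt_word x y (2 * j)) = (x \<otimes> y) [^] j" for j
  proof (induction j)
    case (Suc j)
    have "list_prod G (alt_word x y (2 * Suc j)) = x \<otimes> (y \<otimes> (x \<otimes> y) [^] j)"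
      using Suc by simp
    also have "\<dots> = (x \<otimes> y) \<otimes> (x \<otimes> y) [^] j"
      using assms by (simp add: m_assoc)
    finally show ?case
      using assms nat_pow_Suc2[of "x \<otimes> y" j] by simp
  qed simp
  show "list_prod G (alt_word x y (2 * j + 1)) = (x \<otimes> y) [^] j \<otimes> x"
  proof (induction j)
    case (Suc j)
    have "list_prod G (alt_word x y (2 * Suc j + 1)) = x \<otimes> (y \<otimes> ((x \<otimes> y) [^] j \<otimes> x))"
      using Suc by simp
    also have "\<dots> = ((x \<otimes> y) \<otimes> (x \<otimes> y) [^] j) \<otimes> x"
      using assms by (simp add: m_assoc)
    finally show ?case
      using assms nat_pow_Suc2[of "x \<otimes> y" j] by simp
  qed (use assms in simp)
qed

text \<open>\<open>deg\<close> is the exponent sum. \<open>cl\<close> stands for the saturation of a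
  set of words: the product of a presented group is defined on arbitrary sets of words and sees only
  their saturations. This matters because \<open>bh\<close> selects its list by \<open>THE\<close>
  among all lists, including those with entries outside the carrier.\<close>

locale dihedral_artin = group G for G (structure) +
  fixes s t :: 'a and k :: nat and deg :: "'a \<Rightarrow> int" and cl :: "'a \<Rightarrow> 'a"
  assumes s_closed [simp]: "s \<in> carrier G" and t_closed [simp]: "t \<in> carrier G"
    and k_pos: "k \<ge> 1"
    and artin_relation: "list_prod G (alt_word s t (2 * k + 1)) = list_prod G (alt_word t s (2 * k + 1))"
    and generated: "carrier G = generate G {s, t}"
    and deg_mult: "x \<in> carrier G \<Longrightarrow> y \<in> carrier G \<Longrightarrow> deg (x \<otimes> y) = deg x + deg y"
    and deg_s [simp]: "deg s = 1" and deg_t [simp]: "deg t = 1"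
    and mult_cl: "cl x \<otimes> cl y = x \<otimes> y"
    and cl_mult: "cl (x \<otimes> y) = x \<otimes> y"
    and cl_carrier: "x \<in> carrier G \<Longrightarrow> cl x = x"
    and carrier_cl: "x \<otimes> y \<in> carrier G \<Longrightarrow> cl x \<in> carrier G \<and> cl y \<in> carrier G"
begin

definition \<Omega> :: 'a where
  "\<Omega> = list_prod G (alt_word s t (2 * k + 1))"

definition \<Delta> :: 'a where
  "\<Delta> = \<Omega> [^] (2::nat)"

lemma \<Omega>_eq: "\<Omega> = (s \<otimes> t) [^] k \<otimes> s" "\<Omega> = (t \<otimes> s) [^] k \<otimes> t"
  using list_prod_alt_word(2)[of s t k] list_prod_alt_word(2)[of t s k] artin_relation
  by (simp_all add: \<Omega>_def)

lemma \<Omega>_closed [simp]: "\<Omega> \<in> carrier G"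
  by (simp add: \<Omega>_eq(1))

lemma \<Delta>_eq: "\<Delta> = \<Omega> \<otimes> \<Omega>"
  by (simp add: \<Delta>_def numeral_2_eq_2)

lemma \<Delta>_closed [simp]: "\<Delta> \<in> carrier G"
  by (simp add: \<Delta>_eq)

lemma \<Omega>_s: "\<Omega> \<otimes> s = t \<otimes> \<Omega>"
proof -
  have "\<Omega> \<otimes> s = ((t \<otimes> s) [^] k \<otimes> t) \<otimes> s"
    by (simp add: \<Omega>_eq(2))
  also have "\<dots> = t \<otimes> \<Omega>"
    unfolding pow_mult_shift[OF t_closed s_closed] \<Omega>_eq(1) by (simp add: m_assoc)
  finally show ?thesis .
qed

lemma \<Omega>_t: "\<Omega> \<otimes> t = s \<otimes> \<Omega>"
proof -
  have "\<Omega> \<otimes> t = ((s \<otimes> t) [^] k \<otimes> s) \<otimes> t"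
    by (simp add: \<Omega>_eq(1))
  also have "\<dots> = s \<otimes> \<Omega>"
    unfolding pow_mult_shift[OF s_closed t_closed] \<Omega>_eq(2) by (simp add: m_assoc)
  finally show ?thesis .
qed

lemma \<Delta>_central: "x \<in> carrier G \<Longrightarrow> \<Delta> \<otimes> x = x \<otimes> \<Delta>"
  unfolding generated
proof (induction rule: generate.induct)
  have *: "\<Delta> \<otimes> h = h \<otimes> \<Delta>" if "h = s \<or> h = t" for h
  proof -
    have "\<Omega> \<otimes> t \<otimes> \<Omega> = s \<otimes> \<Omega> \<otimes> \<Omega>" "\<Omega> \<otimes> s \<otimes> \<Omega> = t \<otimes> \<Omega> \<otimes> \<Omega>"
      by (simp_all add: \<Omega>_s \<Omega>_t)
    then have "\<Omega> \<otimes> (t \<otimes> \<Omega>) = s \<otimes> (\<Omega> \<otimes> \<Omega>)" "\<Omega> \<otimes> (s \<otimes> \<Omega>) = t \<otimes> (\<Omega> \<otimes> \<Omega>)"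
      by (simp_all add: m_assoc)
    then show ?thesis
      using that unfolding \<Delta>_eq by (elim disjE) (simp_all only: m_assoc \<Omega>_s \<Omega>_t \<Omega>_closed s_closed t_closed)
  qed
  {
    case (incl h)
    then show ?case using * by blast
  next
    case (inv h)
    then have "h \<in> carrier G" by auto
    then show ?case
      using *[of h] inv int_pow_intertwine[of h \<Delta> h "-1"] by (simp add: int_pow_neg)
  next
    case (eng h1 h2)
    then have [simp]: "h1 \<in> carrier G" "h2 \<in> carrier G"
      by (simp_all add: generated)
    have "\<Delta> \<otimes> (h1 \<otimes> h2) = (\<Delta> \<otimes> h1) \<otimes> h2"
      by (simp add: m_assoc)
    also have "\<dots> = h1 \<otimes> (\<Delta> \<otimes> h2)"
      unfolding eng(3) by (simp add: m_assoc)
    finally show ?case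
      unfolding eng(4) by (simp add: m_assoc)
  }
qed simp

abbreviation D :: "int \<Rightarrow> 'a" where
  "D q \<equiv> \<Delta> [^] q"

lemma D_central: "x \<in> carrier G \<Longrightarrow> D q \<otimes> x = x \<otimes> D q"
  by (rule int_pow_intertwine) (simp_all add: \<Delta>_central)

lemma D_add: "D p \<otimes> D q = D (p + q)"
  by (simp add: int_pow_mult)

lemma mult_D_mult:
  "x \<in> carrier G \<Longrightarrow> y \<in> carrier G \<Longrightarrow> (x \<otimes> D p) \<otimes> (y \<otimes> D q) = (x \<otimes> y) \<otimes> D (p + q)"
proof -
  assume [simp]: "x \<in> carrier G" "y \<in> carrier G"
  have "(x \<otimes> D p) \<otimes> (y \<otimes> D q) = x \<otimes> (D p \<otimes> y) \<otimes> D q"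
    by (simp add: m_assoc)
  also have "\<dots> = (x \<otimes> y) \<otimes> (D p \<otimes> D q)"
    unfolding D_central[OF \<open>y \<in> carrier G\<close>] by (simp add: m_assoc)
  finally show ?thesis
    by (simp add: D_add)
qed

lemma mult_D_right: "x \<in> carrier G \<Longrightarrow> y \<in> carrier G \<Longrightarrow> (x \<otimes> D p) \<otimes> y = (x \<otimes> y) \<otimes> D p"
  using mult_D_mult[of x y p 0] by simp

lemma inv_mult_D: "x \<in> carrier G \<Longrightarrow> inv (x \<otimes> D p) = inv x \<otimes> D (- p)"
  by (simp add: inv_mult_group int_pow_neg[symmetric] D_central)

text \<open>Modulo the centre \<open>G\<close> is the free product of the groups of order two and \<open>2k + 1\<close> generated
  by \<open>\<Omega>\<close> and \<open>u\<close>.\<close>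

definition u :: 'a where
  "u = \<Omega> \<otimes> t"

abbreviation v :: 'a where
  "v \<equiv> inv u"

lemma u_closed [simp]: "u \<in> carrier G"
  by (simp add: u_def)

lemma s_pow_u: "s [^] (a::int) \<otimes> u = u \<otimes> t [^] a"
proof (rule int_pow_intertwine)
  have "s \<otimes> (\<Omega> \<otimes> t) = (s \<otimes> \<Omega>) \<otimes> t"
    by (simp add: m_assoc)
  also have "\<dots> = (\<Omega> \<otimes> t) \<otimes> t"
    by (simp only: \<Omega>_t)
  finally show "s \<otimes> u = u \<otimes> t"
    unfolding u_def .
qed simp_all

lemma u_u: "u \<otimes> u = (s \<otimes> t) \<otimes> \<Delta>"
proof -
  have "u \<otimes> u = (s \<otimes> \<Omega>) \<otimes> (\<Omega> \<otimes> t)"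
    unfolding u_def by (simp only: \<Omega>_t)
  also have "\<dots> = s \<otimes> (\<Delta> \<otimes> t)"
    by (simp add: \<Delta>_eq m_assoc)
  finally show ?thesis
    by (simp add: \<Delta>_central m_assoc)
qed

lemma u_pow_2k: "u [^] (2 * k) = (s \<otimes> t) [^] k \<otimes> D (int k)"
proof -
  have "u [^] (2 * k) = (u \<otimes> u) [^] k"
    using nat_pow_pow[of u 2 k] by (simp add: numeral_2_eq_2)
  also have "\<dots> = (s \<otimes> t) [^] k \<otimes> \<Delta> [^] k"
    unfolding u_u by (rule pow_mult_distrib) (simp_all add: \<Delta>_central)
  finally show ?thesis
    by (simp add: int_pow_int)
qed

lemma t_u_pow_2k: "t \<otimes> u [^] (2 * k) = \<Omega> \<otimes> D (int k)"
proof -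
  have "t \<otimes> (s \<otimes> t) [^] k = \<Omega>"
    unfolding \<Omega>_eq(2) by (simp add: pow_mult_shift)
  then show ?thesis
    unfolding u_pow_2k by (simp add: m_assoc[symmetric])
qed

lemma u_pow_m: "u [^] (2 * k + 1) = D (int k + 1)"
proof -
  have "u [^] (2 * k + 1) = (s \<otimes> t) [^] k \<otimes> D (int k) \<otimes> (s \<otimes> \<Omega>)"
    using u_pow_2k by (simp add: u_def \<Omega>_t)
  also have "\<dots> = ((s \<otimes> t) [^] k \<otimes> (s \<otimes> \<Omega>)) \<otimes> D (int k)"
    by (simp add: mult_D_right)
  also have "(s \<otimes> t) [^] k \<otimes> (s \<otimes> \<Omega>) = \<Delta>"
    unfolding \<Delta>_eq \<Omega>_eq(1) by (simp add: m_assoc)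
  also have "\<Delta> \<otimes> D (int k) = D (int k + 1)"
    using D_add[of 1 "int k"] by (simp add: add.commute)
  finally show ?thesis .
qed

lemma v_t_v: "v \<otimes> t \<otimes> v = inv t \<otimes> D (- 1)"
proof -
  have "u \<otimes> inv t \<otimes> u = \<Omega> \<otimes> (\<Omega> \<otimes> t)"
    by (simp add: u_def m_assoc)
  also have "\<dots> = t \<otimes> D 1"
    using \<Delta>_central[of t] by (simp add: \<Delta>_eq m_assoc)
  finally have "inv (u \<otimes> inv t \<otimes> u) = inv t \<otimes> D (- 1)"
    by (simp add: inv_mult_D del: int_pow_1)
  then show ?thesis
    by (simp add: inv_mult_group m_assoc)
qed

text \<open>The source of blocks: two occurrences of \<open>v\<close> become one block of
  \<open>s\<close> at the price of one Delta^-1. It is the inverse of u t^-a u = s^-a u^2 combined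
  with \<open>u_u\<close>.\<close>

lemma v_pow_t_v: "v \<otimes> t [^] (a::int) \<otimes> v = inv t \<otimes> s [^] (a - 1) \<otimes> D (- 1)"
proof -
  have "u \<otimes> t [^] (- a) \<otimes> u = s [^] (- a) \<otimes> (u \<otimes> u)"
    using s_pow_u[of "- a"] by (simp add: m_assoc[symmetric])
  also have "\<dots> = (s [^] (- a) \<otimes> s [^] (1::int)) \<otimes> t \<otimes> D 1"
    unfolding u_u by (simp add: m_assoc)
  also have "\<dots> = (s [^] (1 - a) \<otimes> t) \<otimes> D 1"
    using int_pow_mult[of s "- a" 1] by (simp del: int_pow_1)
  finally have "inv (u \<otimes> t [^] (- a) \<otimes> u) = inv (s [^] (1 - a) \<otimes> t) \<otimes> D (- 1)"
    by (simp only: inv_mult_D m_closed int_pow_closed s_closed t_closed)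
  moreover have "inv (s [^] (1 - a)) = s [^] (a - 1)" "inv (t [^] (- a)) = t [^] a"
    by (simp_all flip: int_pow_neg)
  ultimately show ?thesis
    by (simp add: inv_mult_group m_assoc)
qed

text \<open>With a central z such that z^(2k-1) = Delta, and w = v z^k, this reads w = t^-1 w^(2k)
  t^-1: the number of w grows by 2k - 1 and no power of z appears.\<close>

lemma v_eq: "v = inv t \<otimes> v [^] (2 * k) \<otimes> inv t \<otimes> D (int k)"
proof -
  have "t \<otimes> u [^] (2 * k) \<otimes> t = u \<otimes> D (int k)"
    unfolding t_u_pow_2k by (simp add: mult_D_right u_def)
  then have "inv (t \<otimes> u [^] (2 * k) \<otimes> t) = v \<otimes> D (- int k)"
    by (simp add: inv_mult_D)
  then have "v \<otimes> D (- int k) \<otimes> D (int k) = (inv t \<otimes> (inv (u [^] (2 * k)) \<otimes> inv t)) \<otimes> D (int k)"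
    by (simp add: inv_mult_group m_assoc)
  then show ?thesis
    unfolding nat_pow_inv[OF u_closed, symmetric] by (simp add: m_assoc D_add)
qed

lemma v_t_u: "v \<otimes> t \<otimes> u = inv t \<otimes> v [^] (2 * k - 1) \<otimes> D (int k)"
proof -
  have k: "2 * k = Suc (2 * k - 1)"
    using k_pos by simp
  have "v \<otimes> t \<otimes> u [^] (2 * k) = v \<otimes> \<Omega> \<otimes> D (int k)"
    using t_u_pow_2k by (simp add: m_assoc)
  also have "v \<otimes> \<Omega> = inv t"
    unfolding u_def by (simp add: inv_mult_group m_assoc)
  finally have e: "v \<otimes> t \<otimes> u [^] (2 * k) = inv t \<otimes> D (int k)" .
  have "u [^] (2 * k) = u \<otimes> u [^] (2 * k - 1)"
    by (subst k) (rule nat_pow_Suc2, simp)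
  then have "v \<otimes> t \<otimes> u = (v \<otimes> t \<otimes> u [^] (2 * k)) \<otimes> inv (u [^] (2 * k - 1))"
    by (simp add: m_assoc)
  also have "\<dots> = inv t \<otimes> inv (u [^] (2 * k - 1)) \<otimes> D (int k)"
    unfolding e by (rule mult_D_right) simp_all
  finally show ?thesis
    by (simp add: nat_pow_inv)
qed

text \<open>Zero exponents are allowed, so \<open>d\<close> is an upper bound for the number of
  genuine blocks; \<open>SB_mono\<close> rests on this.\<close>

inductive SB :: "nat \<Rightarrow> 'a \<Rightarrow> bool" where
  zero: "SB 0 (t [^] (a::int))"
| Suc: "SB d g \<Longrightarrow> SB (Suc d) (g \<otimes> s [^] (x::int) \<otimes> t [^] (y::int))"

lemma SB_closed [simp]: "SB d g \<Longrightarrow> g \<in> carrier G"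
  by (induction rule: SB.induct) simp_all

lemma SB_t: "SB d g \<Longrightarrow> SB d (g \<otimes> t [^] (a::int))"
proof (induction rule: SB.cases)
  case (zero b)
  then show ?thesis using SB.zero[of "b + a"] by (simp add: int_pow_mult)
next
  case (Suc d' h x y)
  then show ?thesis using SB.Suc[of d' h x "y + a"] by (simp add: int_pow_mult m_assoc)
qed

lemma SB_s: "SB d g \<Longrightarrow> SB (Suc d) (g \<otimes> s [^] (x::int))"
  using SB.Suc[of d g x 0] by simp

lemma SB_mult: "SB n h \<Longrightarrow> SB m g \<Longrightarrow> SB (m + n) (g \<otimes> h)"
proof (induction rule: SB.induct)
  case (zero a)
  then show ?case using SB_t by simp
next
  case (Suc d h x y)
  then show ?case using SB.Suc[of "m + d" "g \<otimes> h" x y] by (simp add: m_assoc)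
qed

lemma SB_mono: "SB d g \<Longrightarrow> SB (d + e) g"
  using SB_s[of _ g 0] by (induction e) simp_all

lemma SB_inv: "SB d g \<Longrightarrow> SB d (inv g)"
proof (induction rule: SB.induct)
  case (zero a)
  then show ?case using SB.zero[of "- a"] by (simp add: int_pow_neg)
next
  case (Suc d g x y)
  have "SB 1 (t [^] (- y) \<otimes> s [^] (- x))"
    using SB_s[OF SB.zero] by simp
  from SB_mult[OF Suc.IH this]
  have "SB (Suc d) (t [^] (- y) \<otimes> s [^] (- x) \<otimes> inv g)"
    by simp
  then show ?case using Suc.hyps by (simp add: inv_mult_group m_assoc int_pow_neg)
qed

lemma SB_split: "SB (m + n) g \<Longrightarrow> \<exists>g1 g2. SB m g1 \<and> SB n g2 \<and> g = g1 \<otimes> g2"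
proof (induction n arbitrary: g)
  case 0
  have "SB 0 \<one>" using SB.zero[of 0] by simp
  then show ?case using 0 by (intro exI[of _ g] exI[of _ \<one>]) simp
next
  case (Suc n)
  from Suc.prems have "SB (Suc (m + n)) g" by simp
  then obtain h x y where h: "SB (m + n) h" "g = h \<otimes> s [^] (x::int) \<otimes> t [^] (y::int)"
    by (cases rule: SB.cases) auto
  then obtain g1 g2 where g: "SB m g1" "SB n g2" "h = g1 \<otimes> g2"
    using Suc.IH by blast
  then show ?case
    using h(2) SB.Suc[OF g(2), of x y]
    by (intro exI[of _ g1] exI[of _ "g2 \<otimes> s [^] x \<otimes> t [^] y"]) (simp add: m_assoc)
qed

lemma SB_list:
  "SB d g \<Longrightarrow> \<exists>(a::int) ps. length ps = d \<and>
     g = t [^] a \<otimes> list_prod G (map (\<lambda>(x::int, y::int). s [^] x \<otimes> t [^] y) ps)"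
proof (induction rule: SB.induct)
  case (zero a)
  then show ?case by (intro exI[of _ a] exI[of _ "[]"]) simp
next
  case (Suc d g x y)
  then obtain a :: int and ps where *: "length ps = d"
    "g = t [^] a \<otimes> list_prod G (map (\<lambda>(x::int, y::int). s [^] x \<otimes> t [^] y) ps)"
    by blast
  have "set (map (\<lambda>(x::int, y::int). s [^] x \<otimes> t [^] y) qs) \<subseteq> carrier G" for qs
    by auto
  note carr = this list_prod_closed[OF this] list_prod_append[OF this this]
  have "g \<otimes> s [^] x \<otimes> t [^] y
      = t [^] a \<otimes> list_prod G (map (\<lambda>(x::int, y::int). s [^] x \<otimes> t [^] y) (ps @ [(x, y)]))"
    unfolding *(2) map_append carr(3) using carr(2)[of ps] by (simp add: m_assoc)
  then show ?case using *(1) by (intro exI[of _ a] exI[of _ "ps @ [(x, y)]"]) simp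
qed

text \<open>Both signs of \<open>t\<close> occur but no inverse of \<open>v\<close>. In contrast to
  \<open>SB\<close> the number of \<open>v\<close> is kept exact, because it is balanced against the
  exponent of Delta.\<close>

inductive W :: "nat \<Rightarrow> 'a \<Rightarrow> bool" where
  zero: "W 0 (t [^] (a::int))"
| Suc: "W n g \<Longrightarrow> W (Suc n) (g \<otimes> v \<otimes> t [^] (a::int))"

lemma W_closed [simp]: "W n g \<Longrightarrow> g \<in> carrier G"
  by (induction rule: W.induct) simp_all

lemma W_t: "W n g \<Longrightarrow> W n (g \<otimes> t [^] (a::int))"
proof (induction rule: W.cases)
  case (zero b)
  then show ?thesis using W.zero[of "b + a"] by (simp add: int_pow_mult)
next
  case (Suc n h b)
  then show ?thesis using W.Suc[of n h "b + a"] by (simp add: int_pow_mult m_assoc)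
qed

lemma W_inv_t: "W n g \<Longrightarrow> W n (g \<otimes> inv t)"
  using W_t[of n g "-1"] by (simp add: int_pow_neg)

lemma W_v: "W n g \<Longrightarrow> W (Suc n) (g \<otimes> v)"
  using W.Suc[of n g 0] by simp

lemma W_v_pow: "W n g \<Longrightarrow> W (n + j) (g \<otimes> v [^] (j::nat))"
proof (induction j)
  case (Suc j)
  then show ?case using W_v[of "n + j" "g \<otimes> v [^] j"] by (simp add: m_assoc)
qed simp

text \<open>The occurrences of \<open>v\<close> are paired from the right by
  \<open>v_pow_t_v\<close>; every pair yields one block and one Delta^-1.\<close>

lemma W_even_SB: "W (2 * d) g \<Longrightarrow> SB d (g \<otimes> D (int d))"
proof (induction d arbitrary: g)
  case 0
  then show ?case by (cases rule: W.cases) (auto intro: SB.zero)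
next
  case (Suc d)
  from Suc.prems have "W (Suc (Suc (2 * d))) g" by simp
  then obtain g1 b where g1: "W (Suc (2 * d)) g1" "g = g1 \<otimes> v \<otimes> t [^] (b::int)"
    by (cases rule: W.cases) auto
  from g1(1) obtain h a where h: "W (2 * d) h" "g1 = h \<otimes> v \<otimes> t [^] (a::int)"
    by (cases rule: W.cases) auto
  have cl: "h \<in> carrier G" using h(1) by simp
  have "g = h \<otimes> (v \<otimes> t [^] a \<otimes> v) \<otimes> t [^] b"
    unfolding g1(2) h(2) using cl by (simp add: m_assoc)
  also have "\<dots> = (h \<otimes> inv t \<otimes> s [^] (a - 1) \<otimes> t [^] b) \<otimes> D (- 1)"
    unfolding v_pow_t_v using cl by (simp add: m_assoc D_central[of "t [^] b"])
  finally have "g \<otimes> D (int (Suc d)) = (h \<otimes> inv t \<otimes> s [^] (a - 1) \<otimes> t [^] b) \<otimes> (D (- 1) \<otimes> D (int (Suc d)))"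
    using cl by (simp add: m_assoc)
  also have "\<dots> = ((h \<otimes> D (int d)) \<otimes> inv t) \<otimes> s [^] (a - 1) \<otimes> t [^] b"
    unfolding D_add using cl by (simp add: mult_D_right)
  finally show ?case
    using SB.Suc[OF SB_t[OF Suc.IH[OF h(1)], of "-1"], of "a - 1" b] by (simp add: int_pow_neg)
qed

text \<open>Expands the last \<open>v\<close> by \<open>v_eq\<close>. Its purpose is to change the
  parity of the number of \<open>v\<close>, so that they can be paired.\<close>

lemma W_lengthen:
  assumes "W (Suc n) g"
  shows "W (n + 2 * k) (g \<otimes> D (- int k))"
proof -
  from assms obtain h a where h: "W n h" "g = h \<otimes> v \<otimes> t [^] (a::int)"
    by (cases rule: W.cases) auto
  have cl: "h \<in> carrier G" using h(1) by simp
  have "g = h \<otimes> (inv t \<otimes> v [^] (2 * k) \<otimes> inv t \<otimes> D (int k)) \<otimes> t [^] a"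
    unfolding h(2) by (subst v_eq) (rule HOL.refl)
  also have "\<dots> = (h \<otimes> inv t \<otimes> v [^] (2 * k) \<otimes> inv t \<otimes> t [^] a) \<otimes> D (int k)"
    using cl by (simp add: m_assoc D_central[of "t [^] a"])
  finally have "g \<otimes> D (- int k) = h \<otimes> inv t \<otimes> v [^] (2 * k) \<otimes> inv t \<otimes> t [^] a"
    using cl by (simp add: m_assoc D_add)
  then show ?thesis
    using W_t[OF W_inv_t[OF W_v_pow[OF W_inv_t[OF h(1)]]]] by simp
qed

lemma v_pow_pred: "v [^] (2 * k - 1) \<otimes> v = v [^] (2 * k)"
proof -
  have "v [^] (2 * k - 1) \<otimes> v = v [^] Suc (2 * k - 1)"
    by simp
  also have "Suc (2 * k - 1) = 2 * k"
    using k_pos by simp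
  finally show ?thesis .
qed

lemma v_t: "v \<otimes> t = inv t \<otimes> v [^] (2 * k) \<otimes> D (int k)"
proof -
  have "v \<otimes> t = v \<otimes> t \<otimes> u \<otimes> v"
    by (simp add: m_assoc)
  also have "\<dots> = inv t \<otimes> v [^] (2 * k) \<otimes> D (int k)"
    unfolding v_t_u v_pow_pred[symmetric] by (simp add: m_assoc D_central[of v])
  finally show ?thesis .
qed

text \<open>By \<open>v_t\<close>, each \<open>t\<close> consumes one trailing \<open>v\<close> and
  leaves 2k of them behind. A positive power of \<open>t\<close> thus disappears to the left and a
  trailing power with exponent \<open>2 * k\<close> is restored.\<close>

lemma W_absorb:
  assumes "W n g" "E \<ge> 1"
  shows "\<exists>n' g'. W n' g' \<and> g \<otimes> v [^] E \<otimes> t [^] Suc b = g' \<otimes> v [^] (2 * k) \<otimes> D (int k * int (Suc b))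
    \<and> n' + 2 * k = n + E + (2 * k - 1) * Suc b"
proof (induction b)
  case 0
  obtain E' where E: "E = Suc E'" using assms(2) by (cases E) auto
  have cl: "g \<in> carrier G" using assms(1) by simp
  have "g \<otimes> v [^] E \<otimes> t [^] Suc 0 = g \<otimes> v [^] E' \<otimes> (v \<otimes> t)"
    using cl by (simp add: E m_assoc)
  also have "\<dots> = (g \<otimes> v [^] E' \<otimes> inv t) \<otimes> v [^] (2 * k) \<otimes> D (int k * int (Suc 0))"
    unfolding v_t using cl by (simp add: m_assoc)
  finally show ?case
    using W_inv_t[OF W_v_pow[OF assms(1)], of E'] E k_pos
    by (intro exI[of _ "n + E'"] exI[of _ "g \<otimes> v [^] E' \<otimes> inv t"]) simp
next
  case (Suc b)
  then obtain n' g' where g': "W n' g'"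
    "g \<otimes> v [^] E \<otimes> t [^] Suc b = g' \<otimes> v [^] (2 * k) \<otimes> D (int k * int (Suc b))"
    "n' + 2 * k = n + E + (2 * k - 1) * Suc b"
    by blast
  have cl: "g \<in> carrier G" "g' \<in> carrier G" using assms(1) g'(1) by simp_all
  have "g \<otimes> v [^] E \<otimes> t [^] Suc (Suc b) = (g \<otimes> v [^] E \<otimes> t [^] Suc b) \<otimes> t"
    using cl by (simp add: m_assoc)
  also have "\<dots> = (g' \<otimes> v [^] (2 * k - 1) \<otimes> (v \<otimes> t)) \<otimes> D (int k * int (Suc b))"
    unfolding g'(2) v_pow_pred[symmetric] using cl by (simp add: m_assoc D_central[of t])
  also have "\<dots> = (g' \<otimes> v [^] (2 * k - 1) \<otimes> inv t) \<otimes> v [^] (2 * k) \<otimes> (D (int k) \<otimes> D (int k * int (Suc b)))"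
    unfolding v_t using cl by (simp add: m_assoc)
  also have "D (int k) \<otimes> D (int k * int (Suc b)) = D (int k * int (Suc (Suc b)))"
    by (simp add: D_add algebra_simps)
  finally show ?case
    using W_inv_t[OF W_v_pow[OF g'(1)], of "2 * k - 1"] g'(3) k_pos
    by (intro exI[of _ "n' + (2 * k - 1)"] exI[of _ "g' \<otimes> v [^] (2 * k - 1) \<otimes> inv t"]) simp
qed

end

lemma (in monoid) gen_submonoid_eq:
  assumes "X \<subseteq> carrier G"
  shows "gen_submonoid G X = {list_prod G xs | xs. set xs \<subseteq> X}" (is "_ = ?L")
proof
  have "submonoid ?L G"
  proof
    show "?L \<subseteq> carrier G" using assms by (auto intro!: list_prod_closed)
    show "\<one> \<in> ?L" by (auto intro: exI[of _ "[]"])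
    fix x y assume "x \<in> ?L" "y \<in> ?L"
    then obtain xs ys where "set xs \<subseteq> X" "x = list_prod G xs" "set ys \<subseteq> X" "y = list_prod G ys"
      by blast
    then have "x \<otimes> y = list_prod G (xs @ ys)" "set (xs @ ys) \<subseteq> X"
      using list_prod_append[of xs ys] assms by auto
    then show "x \<otimes> y \<in> ?L" by blast
  qed
  moreover have "X \<subseteq> ?L"
  proof
    fix x assume "x \<in> X"
    then have "x = list_prod G [x]" "set [x] \<subseteq> X" using assms by auto
    then show "x \<in> ?L" by blast
  qed
  ultimately show "gen_submonoid G X \<subseteq> ?L"
    unfolding gen_submonoid_def by (intro hull_minimal)
  have "list_prod G xs \<in> K" if "submonoid K G" "X \<subseteq> K" "set xs \<subseteq> X" for xs K
    using that(3)
    by (induction xs) (use that in \<open>auto intro: submonoid.one_closed submonoid.m_closed\<close>)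
  then show "?L \<subseteq> gen_submonoid G X"
    unfolding gen_submonoid_def hull_def by blast
qed

context dihedral_artin
begin

section \<open>The positive monoid and its words in maximal blocks\<close>

lemma deg_one [simp]: "deg \<one> = 0"
  using deg_mult[of \<one> \<one>] by simp

lemma deg_inv [simp]: "x \<in> carrier G \<Longrightarrow> deg (inv x) = - deg x"
  using deg_mult[of x "inv x"] by simp

lemma deg_nat_pow: "x \<in> carrier G \<Longrightarrow> deg (x [^] (n::nat)) = int n * deg x"
  by (induction n) (simp_all add: deg_mult algebra_simps)

definition M :: "'a set" where
  "M = gen_submonoid G {s, t}"

lemma M_eq: "M = {list_prod G xs | xs. set xs \<subseteq> {s, t}}"
  unfolding M_def by (rule gen_submonoid_eq) simp

lemma M_closed [simp]: "a \<in> M \<Longrightarrow> a \<in> carrier G"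
  unfolding M_eq by (auto intro!: list_prod_closed)

lemma M_one [simp]: "\<one> \<in> M"
  unfolding M_eq by (auto intro: exI[of _ "[]"])

lemma M_mult [simp]:
  assumes "a \<in> M" "b \<in> M"
  shows "a \<otimes> b \<in> M"
proof -
  obtain xs ys where "set xs \<subseteq> {s, t}" "a = list_prod G xs" "set ys \<subseteq> {s, t}" "b = list_prod G ys"
    using assms unfolding M_eq by blast
  moreover from this have "set xs \<subseteq> carrier G" "set ys \<subseteq> carrier G" by auto
  ultimately have "a \<otimes> b = list_prod G (xs @ ys)" "set (xs @ ys) \<subseteq> {s, t}"
    by (simp_all add: list_prod_append)
  then show ?thesis unfolding M_eq by blast
qed

lemma M_gens: "x \<in> {s, t} \<Longrightarrow> x \<in> M"
  unfolding M_eq by (force intro: exI[of _ "[x]"])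

lemma M_s [simp]: "s \<in> M" and M_t [simp]: "t \<in> M"
  by (simp_all add: M_gens)

lemma M_pow [simp]: "a \<in> M \<Longrightarrow> a [^] (n::nat) \<in> M"
  by (induction n) simp_all

lemma M_induct [consumes 1, case_names one snoc]:
  assumes "a \<in> M" "P \<one>" "\<And>a x. a \<in> M \<Longrightarrow> P a \<Longrightarrow> x \<in> {s, t} \<Longrightarrow> P (a \<otimes> x)"
  shows "P a"
proof -
  have "P (list_prod G xs) \<and> list_prod G xs \<in> M" if "set xs \<subseteq> {s, t}" for xs
    using that
  proof (induction xs rule: rev_induct)
    case (snoc x xs)
    then have x: "x \<in> {s, t}" and "set xs \<subseteq> carrier G" "set [x] \<subseteq> carrier G" by auto
    then have "list_prod G (xs @ [x]) = list_prod G xs \<otimes> x"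
      by (simp add: list_prod_append)
    then show ?case
      using snoc assms(3)[of "list_prod G xs" x] M_gens[OF x] by simp
  qed (simp add: assms(2))
  then show ?thesis
    using assms(1) unfolding M_eq by blast
qed

lemma deg_M: "a \<in> M \<Longrightarrow> 0 \<le> deg a \<and> (deg a = 0 \<longrightarrow> a = \<one>)"
proof (induction rule: M_induct)
  case (snoc a x)
  then have "x \<in> carrier G" "deg x = 1" by auto
  then show ?case using snoc by (simp add: deg_mult)
qed simp

lemma M_divisible:
  assumes "a \<in> M" "a \<noteq> \<one>"
  shows "a \<otimes> inv s \<in> M \<or> a \<otimes> inv t \<in> M"
  using assms
proof (induction rule: M_induct)
  case (snoc b x)
  then show ?case by (auto simp: m_assoc)
qed simp

lemma not_divisible_pow:
  assumes "x \<in> {s, t}" "b \<otimes> inv x \<notin> M" "b \<in> carrier G"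
  shows "b \<otimes> inv (x [^] Suc n) \<notin> M"
proof
  assume *: "b \<otimes> inv (x [^] Suc n) \<in> M"
  have x: "x \<in> carrier G" "x \<in> M" using assms(1) M_gens by auto
  have "x [^] Suc n = x [^] n \<otimes> x" by simp
  have "b \<otimes> inv (x [^] Suc n) \<otimes> x [^] n = b \<otimes> inv x \<otimes> (inv (x [^] n) \<otimes> x [^] n)"
    using x assms(3) by (simp add: inv_mult_group m_assoc)
  also have "\<dots> = b \<otimes> inv x"
    using x assms(3) by simp
  finally show False
    using * x assms(2) M_mult[OF * M_pow[OF x(2), of n]] by simp
qed

text \<open>The degree of \<open>a\<close> bounds the exponents of the powers of \<open>x\<close>
  dividing it, so a greatest exponent exists.\<close>

lemma maximal_power:
  assumes "a \<in> M" "x \<in> {s, t}"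
  obtains n b where "b \<in> M" "a = b \<otimes> x [^] (n::nat)" "b \<otimes> inv x \<notin> M"
    "a \<otimes> inv x \<in> M \<Longrightarrow> n \<ge> 1"
proof -
  have x: "x \<in> carrier G" "x \<in> M" "deg x = 1" using assms(2) M_gens by auto
  let ?P = "\<lambda>n::nat. a \<otimes> inv (x [^] n) \<in> M"
  have bound: "n \<le> nat (deg a)" if "?P n" for n
  proof -
    have "0 \<le> deg (a \<otimes> inv (x [^] n))" using deg_M[OF that] by simp
    then show ?thesis
      using assms(1) x by (simp add: deg_mult deg_nat_pow)
  qed
  have zero: "?P 0" using assms(1) by simp
  define n where "n = Greatest ?P"
  have n: "?P n" "?P m \<Longrightarrow> m \<le> n" for m
    unfolding n_def using bound GreatestI_nat[of ?P, OF zero] Greatest_le_nat[of ?P m] by blast+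
  have "a \<otimes> inv (x [^] Suc n) = (a \<otimes> inv (x [^] n)) \<otimes> inv x"
    using assms(1) x nat_pow_Suc2[of x n] by (simp add: inv_mult_group m_assoc del: nat_pow_Suc)
  then have "(a \<otimes> inv (x [^] n)) \<otimes> inv x \<notin> M"
    using n(2)[of "Suc n"] by auto
  moreover have "a = (a \<otimes> inv (x [^] n)) \<otimes> x [^] n"
    using assms(1) x by (simp add: m_assoc)
  moreover have "n \<ge> 1" if "a \<otimes> inv x \<in> M"
    using n(2)[of 1] that x by simp
  ultimately show thesis
    using that[OF n(1)] by blast
qed

text \<open>A product of blocks, listed from the right: \<open>val x y [e\<^sub>1, e\<^sub>2, \<dots>]\<close> is
  \<open>\<cdots> y\<^bsup>e\<^sub>2\<^esup> x\<^bsup>e\<^sub>1\<^esup>\<close>.\<close>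

fun val :: "'a \<Rightarrow> 'a \<Rightarrow> nat list \<Rightarrow> 'a" where
  "val x y [] = \<one>"
| "val x y (n # ns) = val y x ns \<otimes> x [^] n"

text \<open>The last conjunct forbids divisibility by the letter \<open>y\<close> that may follow on
  the right. Hence a \<open>y\<close>-block appended there is the full power of \<open>y\<close>
  dividing the product, as \<open>tau\<close> demands.\<close>

fun greedy :: "'a \<Rightarrow> 'a \<Rightarrow> nat list \<Rightarrow> bool" where
  "greedy x y [] \<longleftrightarrow> True"
| "greedy x y (n # ns) \<longleftrightarrow> n \<ge> 1 \<and> greedy y x ns \<and> val y x ns \<otimes> x [^] n \<otimes> inv y \<notin> M"

lemma val_M: "{x, y} = {s, t} \<Longrightarrow> val x y ns \<in> M"
proof (induction ns arbitrary: x y)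
  case (Cons n ns)
  have "{y, x} = {s, t}" "x \<in> {s, t}" using Cons.prems by auto
  then show ?case using Cons.IH M_gens by simp
qed simp

lemma greedy_exists:
  "a \<in> M \<Longrightarrow> {x, y} = {s, t} \<Longrightarrow> a \<otimes> inv y \<notin> M \<Longrightarrow> \<exists>ns. greedy x y ns \<and> a = val x y ns"
proof (induction "nat (deg a)" arbitrary: a x y rule: less_induct)
  case less
  show ?case
  proof (cases "a = \<one>")
    case True
    then show ?thesis by (intro exI[of _ "[]"]) simp
  next
    case False
    have xy: "x \<in> {s, t}" "{y, x} = {s, t}" "x \<in> carrier G" "deg x = 1"
      using less.prems(2) by (auto simp: doubleton_eq_iff)
    have "a \<otimes> inv x \<in> M"
      using M_divisible[OF less.prems(1) False] less.prems(2,3) by (auto simp: doubleton_eq_iff)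
    then obtain n b where b: "b \<in> M" "a = b \<otimes> x [^] (n::nat)" "b \<otimes> inv x \<notin> M" "n \<ge> 1"
      using maximal_power[OF less.prems(1) xy(1)] by blast
    have "deg a = deg b + int n"
      using b xy by (simp add: deg_mult deg_nat_pow)
    then have "nat (deg b) < nat (deg a)"
      using deg_M[OF b(1)] b(4) by simp
    then obtain ns where "greedy y x ns" "b = val y x ns"
      using less.hyps b(1,3) xy(2) by blast
    then show ?thesis
      using b less.prems(3) by (intro exI[of _ "n # ns"]) simp
  qed
qed

text \<open>The final exponent of \<open>t\<close> may be 0, just as the first factor of an
  alternating form of a nontrivial element may be trivial.\<close>

lemma greedy_form:
  assumes "a \<in> M"
  obtains n ns where "a = val s t ns \<otimes> t [^] (n::nat)" "greedy s t ns"
proof -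
  obtain n b where b: "b \<in> M" "a = b \<otimes> t [^] (n::nat)" "b \<otimes> inv t \<notin> M"
    by (rule maximal_power[OF assms, of t]) auto
  then obtain ns where "greedy s t ns" "b = val s t ns"
    using greedy_exists[of b s t] by auto
  then show thesis using that b(2) by blast
qed

lemma val_not_divisible:
  assumes "greedy x y ns" "y \<in> {s, t}"
  shows "val x y ns \<otimes> inv y \<notin> M"
proof (cases ns)
  case Nil
  show ?thesis
  proof
    assume "val x y ns \<otimes> inv y \<in> M"
    then have "0 \<le> deg (val x y ns \<otimes> inv y)" using deg_M by blast
    then show False using Nil assms(2) by (auto simp: deg_mult)
  qed
qed (use assms in simp)

section \<open>Alternating forms\<close>

definition Mon :: "'a \<Rightarrow> 'a set" where
  "Mon x = gen_submonoid G {x}"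

lemma Mon_eq: "x \<in> carrier G \<Longrightarrow> Mon x = {x [^] n | n::nat. True}"
proof -
  assume x: "x \<in> carrier G"
  have pow: "list_prod G xs = x [^] length xs" if "set xs \<subseteq> {x}" for xs
    using that x by (induction xs) (simp_all add: nat_pow_Suc2[OF x, symmetric])
  have "gen_submonoid G {x} = {list_prod G xs | xs. set xs \<subseteq> {x}}"
    by (rule gen_submonoid_eq) (use x in simp)
  also have "\<dots> = {x [^] n | n::nat. True}"
  proof (intro equalityI subsetI)
    fix y assume "y \<in> {list_prod G xs | xs. set xs \<subseteq> {x}}"
    then show "y \<in> {x [^] n | n::nat. True}" using pow by blast
  next
    fix y assume "y \<in> {x [^] n | n::nat. True}"
    then obtain n :: nat where y: "y = x [^] n" by blast
    have sub: "set (replicate n x) \<subseteq> {x}" by auto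
    have "y = list_prod G (replicate n x)"
      using pow[OF sub] y by simp
    then show "y \<in> {list_prod G xs | xs. set xs \<subseteq> {x}}" using sub by blast
  qed
  finally show ?thesis unfolding Mon_def .
qed

text \<open>By \<open>not_divisible_pow\<close> the powers of \<open>x\<close> dividing the product
  are exactly those with exponent at most \<open>n\<close>. Different powers have different degrees,
  so the description in \<open>tau\<close> has a single solution.\<close>

lemma tau_Mon:
  assumes "x \<in> {s, t}" "b \<in> M" "b \<otimes> inv x \<notin> M"
  shows "tau G M (Mon x) (b \<otimes> x [^] (n::nat)) = x [^] n"
proof -
  have x: "x \<in> carrier G" "x \<in> M" "deg x = 1" using assms(1) M_gens by auto
  have inj: "i = j" if "x [^] i = x [^] j" for i j :: nat
    using arg_cong[OF that, of deg] x by (simp add: deg_nat_pow)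
  have le: "x [^] i \<otimes> inv (x [^] j) \<in> M \<longleftrightarrow> j \<le> i" for i j :: nat
  proof
    assume "x [^] i \<otimes> inv (x [^] j) \<in> M"
    then have "0 \<le> deg (x [^] i \<otimes> inv (x [^] j))" using deg_M by blast
    then show "j \<le> i" using x by (simp add: deg_mult deg_nat_pow)
  next
    assume "j \<le> i"
    then have "x [^] i = x [^] (i - j) \<otimes> x [^] j"
      using x by (simp add: nat_pow_mult)
    then show "x [^] i \<otimes> inv (x [^] j) \<in> M"
      using x by (simp add: m_assoc)
  qed
  have leb: "b \<otimes> x [^] n \<otimes> inv (x [^] j) \<in> M \<longleftrightarrow> j \<le> n" for j :: nat
  proof (cases "j \<le> n")
    case True
    then have "x [^] n \<otimes> inv (x [^] j) \<in> M" using le by simp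
    then show ?thesis using True assms(2) x M_mult[of b "x [^] n \<otimes> inv (x [^] j)"] by (simp add: m_assoc)
  next
    case False
    then obtain i where j: "j = Suc i + n" using less_imp_Suc_add[of n j] by auto
    have "x [^] j = x [^] Suc i \<otimes> x [^] n"
      unfolding j using x by (simp only: nat_pow_mult)
    then have "b \<otimes> x [^] n \<otimes> inv (x [^] j) = b \<otimes> inv (x [^] Suc i)"
      using x assms(2) by (simp add: inv_mult_group m_assoc del: nat_pow_Suc) (simp add: m_assoc[symmetric])
    then show ?thesis
      using False not_divisible_pow[OF assms(1,3), of i] assms(2) by simp
  qed
  have sets: "{c \<in> Mon x. le_R G M c (b \<otimes> x [^] n)} = {c \<in> Mon x. le_R G M c (x [^] i)} \<longleftrightarrow> i = n" for i
  proof -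
    have "{c \<in> Mon x. le_R G M c (b \<otimes> x [^] n)} = (\<lambda>j. x [^] j) ` {..n}"
      "{c \<in> Mon x. le_R G M c (x [^] i)} = (\<lambda>j. x [^] j) ` {..i}"
      unfolding Mon_eq[OF x(1)] le_R_def using le leb by auto
    moreover have "inj (\<lambda>j::nat. x [^] j)"
      using inj by (auto simp: inj_def)
    ultimately show ?thesis
      using inj_image_eq_iff[of "\<lambda>j::nat. x [^] j" "{..n}" "{..i}"] by auto
  qed
  show ?thesis
    unfolding tau_def
  proof (rule the_equality)
    show "x [^] n \<in> Mon x \<and> {c \<in> Mon x. le_R G M c (b \<otimes> x [^] n)} = {c \<in> Mon x. le_R G M c (x [^] n)}"
      using sets[of n] Mon_eq[OF x(1)] by auto
  next
    fix c assume c: "c \<in> Mon x \<and> {c \<in> Mon x. le_R G M c (b \<otimes> x [^] n)} = {d \<in> Mon x. le_R G M d c}"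
    then obtain i :: nat where i: "c = x [^] i" using Mon_eq[OF x(1)] by auto
    show "c = x [^] n" using c sets[of i] unfolding i by auto
  qed
qed

lemma tau_divides:
  assumes "x \<in> {s, t}" "a \<in> M"
  obtains n :: nat where "tau G M (Mon x) a = x [^] n" "a \<otimes> inv (x [^] n) \<in> M"
proof -
  obtain n b where b: "b \<in> M" "a = b \<otimes> x [^] (n::nat)" "b \<otimes> inv x \<notin> M"
    by (rule maximal_power[OF assms(2,1)]) blast
  have "a \<otimes> inv (x [^] n) = b"
    using b assms(1) by (auto simp: m_assoc)
  then show thesis
    using that tau_Mon[OF assms(1) b(1,3), of n] b(1,2) by simp
qed

text \<open>Stated for either order of the letters and without fixing the product, so that the tail
  of a form is again a form, with the letters exchanged.\<close>

definition alt_form :: "'a \<Rightarrow> 'a \<Rightarrow> 'a list \<Rightarrow> bool" where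
  "alt_form x y as \<longleftrightarrow> as \<noteq> [] \<and> last as \<noteq> \<one> \<and>
     (\<forall>i < length as. as ! i = tau G M (if even i then Mon x else Mon y) (list_prod G (rev (drop i as))))"

lemma alt_form_Nil: "\<not> alt_form x y []"
  by (simp add: alt_form_def)

lemma alt_form_Cons:
  "alt_form x y (c # as) \<longleftrightarrow> c = tau G M (Mon x) (list_prod G (rev (c # as))) \<and>
     (if as = [] then c \<noteq> \<one> else alt_form y x as)"
proof -
  have odd: "(if even (Suc i) then Mon x else Mon y) = (if even i then Mon y else Mon x)" for i
    by simp
  have "(\<forall>i < length (c # as). (c # as) ! i = tau G M (if even i then Mon x else Mon y) (list_prod G (rev (drop i (c # as)))))
    \<longleftrightarrow> c = tau G M (Mon x) (list_prod G (rev (c # as))) \<and>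
      (\<forall>i < length as. as ! i = tau G M (if even i then Mon y else Mon x) (list_prod G (rev (drop i as))))"
    unfolding length_Cons All_less_Suc2 nth_Cons_Suc drop_Suc_Cons odd by simp
  then show ?thesis
    unfolding alt_form_def by auto
qed

text \<open>The factors of an alternating form are not assumed to lie in the carrier; this is where the
  closure operator \<open>cl\<close> is needed.\<close>

lemma list_prod_snoc_cl:
  assumes "list_prod G (ys @ [c]) \<in> carrier G"
  shows "list_prod G ys \<in> carrier G" "cl c \<in> carrier G"
    "list_prod G (ys @ [c]) = list_prod G ys \<otimes> cl c"
proof -
  have "list_prod G ys \<in> carrier G \<and> cl c \<in> carrier G \<and> list_prod G (ys @ [c]) = list_prod G ys \<otimes> cl c"
    using assms
  proof (induction ys)
    case Nil
    have "c \<otimes> \<one> \<in> carrier G" using Nil by simp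
    then have "cl c \<in> carrier G" using carrier_cl by blast
    moreover have "c \<otimes> \<one> = cl c \<otimes> \<one>"
      using mult_cl[of c \<one>] cl_carrier[of \<one>] by simp
    ultimately show ?case by simp
  next
    case (Cons y ys)
    have yP: "y \<otimes> list_prod G (ys @ [c]) \<in> carrier G" using Cons.prems by simp
    have "cl (list_prod G (ys @ [c])) = list_prod G (ys @ [c])"
      by (cases ys) (simp_all add: cl_mult)
    then have P: "list_prod G (ys @ [c]) \<in> carrier G" "cl y \<in> carrier G"
      using carrier_cl[OF yP] by auto
    note IH = Cons.IH[OF P(1)]
    have e: "y \<otimes> z = cl y \<otimes> z" if "z \<in> carrier G" for z
      using mult_cl[of y z] cl_carrier[OF that] by simp
    have "list_prod G ((y # ys) @ [c]) = cl y \<otimes> (list_prod G ys \<otimes> cl c)"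
      using e[OF P(1)] IH by simp
    then show ?case
      using IH P(2) e[of "list_prod G ys"] by (simp add: m_assoc)
  qed
  then show "list_prod G ys \<in> carrier G" "cl c \<in> carrier G"
    "list_prod G (ys @ [c]) = list_prod G ys \<otimes> cl c"
    by blast+
qed

text \<open>The head is a value of \<open>tau\<close>, hence a power of \<open>x\<close> and in the
  carrier. It can therefore be cancelled although nothing is known about the other factors.\<close>

lemma alt_form_tail:
  assumes "alt_form x y (c # as)" "x \<in> {s, t}" "list_prod G (rev (c # as)) = a" "a \<in> M"
  shows "c = tau G M (Mon x) a" "list_prod G (rev as) = a \<otimes> inv c" "a \<otimes> inv c \<in> M"
proof -
  show c: "c = tau G M (Mon x) a"
    using assms(1,3) alt_form_Cons by auto
  obtain n :: nat where n: "c = x [^] n" "a \<otimes> inv c \<in> M"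
    by (rule tau_divides[OF assms(2,4)]) (simp add: c)
  then have cc: "c \<in> carrier G" using assms(2) by auto
  show "a \<otimes> inv c \<in> M" by (rule n(2))
  have "list_prod G (rev as @ [c]) \<in> carrier G" using assms(3,4) by simp
  note L = list_prod_snoc_cl[OF this]
  have "a = list_prod G (rev as) \<otimes> c"
    using L(3) assms(3) cl_carrier[OF cc] by simp
  then show "list_prod G (rev as) = a \<otimes> inv c"
    using L(1) cc by (simp add: m_assoc)
qed

text \<open>The value of \<open>tau\<close> at the unit is the unit, so the head is trivial and the
  tail again has product 1; the last factor contradicts this.\<close>

lemma alt_form_ne_one:
  "alt_form x y as \<Longrightarrow> {x, y} = {s, t} \<Longrightarrow> list_prod G (rev as) = \<one> \<Longrightarrow> False"
proof (induction as arbitrary: x y)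
  case Nil
  then show ?case using alt_form_Nil by blast
next
  case (Cons c as)
  have xy: "x \<in> {s, t}" "{y, x} = {s, t}" using Cons.prems(2) by auto
  note T = alt_form_tail[OF Cons.prems(1) xy(1) Cons.prems(3) M_one]
  have "\<one> \<otimes> inv x \<notin> M" using val_not_divisible[of y x "[]"] xy by simp
  then have "c = \<one>" using T(1) tau_Mon[OF xy(1) M_one, of 0] xy(1) by simp
  then show False
    using Cons.prems(1) Cons.IH[of y x] T(2) xy(2) unfolding alt_form_Cons by (auto split: if_splits)
qed

text \<open>The product determines the head through \<open>tau\<close>, and then the product of the
  tail. A shorter list is impossible because no form has product 1.\<close>

lemma alt_form_unique:
  "alt_form x y as \<Longrightarrow> alt_form x y bs \<Longrightarrow> {x, y} = {s, t} \<Longrightarrow>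
    list_prod G (rev as) = a \<Longrightarrow> list_prod G (rev bs) = a \<Longrightarrow> a \<in> M \<Longrightarrow> as = bs"
proof (induction as arbitrary: bs x y a)
  case Nil
  then show ?case using alt_form_Nil by blast
next
  case (Cons c as)
  have "bs \<noteq> []" using Cons.prems(2) alt_form_Nil by blast
  then obtain c' bs' where bs: "bs = c' # bs'" by (cases bs) blast+
  have xy: "x \<in> {s, t}" "{y, x} = {s, t}" using Cons.prems(3) by auto
  note T = alt_form_tail[OF Cons.prems(1) xy(1) Cons.prems(4,6)]
  note T' = alt_form_tail[OF Cons.prems(2)[unfolded bs] xy(1) Cons.prems(5)[unfolded bs] Cons.prems(6)]
  have c: "c' = c" unfolding T(1) T'(1) ..
  have T2: "list_prod G (rev bs') = a \<otimes> inv c"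
    using T'(2) unfolding c .
  have tails: "as = [] \<or> alt_form y x as" "bs' = [] \<or> alt_form y x bs'"
    using Cons.prems(1)[unfolded alt_form_Cons, THEN conjunct2]
      Cons.prems(2)[unfolded bs alt_form_Cons, THEN conjunct2] by (simp_all split: if_splits)
  have one: "as = bs'" if "as = [] \<or> bs' = []"
  proof -
    have "a \<otimes> inv c = \<one>"
    proof (cases "as = []")
      case True
      then show ?thesis using T(2) by simp
    next
      case False
      then have "bs' = []" using that by blast
      then show ?thesis using T2 by simp
    qed
    then have "list_prod G (rev as) = \<one>" "list_prod G (rev bs') = \<one>"
      using T(2) T2 by simp_all
    then have "as = []" "bs' = []"
      using tails alt_form_ne_one[OF _ xy(2)] by blast+
    then show ?thesis by simp
  qed
  have "as = bs'"
  proof (cases "as = [] \<or> bs' = []")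
    case False
    then have "alt_form y x as" "alt_form y x bs'"
      using tails by blast+
    then show ?thesis
      by (rule Cons.IH[OF _ _ xy(2) T(2) T2 T(3)])
  qed (rule one)
  then show ?case unfolding bs c by simp
qed

fun powers :: "'a \<Rightarrow> 'a \<Rightarrow> nat list \<Rightarrow> 'a list" where
  "powers x y [] = []"
| "powers x y (n # ns) = x [^] n # powers y x ns"

lemma length_powers [simp]: "length (powers x y ns) = length ns"
  by (induction ns arbitrary: x y) auto

lemma powers_carrier: "{x, y} = {s, t} \<Longrightarrow> set (powers x y ns) \<subseteq> carrier G"
proof (induction ns arbitrary: x y)
  case (Cons n ns)
  have "{y, x} = {s, t}" "x \<in> carrier G" using Cons.prems by (auto simp: doubleton_eq_iff)
  then show ?case using Cons.IH by simp
qed simp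

lemma list_prod_rev_powers: "{x, y} = {s, t} \<Longrightarrow> list_prod G (rev (powers x y ns)) = val x y ns"
proof (induction ns arbitrary: x y)
  case (Cons n ns)
  have yx: "{y, x} = {s, t}" "x \<in> carrier G" using Cons.prems by (auto simp: doubleton_eq_iff)
  then show ?case
    using Cons.IH[OF yx(1)] list_prod_append[of "rev (powers y x ns)" "[x [^] n]"] powers_carrier[OF yx(1)]
    by simp
qed simp

lemma alt_form_powers:
  "{x, y} = {s, t} \<Longrightarrow> greedy y x ns \<Longrightarrow> ns \<noteq> [] \<or> n \<ge> 1 \<Longrightarrow> alt_form x y (powers x y (n # ns))"
proof (induction ns arbitrary: x y n)
  case Nil
  have x1: "x \<in> {s, t}" using Nil by auto
  then have x: "x \<in> {s, t}" "x \<in> carrier G" "deg x = 1" by auto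
  have "\<one> \<otimes> inv x \<notin> M" using val_not_divisible[of y x "[]"] x1 by simp
  then have "tau G M (Mon x) (\<one> \<otimes> x [^] n) = x [^] n"
    by (rule tau_Mon[OF x(1) M_one])
  moreover have "x [^] n \<noteq> \<one>"
  proof
    assume "x [^] n = \<one>"
    then have "deg (x [^] n) = 0" by simp
    then show False using x Nil by (simp add: deg_nat_pow)
  qed
  ultimately show ?case
    using x unfolding powers.simps alt_form_Cons by simp
next
  case (Cons m ns)
  have yx: "{y, x} = {s, t}" "x \<in> {s, t}" using Cons.prems by auto
  have "val y x (m # ns) \<otimes> inv x \<notin> M"
    by (rule val_not_divisible[OF Cons.prems(2) yx(2)])
  then have "tau G M (Mon x) (val y x (m # ns) \<otimes> x [^] n) = x [^] n"
    using tau_Mon[OF yx(2) val_M[OF yx(1)]] by blast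
  moreover have "list_prod G (rev (powers x y (n # m # ns))) = val y x (m # ns) \<otimes> x [^] n"
    by (simp only: list_prod_rev_powers[OF Cons.prems(1)] val.simps)
  moreover have "alt_form y x (powers y x (m # ns))"
    using Cons.IH[OF yx(1), of m] Cons.prems(2) by simp
  ultimately show ?case
    unfolding powers.simps(2)[of x y n] alt_form_Cons by simp
qed

text \<open>The possibly trivial power of \<open>t\<close> is always counted, so the breadth is
  \<open>length ns + 1\<close>, and both branches of \<open>dpt\<close> are its half rounded down:
  the number of blocks of \<open>s\<close>. The unit, with breadth 1 by convention, fits in as
  \<open>ns = []\<close>.\<close>

lemma dpt_greedy:
  assumes "greedy s t ns"
  shows "dpt G M (Mon t) (Mon s) (val s t ns \<otimes> t [^] (n::nat)) = (length ns + 1) div 2"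
proof -
  let ?a = "val s t ns \<otimes> t [^] n"
  have half: "(if odd p then (p - 1) div 2 else p div 2) = p div 2" for p :: nat
    by (auto elim: oddE)
  have a: "?a \<in> M" using val_M[of s t] by simp
  show ?thesis
  proof (cases "ns = [] \<and> n = 0")
    case True
    then show ?thesis by (simp add: dpt_def bh_def)
  next
    case False
    have ts: "{t, s} = {s, t}" by auto
    have af: "alt_form t s (powers t s (n # ns))"
      using alt_form_powers[OF ts assms, of n] False by auto
    have prod: "list_prod G (rev (powers t s (n # ns))) = ?a"
      using list_prod_rev_powers[OF ts, of "n # ns"] by simp
    have ne: "?a \<noteq> \<one>"
      using alt_form_ne_one[OF af ts] unfolding prod by blast
    have iff: "is_alternating_form G M (Mon t) (Mon s) ?a as \<longleftrightarrow> alt_form t s as \<and> list_prod G (rev as) = ?a"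
      for as
      unfolding is_alternating_form_def alt_form_def eq_commute[of ?a] by blast
    have "(THE as. is_alternating_form G M (Mon t) (Mon s) ?a as) = powers t s (n # ns)"
      unfolding iff
    proof (rule the_equality)
      show "as = powers t s (n # ns)" if "alt_form t s as \<and> list_prod G (rev as) = ?a" for as
        by (rule alt_form_unique[OF conjunct1[OF that] af ts conjunct2[OF that] prod a])
    qed (rule conjI[OF af prod])
    then show ?thesis
      using ne unfolding dpt_def bh_def Let_def half by simp
  qed
qed

section \<open>The depth of greedy words\<close>

fun alt :: "'a \<Rightarrow> 'a \<Rightarrow> nat \<Rightarrow> 'a" where
  "alt x y 0 = \<one>"
| "alt x y (Suc n) = alt y x n \<otimes> x"

lemma alt_M: "{x, y} = {s, t} \<Longrightarrow> alt x y n \<in> M"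
proof (induction n arbitrary: x y)
  case (Suc n)
  have "{y, x} = {s, t}" "x \<in> {s, t}" using Suc.prems by auto
  then show ?case using Suc.IH M_gens by simp
qed simp

lemma alt_even: "x \<in> carrier G \<Longrightarrow> y \<in> carrier G \<Longrightarrow> alt x y (2 * j) = (y \<otimes> x) [^] j"
  by (induction j) (simp_all add: m_assoc)

lemma alt_m: "{x, y} = {s, t} \<Longrightarrow> alt x y (Suc (2 * k)) = \<Omega>"
  using alt_even[of s t k] alt_even[of t s k] \<Omega>_eq by (auto simp: doubleton_eq_iff)

text \<open>The block moves in front of Omega and changes its letter, and Omega can be written so as
  to end in either letter. So a greedy word cannot contain Omega at such a place.\<close>

lemma \<Omega>_block_divisible:
  assumes "{x, y} = {s, t}" "f \<in> M"
  shows "f \<otimes> \<Omega> \<otimes> x [^] (b::nat) \<otimes> inv y \<in> M"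
proof -
  have xy: "y \<in> M" "x \<in> carrier G" "y \<in> carrier G" "{y, x} = {s, t}"
    using assms(1) M_gens by (auto simp: doubleton_eq_iff)
  have "y \<otimes> \<Omega> = \<Omega> \<otimes> x"
    using assms(1) \<Omega>_s \<Omega>_t by (auto simp: doubleton_eq_iff)
  then have "y [^] (int b) \<otimes> \<Omega> = \<Omega> \<otimes> x [^] (int b)"
    by (rule int_pow_intertwine) (use xy in simp_all)
  then have "f \<otimes> \<Omega> \<otimes> x [^] b = f \<otimes> y [^] b \<otimes> \<Omega>"
    using xy assms(2) by (simp add: int_pow_int m_assoc)
  also have "\<dots> = f \<otimes> y [^] b \<otimes> alt x y (2 * k) \<otimes> y"
    using alt_m[OF xy(4)] xy assms alt_M[OF assms(1)] by (simp add: m_assoc)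
  finally have "f \<otimes> \<Omega> \<otimes> x [^] b \<otimes> inv y = f \<otimes> y [^] b \<otimes> alt x y (2 * k)"
    using xy assms(2) alt_M[OF assms(1)] by (simp add: m_assoc)
  then show ?thesis
    using xy(1) assms(2) alt_M[OF assms(1)] by simp
qed

text \<open>\<open>R\<close> is the length of an alternating tail of the word. Exponent 1 prolongs
  the tail and a larger exponent restarts it at length 1; a tail of length \<open>2 * k + 1\<close>
  would be Omega.\<close>

lemma alt_advance:
  assumes "{x, y} = {s, t}" "f \<in> M" "P = f \<otimes> alt y x R" "R \<le> 2 * k"
    "P \<otimes> x [^] Suc b \<otimes> inv y \<notin> M"
  shows "Suc R \<le> 2 * k"
    "\<exists>f'\<in>M. P \<otimes> x [^] Suc b = f' \<otimes> alt x y (if b = 0 then Suc R else 1)"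
proof -
  have yx: "{y, x} = {s, t}" "x \<in> M" "x \<in> carrier G"
    using assms(1) M_gens by (auto simp: doubleton_eq_iff)
  have cl: "alt y x R \<in> M" "P \<in> M"
    using alt_M[OF yx(1)] assms(2,3) by simp_all
  have pow: "P \<otimes> x [^] Suc b = P \<otimes> x \<otimes> x [^] b"
    using nat_pow_Suc2[OF yx(3), of b] cl yx by (simp add: m_assoc del: nat_pow_Suc)
  show "Suc R \<le> 2 * k"
  proof (rule ccontr)
    assume "\<not> Suc R \<le> 2 * k"
    then have R: "R = 2 * k" using assms(4) by simp
    have "P \<otimes> x = f \<otimes> alt x y (Suc R)"
      using assms(2,3) cl yx by (simp add: m_assoc)
    also have "\<dots> = f \<otimes> \<Omega>"
      unfolding R alt_m[OF assms(1)] ..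
    finally show False
      using assms(5) \<Omega>_block_divisible[OF assms(1,2), of b] unfolding pow by simp
  qed
  show "\<exists>f'\<in>M. P \<otimes> x [^] Suc b = f' \<otimes> alt x y (if b = 0 then Suc R else 1)"
  proof (cases "b = 0")
    case True
    then show ?thesis
      using assms(2,3) cl yx by (intro bexI[of _ f]) (simp_all add: m_assoc)
  next
    case False
    then show ?thesis
      using cl yx by (intro bexI[of _ "P \<otimes> x [^] b"]) (simp_all add: m_assoc)
  qed
qed

text \<open>\<open>N\<close> is the number of all \<open>v\<close> and \<open>E\<close> that of a
  guaranteed run at the right end, the only place where \<open>u\<close> can cancel. The run need
  not be maximal.\<close>

definition trailing :: "nat \<Rightarrow> 'a \<Rightarrow> nat \<Rightarrow> int \<Rightarrow> bool" where
  "trailing E A N q \<longleftrightarrow> (\<exists>n g. W n g \<and> A = g \<otimes> v [^] E \<otimes> D q \<and> n + E = N)"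

lemma trailing_D:
  assumes "trailing E A N q"
  shows "trailing E (A \<otimes> D p) N (q + p)"
proof -
  obtain n g where *: "W n g" "A = g \<otimes> v [^] E \<otimes> D q" "n + E = N"
    using assms unfolding trailing_def by blast
  have "A \<otimes> D p = g \<otimes> v [^] E \<otimes> D (q + p)"
    unfolding *(2) using *(1) by (simp add: m_assoc D_add)
  then show ?thesis using * unfolding trailing_def by blast
qed

text \<open>The factor \<open>u\<close> cancels one \<open>v\<close>, and a power of
  \<open>t\<close> needs another one to be absorbed; hence two of them must be at hand.\<close>

lemma trailing_advance:
  assumes "trailing E A N q" "E \<ge> 2"
  shows "trailing (if b = 0 then E - 1 else 2 * k) (A \<otimes> u \<otimes> t [^] (b::nat))
    (N - 1 + (2 * k - 1) * b) (q + int k * int b)"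
proof -
  obtain n g where *: "W n g" "A = g \<otimes> v [^] E \<otimes> D q" "n + E = N"
    using assms(1) unfolding trailing_def by blast
  obtain E' where E: "E = Suc E'" "E' \<ge> 1" using assms(2) by (cases E) auto
  have cl: "g \<in> carrier G" using *(1) by simp
  have "A \<otimes> u = g \<otimes> v [^] E' \<otimes> D q"
    unfolding *(2) E(1) using cl by (simp add: m_assoc D_central[of u]) (simp add: m_assoc[symmetric])
  then have Au: "A \<otimes> u \<otimes> t [^] b = g \<otimes> v [^] E' \<otimes> t [^] b \<otimes> D q"
    using cl by (simp add: m_assoc D_central[of "t [^] b"])
  show ?thesis
  proof (cases b)
    case 0
    then show ?thesis
      using Au * E cl unfolding trailing_def by (intro exI[of _ n] exI[of _ g]) simp
  next
    case (Suc c)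
    obtain n' g' where g': "W n' g'"
      "g \<otimes> v [^] E' \<otimes> t [^] Suc c = g' \<otimes> v [^] (2 * k) \<otimes> D (int k * int (Suc c))"
      "n' + 2 * k = n + E' + (2 * k - 1) * Suc c"
      using W_absorb[OF *(1) E(2), of c] by blast
    have "A \<otimes> u \<otimes> t [^] b = g' \<otimes> v [^] (2 * k) \<otimes> D (int k * int b + q)"
      unfolding Au unfolding Suc g'(2) using g'(1) by (simp add: m_assoc D_add)
    moreover have "n' + 2 * k = N - 1 + (2 * k - 1) * b"
      using g'(3) *(3) E Suc by simp
    ultimately show ?thesis
      using g'(1) Suc unfolding trailing_def by (auto simp: add.commute)
  qed
qed

text \<open>The initial store of \<open>v\<close> comes from writing the unit as v^(2k+1)
  Delta^(k+1).\<close>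

lemma trailing_one: "trailing (2 * k + 1) \<one> (2 * k + 1) (int k + 1)"
proof -
  have "v [^] (2 * k + 1) \<otimes> D (int k + 1) = \<one>"
    unfolding nat_pow_inv[OF u_closed] u_pow_m by simp
  then show ?thesis
    unfolding trailing_def using W.zero[of 0] by (intro exI[of _ 0] exI[of _ \<one>]) simp
qed

text \<open>Adjoin a central \<open>z\<close> with \<open>z\<^bsup>2k-1\<^esup> = \<Delta>\<close> and put \<open>w = v z\<^sup>k\<close>, so that
  \<open>w\<^bsup>2k+1\<^esup> = z\<close>; the equations for \<open>q\<close> compare the exponents of \<open>z\<close>.  A word ending in \<open>R\<close>
  alternating letters leaves a trailing power of \<open>v\<close> with exponent \<open>E \<ge> 2k + 1 - R\<close>, which is
  not used up before the alternating letters form \<open>\<Omega>\<close>.\<close>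

lemma greedy_invariant:
  "(greedy s t ns \<and> ns \<noteq> [] \<longrightarrow> (\<exists>R f E N q. f \<in> M \<and> R \<le> 2 * k \<and> val s t ns = f \<otimes> alt s t R \<and>
      2 * k + 1 \<le> E + R \<and> trailing E (val s t ns \<otimes> t \<otimes> v) N q \<and>
      (2 * int k - 1) * q = int k * int N - int k + int ((length ns + 1) div 2) - 1)) \<and>
   (greedy t s ns \<longrightarrow> (\<exists>R f E N q. f \<in> M \<and> R \<le> 2 * k \<and> val t s ns = f \<otimes> alt t s R \<and>
      2 * k + 1 \<le> E + R \<and> trailing E (val t s ns) N q \<and>
      (2 * int k - 1) * q = int k * int N + int (length ns div 2) - 1))"
proof (induction ns)
  case Nil
  have "(2 * int k - 1) * (int k + 1) = int k * int (2 * k + 1) + int (length ([]::nat list) div 2) - 1"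
    by (simp add: algebra_simps)
  then have "\<exists>R f E N q. f \<in> M \<and> R \<le> 2 * k \<and> val t s [] = f \<otimes> alt t s R \<and>
      2 * k + 1 \<le> E + R \<and> trailing E (val t s []) N q \<and>
      (2 * int k - 1) * q = int k * int N + int (length ([]::nat list) div 2) - 1"
    using trailing_one
    by (intro exI[of _ 0] exI[of _ \<one>] exI[of _ "2 * k + 1"] exI[of _ "int k + 1"]) simp
  then show ?case by simp
next
  case (Cons m ns)
  have st: "{s, t} = {s, t}" "{t, s} = {s, t}" by auto
  show ?case
  proof (intro conjI impI)
    assume "greedy s t (m # ns) \<and> m # ns \<noteq> []"
    then have gr: "m \<ge> 1" "greedy t s ns" "val t s ns \<otimes> s [^] m \<otimes> inv t \<notin> M" by auto
    obtain b where b: "m = Suc b" using gr(1) by (cases m) auto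
    obtain R f E N q where IH: "f \<in> M" "R \<le> 2 * k" "val t s ns = f \<otimes> alt t s R"
      "2 * k + 1 \<le> E + R" "trailing E (val t s ns) N q"
      "(2 * int k - 1) * q = int k * int N + int (length ns div 2) - 1"
      using Cons.IH gr(2) by blast
    let ?P = "val t s ns"
    have P: "?P \<in> carrier G" using val_M[OF st(2)] by simp
    note adv = alt_advance[OF st(1) IH(1,3,2) gr(3)[unfolded b]]
    obtain f' where f': "f' \<in> M" "?P \<otimes> s [^] Suc b = f' \<otimes> alt s t (if b = 0 then Suc R else 1)"
      using adv(2) by blast
    have E: "E \<ge> 2" using adv(1) IH(4) by linarith
    have N: "N \<ge> 2" using IH(5) E unfolding trailing_def by auto
    \<comment> \<open>Appending \<open>t \<otimes> v\<close> after a block of \<open>s\<close> makes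
      both kinds of blocks act alike, by \<open>u \<otimes> t [^] b\<close>: here s^(b+1) t v = u
      t^b Delta^-1, and for the following block of \<open>t\<close> one has t^(b+1) = (t v) (u
      t^b).\<close>
    have "s [^] Suc b \<otimes> t \<otimes> v = u \<otimes> t [^] b \<otimes> D (- 1)"
    proof -
      have "s [^] Suc b = u \<otimes> t [^] Suc b \<otimes> v"
        using s_pow_u[of "int (Suc b)"] inv_solve_right[of "s [^] Suc b" "u \<otimes> t [^] Suc b" u]
        by (simp add: int_pow_int del: nat_pow_Suc of_nat_Suc)
      then have "s [^] Suc b \<otimes> t \<otimes> v = u \<otimes> t [^] Suc b \<otimes> (v \<otimes> t \<otimes> v)"
        by (simp add: m_assoc del: nat_pow_Suc)
      then show ?thesis
        unfolding v_t_v by (simp add: m_assoc) (simp add: m_assoc[symmetric])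
    qed
    then have "?P \<otimes> s [^] Suc b \<otimes> t \<otimes> v = (?P \<otimes> u \<otimes> t [^] b) \<otimes> D (- 1)"
      using P by (simp add: m_assoc del: nat_pow_Suc)
    then have tr: "trailing (if b = 0 then E - 1 else 2 * k) (?P \<otimes> s [^] Suc b \<otimes> t \<otimes> v)
        (N - 1 + (2 * k - 1) * b) (q + int k * int b + (- 1))"
      using trailing_D[OF trailing_advance[OF IH(5) E, of b], of "- 1"] by simp
    have len: "(length (m # ns) + 1) div 2 = Suc (length ns div 2)" by simp
    have kk: "int (2 * k - 1) = 2 * int k - 1" using k_pos by simp
    have NN: "int (N - 1 + (2 * k - 1) * b) = int N - 1 + (2 * int k - 1) * int b"
      using N kk by simp
    have q: "(2 * int k - 1) * (q + int k * int b + (- 1))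
        = int k * int (N - 1 + (2 * k - 1) * b) - int k + int ((length (m # ns) + 1) div 2) - 1"
      unfolding len NN using IH(6) by (simp add: algebra_simps)
    have "(if b = 0 then Suc R else 1) \<le> 2 * k"
      "2 * k + 1 \<le> (if b = 0 then E - 1 else 2 * k) + (if b = 0 then Suc R else 1)"
      using adv(1) IH(4) E k_pos by auto
    then show "\<exists>R f E N q. f \<in> M \<and> R \<le> 2 * k \<and> val s t (m # ns) = f \<otimes> alt s t R \<and>
      2 * k + 1 \<le> E + R \<and> trailing E (val s t (m # ns) \<otimes> t \<otimes> v) N q \<and>
      (2 * int k - 1) * q = int k * int N - int k + int ((length (m # ns) + 1) div 2) - 1"
      using f' tr q unfolding b val.simps(2) by blast
  next
    assume "greedy t s (m # ns)"
    then have gr: "m \<ge> 1" "greedy s t ns" "val s t ns \<otimes> t [^] m \<otimes> inv s \<notin> M" by auto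
    obtain b where b: "m = Suc b" using gr(1) by (cases m) auto
    let ?P = "val s t ns"
    have P: "?P \<in> carrier G" using val_M[OF st(1)] by simp
    show "\<exists>R f E N q. f \<in> M \<and> R \<le> 2 * k \<and> val t s (m # ns) = f \<otimes> alt t s R \<and>
      2 * k + 1 \<le> E + R \<and> trailing E (val t s (m # ns)) N q \<and>
      (2 * int k - 1) * q = int k * int N + int (length (m # ns) div 2) - 1"
    \<comment> \<open>The first half of the claim omits the empty word, since
      \<open>t \<otimes> v\<close> offers a run of only one \<open>v\<close>. A leading block of
      \<open>t\<close> instead starts afresh from t^m v^(2k+1) Delta^(k+1).\<close>
    proof (cases "ns = []")
      case True
      have "\<exists>f'\<in>M. \<one> \<otimes> t [^] Suc b = f' \<otimes> alt t s (if b = 0 then Suc 0 else 1)"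
        using alt_advance(2)[OF st(2) M_one, of \<one> 0 b] gr(3) True b by simp
      then obtain f' where f': "f' \<in> M" "\<one> \<otimes> t [^] Suc b = f' \<otimes> alt t s 1"
        unfolding One_nat_def if_cancel by blast
      have val: "val t s (m # ns) = f' \<otimes> alt t s 1"
        unfolding True b val.simps by (rule f'(2))
      have "trailing (2 * k + 1) (t [^] m) (2 * k + 1) (int k + 1)"
      proof -
        have "v [^] (2 * k + 1) \<otimes> D (int k + 1) = \<one>"
          unfolding nat_pow_inv[OF u_closed] u_pow_m by simp
        then show ?thesis
          unfolding trailing_def using W.zero[of "int m"]
          by (intro exI[of _ 0] exI[of _ "t [^] m"]) (simp add: m_assoc int_pow_int)
      qed
      moreover have "(2 * int k - 1) * (int k + 1) = int k * int (2 * k + 1) + int (length (m # ns) div 2) - 1"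
        using True by (simp add: algebra_simps)
      moreover have "val t s (m # ns) = t [^] m" "1 \<le> 2 * k" "2 * k + 1 \<le> 2 * k + 1 + 1"
        using True k_pos by simp_all
      ultimately show ?thesis
        using f'(1) val by metis
    next
      case False
      obtain R f E N q where IH: "f \<in> M" "R \<le> 2 * k" "val s t ns = f \<otimes> alt s t R"
        "2 * k + 1 \<le> E + R" "trailing E (val s t ns \<otimes> t \<otimes> v) N q"
        "(2 * int k - 1) * q = int k * int N - int k + int ((length ns + 1) div 2) - 1"
        using Cons.IH gr(2) False by blast
      note adv = alt_advance[OF st(2) IH(1,3,2) gr(3)[unfolded b]]
      obtain f' where f': "f' \<in> M" "?P \<otimes> t [^] Suc b = f' \<otimes> alt t s (if b = 0 then Suc R else 1)"
        using adv(2) by blast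
      have E: "E \<ge> 2" using adv(1) IH(4) by linarith
      have N: "N \<ge> 2" using IH(5) E unfolding trailing_def by auto
      have "?P \<otimes> t [^] Suc b = ?P \<otimes> t \<otimes> v \<otimes> u \<otimes> t [^] b"
        using P nat_pow_Suc2[OF t_closed, of b] by (simp add: m_assoc del: nat_pow_Suc)
      then have tr: "trailing (if b = 0 then E - 1 else 2 * k) (?P \<otimes> t [^] Suc b)
          (N - 1 + (2 * k - 1) * b) (q + int k * int b)"
        using trailing_advance[OF IH(5) E, of b] by simp
      have len: "length (m # ns) div 2 = (length ns + 1) div 2" by simp
      have kk: "int (2 * k - 1) = 2 * int k - 1" using k_pos by simp
      have NN: "int (N - 1 + (2 * k - 1) * b) = int N - 1 + (2 * int k - 1) * int b"
        using N kk by simp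
      have q: "(2 * int k - 1) * (q + int k * int b)
          = int k * int (N - 1 + (2 * k - 1) * b) + int (length (m # ns) div 2) - 1"
        unfolding len NN using IH(6) by (simp add: algebra_simps)
      have "(if b = 0 then Suc R else 1) \<le> 2 * k"
        "2 * k + 1 \<le> (if b = 0 then E - 1 else 2 * k) + (if b = 0 then Suc R else 1)"
        using adv(1) IH(4) E k_pos by auto
      then show ?thesis
        using f' tr q unfolding b val.simps(2) by blast
    qed
  qed
qed

text \<open>As \<open>R\<close> is at most \<open>2 * k\<close>, the run is not exhausted and can
  pay for the auxiliary \<open>v\<close>. The equation for \<open>q\<close> says that the element is
  a word in w and t^{+-1} times z^(d-1), for d blocks of s.\<close>

lemma greedy_W:
  assumes "greedy s t ns" "ns \<noteq> []"
  shows "\<exists>n g q. W n g \<and> val s t ns \<otimes> t = g \<otimes> D q \<and>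
    (2 * int k - 1) * q = int k * int n + int ((length ns + 1) div 2) - 1"
proof -
  obtain R E N q where I: "R \<le> 2 * k" "2 * k + 1 \<le> E + R" "trailing E (val s t ns \<otimes> t \<otimes> v) N q"
    "(2 * int k - 1) * q = int k * int N - int k + int ((length ns + 1) div 2) - 1"
    using greedy_invariant[of ns] assms by blast
  obtain n g where g: "W n g" "val s t ns \<otimes> t \<otimes> v = g \<otimes> v [^] E \<otimes> D q" "n + E = N"
    using I(3) unfolding trailing_def by blast
  obtain E' where E: "E = Suc E'" using I(1,2) by (cases E) auto
  have P: "val s t ns \<in> carrier G" using val_M[of s t] by simp
  have "val s t ns \<otimes> t = (val s t ns \<otimes> t \<otimes> v) \<otimes> u"
    using P by (simp add: m_assoc)
  also have "\<dots> = g \<otimes> v [^] E' \<otimes> D q"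
    unfolding g(2) E using W_closed[OF g(1)]
    by (simp add: m_assoc D_central[of u]) (simp add: m_assoc[symmetric])
  finally show ?thesis
    using W_v_pow[OF g(1), of E'] I(4) g(3) E
    by (intro exI[of _ "n + E'"] exI[of _ "g \<otimes> v [^] E'"] exI[of _ q]) (auto simp: algebra_simps)
qed

lemma val_SB:
  "SB ((length ns + 1) div 2) (val s t ns) \<and> SB (length ns div 2) (val t s ns)"
proof (induction ns)
  case Nil
  then show ?case using SB.zero[of 0] by simp
next
  case (Cons n ns)
  then show ?case
    using SB_s[of "length ns div 2" "val t s ns" "int n"] SB_t[of "(length ns + 1) div 2" "val s t ns" "int n"]
    by (simp add: int_pow_int)
qed

section \<open>Existence of Delta-forms\<close>

lemma \<Omega>_M: "\<Omega> \<in> M" "\<Omega> \<otimes> inv s \<in> M" "\<Omega> \<otimes> inv t \<in> M"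
proof -
  show "\<Omega> \<in> M" "\<Omega> \<otimes> inv s \<in> M" unfolding \<Omega>_eq(1) by (simp_all add: m_assoc)
  show "\<Omega> \<otimes> inv t \<in> M" unfolding \<Omega>_eq(2) by (simp add: m_assoc)
qed

lemma \<Delta>_M [simp]: "\<Delta> \<in> M"
  by (simp add: \<Delta>_def \<Omega>_M)

lemma D_M: "0 \<le> j \<Longrightarrow> D j \<in> M"
  using M_pow[OF \<Delta>_M, of "nat j"] int_pow_int[of G \<Delta> "nat j"] by simp

lemma deg_\<Delta>: "deg \<Delta> \<ge> 1"
proof -
  have "deg \<Omega> = 2 * int k + 1"
    by (simp add: \<Omega>_eq(1) deg_mult deg_nat_pow)
  then show ?thesis by (simp add: \<Delta>_eq deg_mult)
qed

lemma fraction_exists: "\<alpha> \<in> carrier G \<Longrightarrow> \<exists>a\<in>M. \<exists>j. \<alpha> = a \<otimes> D j"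
  unfolding generated
proof (induction rule: generate.induct)
  case one
  show ?case by (intro bexI[of _ \<one>] exI[of _ 0]) simp_all
next
  case (incl h)
  then have "h \<in> M" by (rule M_gens)
  then show ?case by (intro bexI[of _ h] exI[of _ 0]) simp_all
next
  case (inv h)
  then have "h \<in> carrier G" "\<Omega> \<otimes> inv h \<in> M" using \<Omega>_M by auto
  then have "\<Delta> \<otimes> inv h \<in> M" "inv h = (\<Delta> \<otimes> inv h) \<otimes> D (- 1)"
    using M_mult[of \<Omega> "\<Omega> \<otimes> inv h"] \<Omega>_M(1) D_central[of "inv h" 1]
    by (simp_all add: \<Delta>_eq[symmetric] m_assoc[symmetric] \<Delta>_central) (simp_all add: \<Delta>_eq m_assoc int_pow_neg)
  then show ?case by blast
next
  case (eng h1 h2)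
  then obtain a i b j where "a \<in> M" "h1 = a \<otimes> D i" "b \<in> M" "h2 = b \<otimes> D j" by blast
  then show ?case
    using mult_D_mult[of a b i j] by (intro bexI[of _ "a \<otimes> b"] exI[of _ "i + j"]) simp_all
qed

text \<open>A numerator of least degree is unmovable, because splitting off Delta would lower its
  degree.\<close>

lemma Delta_form_exists:
  assumes "\<alpha> \<in> carrier G"
  shows "\<exists>a j. is_Delta_form G M \<Delta> \<alpha> a (- j)"
proof -
  let ?Q = "\<lambda>p. fst p \<in> M \<and> \<alpha> = fst p \<otimes> D (snd p)"
  have "\<exists>p. ?Q p" using fraction_exists[OF assms] by auto
  then obtain p where p: "?Q p" "\<And>p'. ?Q p' \<Longrightarrow> nat (deg (fst p)) \<le> nat (deg (fst p'))"
    using ex_has_least_nat[of ?Q _ "\<lambda>p. nat (deg (fst p))"] by blast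
  obtain a j where aj: "p = (a, j)" by (cases p)
  then have a: "a \<in> M" "\<alpha> = a \<otimes> D j" using p(1) by auto
  have "a \<otimes> inv \<Delta> \<notin> M"
  proof
    assume *: "a \<otimes> inv \<Delta> \<in> M"
    have "\<alpha> = (a \<otimes> inv \<Delta>) \<otimes> (\<Delta> \<otimes> D j)"
      unfolding a(2) using a(1) by (simp add: m_assoc) (simp add: m_assoc[symmetric])
    also have "\<Delta> \<otimes> D j = D (1 + j)"
      using D_add[of 1 j] by simp
    finally have "nat (deg a) \<le> nat (deg (a \<otimes> inv \<Delta>))"
      using p(2)[of "(a \<otimes> inv \<Delta>, 1 + j)"] * aj by simp
    moreover have "deg (a \<otimes> inv \<Delta>) = deg a - deg \<Delta>"
      using a(1) by (simp add: deg_mult)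
    moreover have "0 \<le> deg (a \<otimes> inv \<Delta>)"
      using deg_M[OF *] by blast
    ultimately show False
      using deg_\<Delta> by linarith
  qed
  then have "is_Delta_form G M \<Delta> \<alpha> a (- (- j))"
    using a unfolding is_Delta_form_def unmovable_def le_R_def by simp
  then show ?thesis by blast
qed

end

section \<open>Negativity and depth\<close>

text \<open>Properties of the preimage of the r_1-negative braids. For the greedy elements that
  occur, \<open>greedy_not_neg\<close> derives from them by counting blocks that the inverse is
  negative or the element is a power of \<open>t\<close>.\<close>

locale dihedral_artin_cone = dihedral_artin +
  fixes neg :: "'a set"
  assumes neg_carrier: "x \<in> neg \<Longrightarrow> x \<in> carrier G"
    and neg_mult: "x \<in> neg \<Longrightarrow> y \<in> neg \<Longrightarrow> x \<otimes> y \<in> neg"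
    and neg_t_left: "x \<in> neg \<Longrightarrow> t [^] (a::int) \<otimes> x \<in> neg"
    and neg_t_right: "x \<in> neg \<Longrightarrow> x \<otimes> t [^] (a::int) \<in> neg"
    and neg_not_t: "t [^] (a::int) \<notin> neg"
    and neg_inv_s: "inv s \<in> neg"
    and neg_blocks: "length ps = 2 * k - 1 \<Longrightarrow>
      list_prod G (map (\<lambda>(x::int, y::int). s [^] x \<otimes> t [^] y) ps) \<otimes> inv \<Delta> \<in> neg"
begin

lemma neg_not_inv: "x \<in> neg \<Longrightarrow> inv x \<notin> neg"
  using neg_mult[of x "inv x"] neg_not_t[of 0] neg_carrier[of x] by auto

text \<open>It follows that positive elements are never negative, which excludes
  \<open>j \<le> 0\<close> in the Delta-form of a negative element.\<close>

lemma M_inv_neg: "a \<in> M \<Longrightarrow> inv a \<in> neg \<or> (\<exists>b::int. a = t [^] b)"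
proof (induction rule: M_induct)
  case one
  then show ?case by (intro disjI2 exI[of _ 0]) simp
next
  case (snoc a x)
  show ?case
  proof (cases "x = s")
    case True
    have "inv s \<otimes> inv a \<in> neg"
    proof (cases "inv a \<in> neg")
      case True
      then show ?thesis using neg_mult neg_inv_s by blast
    next
      case False
      then obtain b :: int where "a = t [^] b" using snoc.IH by blast
      then show ?thesis
        using neg_t_right[OF neg_inv_s, of "- b"] by (simp add: int_pow_neg)
    qed
    then show ?thesis using True snoc.hyps by (simp add: inv_mult_group)
  next
    case False
    then have x: "x = t" using snoc.hyps by simp
    show ?thesis
    proof (cases "inv a \<in> neg")
      case True
      then have "inv (a \<otimes> t) \<in> neg"
        using neg_t_left[OF True, of "- 1"] snoc.hyps by (simp add: inv_mult_group int_pow_neg)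
      then show ?thesis unfolding x by blast
    next
      case False
      then obtain b :: int where "a = t [^] b" using snoc.IH by blast
      then have "a \<otimes> t = t [^] (b + 1)" by (simp add: int_pow_mult)
      then show ?thesis unfolding x by blast
    qed
  qed
qed

lemma M_not_neg: "a \<in> M \<Longrightarrow> a \<notin> neg"
  using M_inv_neg[of a] neg_not_inv[of a] neg_not_t by blast

text \<open>Cut the word into \<open>j\<close> pieces of \<open>2 * k - 1\<close> blocks and give
  each piece its own Delta^-1, which is central.\<close>

lemma SB_neg: "SB ((2 * k - 1) * j) g \<Longrightarrow> j \<ge> 1 \<Longrightarrow> g \<otimes> D (- int j) \<in> neg"
proof (induction j arbitrary: g)
  case (Suc j)
  have base: "h \<otimes> D (- 1) \<in> neg" if h: "SB (2 * k - 1) h" for h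
  proof -
    obtain a ps where ps: "length ps = 2 * k - 1"
      "h = t [^] (a::int) \<otimes> list_prod G (map (\<lambda>(x::int, y::int). s [^] x \<otimes> t [^] y) ps)"
      using SB_list[OF h] by blast
    have "list_prod G (map (\<lambda>(x::int, y::int). s [^] x \<otimes> t [^] y) ps) \<in> carrier G"
      by (intro list_prod_closed) auto
    then show ?thesis
      using neg_t_left[OF neg_blocks[OF ps(1)], of a] unfolding ps(2) by (simp add: m_assoc int_pow_neg)
  qed
  show ?case
  proof (cases "j = 0")
    case True
    then show ?thesis using base Suc.prems by simp
  next
    case False
    have "(2 * k - 1) * Suc j = (2 * k - 1) * j + (2 * k - 1)" by simp
    then obtain g1 g2 where g: "SB ((2 * k - 1) * j) g1" "SB (2 * k - 1) g2" "g = g1 \<otimes> g2"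
      using SB_split[of "(2 * k - 1) * j" "2 * k - 1" g] Suc.prems(1) by (simp only:) blast
    have "g1 \<otimes> D (- int j) \<otimes> (g2 \<otimes> D (- 1)) \<in> neg"
      using neg_mult Suc.IH[OF g(1)] False base[OF g(2)] by simp
    then show ?thesis
      using g mult_D_mult[of g1 g2 "- int j" "- 1"] by (simp add: algebra_simps)
  qed
qed simp

text \<open>Pairing the \<open>v\<close> produces \<open>(2 * k - 1) * l\<close> blocks and uses as
  many factors Delta. Of the \<open>2 * k * l\<close> factors exactly \<open>l\<close> remain, so
  the inverse falls under \<open>SB_neg\<close>.\<close>

lemma W_pos_even:
  assumes "W ((2 * k - 1) * (2 * l)) g" "l \<ge> 1"
  shows "inv (g \<otimes> D (int k * int (2 * l))) \<in> neg"
proof -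
  have e: "(2 * k - 1) * (2 * l) = 2 * ((2 * k - 1) * l)" by simp
  have SB: "SB ((2 * k - 1) * l) (g \<otimes> D (int ((2 * k - 1) * l)))"
    using W_even_SB assms(1) unfolding e by blast
  have "int ((2 * k - 1) * l) + int l = int k * int (2 * l)"
    using k_pos by (simp add: algebra_simps)
  then have "g \<otimes> D (int k * int (2 * l)) = g \<otimes> D (int ((2 * k - 1) * l)) \<otimes> D (int l)"
    using assms(1) by (simp add: m_assoc D_add)
  then have "inv (g \<otimes> D (int k * int (2 * l))) = inv (g \<otimes> D (int ((2 * k - 1) * l))) \<otimes> D (- int l)"
    using SB inv_mult_D by simp
  then show ?thesis
    using SB_neg[OF SB_inv[OF SB] assms(2)] by simp
qed

text \<open>For odd \<open>l\<close> the \<open>v\<close> cannot be paired.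
  \<open>W_lengthen\<close> adds \<open>2 * k - 1\<close> of them together with Delta^-k, which
  amounts to replacing \<open>l\<close> by \<open>Suc l\<close>.\<close>

lemma W_pos:
  assumes "W ((2 * k - 1) * l) g" "l \<ge> 1"
  shows "inv (g \<otimes> D (int k * int l)) \<in> neg"
proof (cases "even l")
  case True
  then obtain l' where "l = 2 * l'" by (elim evenE)
  then show ?thesis using W_pos_even[of l' g] assms by simp
next
  case False
  then have "even (Suc l)" by simp
  then obtain l' where l': "Suc l = 2 * l'" by (elim evenE)
  then have l'1: "l' \<ge> 1" by simp
  have pos: "(2 * k - 1) * l \<ge> 1" using k_pos assms(2) by simp
  then obtain n where n: "(2 * k - 1) * l = Suc n" by (cases "(2 * k - 1) * l") auto
  have "n + 2 * k = (2 * k - 1) * (2 * l')"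
    using n k_pos unfolding l'[symmetric] by simp
  then have "W ((2 * k - 1) * (2 * l')) (g \<otimes> D (- int k))"
    using W_lengthen[of n g] assms(1) unfolding n by simp
  from W_pos_even[OF this l'1]
  have "inv (g \<otimes> D (- int k) \<otimes> D (int k * int (Suc l))) \<in> neg"
    unfolding l' .
  moreover have "- int k + int k * int (Suc l) = int k * int l"
    by (simp add: algebra_simps)
  ultimately show ?thesis
    using assms(1) by (simp add: m_assoc D_add)
qed

lemma greedy_neg:
  assumes "(length ns + 1) div 2 \<le> (2 * k - 1) * j" "j \<ge> 1"
  shows "val s t ns \<otimes> t [^] (n::nat) \<otimes> D (- int j) \<in> neg"
proof -
  obtain e where "(2 * k - 1) * j = (length ns + 1) div 2 + e"
    using assms(1) le_Suc_ex by blast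
  then have "SB ((2 * k - 1) * j) (val s t ns \<otimes> t [^] int n)"
    using SB_t[OF SB_mono[OF conjunct1[OF val_SB]]] by simp
  then show ?thesis
    using SB_neg assms(2) by (simp add: int_pow_int)
qed

lemma greedy_not_neg:
  assumes "greedy s t ns" "(length ns + 1) div 2 = (2 * k - 1) * j + 1 + f"
  shows "inv (val s t ns \<otimes> D (- int j)) \<in> neg \<or>
    f = 0 \<and> (\<exists>b::int. val s t ns \<otimes> D (- int j) = t [^] b)"
proof -
  let ?P = "val s t ns"
  have P: "?P \<in> carrier G" using val_M[of s t] by simp
  have kk: "int (2 * k - 1) = 2 * int k - 1" using k_pos by simp
  have "ns \<noteq> []" using assms(2) by auto
  then obtain n g q where g: "W n g" "?P \<otimes> t = g \<otimes> D q"
    "(2 * int k - 1) * q = int k * int n + int ((length ns + 1) div 2) - 1"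
    using greedy_W[OF assms(1)] by blast
  \<comment> \<open>Inserting v^((2k+1) f) Delta^((k+1) f) = 1 makes the equation homogeneous,
    \<open>(2 * k - 1) * Q = k * N\<close>; in terms of z this absorbs the surplus z^f into a power
    of w.\<close>
  define N where "N = n + (2 * k + 1) * f"
  define Q where "Q = q - int j + (int k + 1) * int f"
  define h where "h = g \<otimes> v [^] ((2 * k + 1) * f)"
  have h: "W N h" "h \<in> carrier G"
    using W_v_pow[OF g(1)] W_closed unfolding N_def h_def by blast+
  have "v [^] ((2 * k + 1) * f) = D (- ((int k + 1) * int f))"
  proof -
    have "v [^] ((2 * k + 1) * f) = inv ((u [^] (2 * k + 1)) [^] f)"
      by (simp only: nat_pow_inv u_closed nat_pow_pow)
    also have "\<dots> = inv (D ((int k + 1) * int f))"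
      unfolding u_pow_m using int_pow_pow[of \<Delta> "int k + 1" "int f"] by (simp add: int_pow_int)
    finally show ?thesis by (simp add: int_pow_neg)
  qed
  then have "h \<otimes> D ((int k + 1) * int f) = g"
    using W_closed[OF g(1)] unfolding h_def by (simp add: m_assoc D_add)
  have eq: "?P \<otimes> D (- int j) \<otimes> t = h \<otimes> D Q"
  proof -
    have "?P \<otimes> D (- int j) \<otimes> t = ?P \<otimes> t \<otimes> D (- int j)"
      using P by (simp add: mult_D_right)
    also have "\<dots> = h \<otimes> D ((int k + 1) * int f) \<otimes> D (q + - int j)"
      unfolding g(2) \<open>h \<otimes> D ((int k + 1) * int f) = g\<close> using W_closed[OF g(1)]
      by (simp only: m_assoc D_add int_pow_closed \<Delta>_closed)
    also have "\<dots> = h \<otimes> D Q"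
      using h(2) unfolding Q_def by (simp add: m_assoc D_add algebra_simps)
    finally show ?thesis .
  qed
  have "(2 * int k - 1) * q = int k * int n + ((2 * int k - 1) * int j + int f)"
    using g(3) unfolding assms(2) of_nat_add of_nat_mult kk by simp
  then have Q: "(2 * int k - 1) * Q = int k * int N"
    unfolding Q_def N_def by (simp add: algebra_simps)
  \<comment> \<open>The numbers \<open>k\<close> and \<open>2 * k - 1\<close> are coprime by 2 k -
    (2 k - 1) = 1. This Bezout relation dictates the choice of \<open>l\<close> and gives
    \<open>N = (2 * k - 1) * l\<close> and \<open>Q = k * l\<close>.\<close>
  define l where "l = 2 * Q - int N"
  have "(2 * int k - 1) * l = 2 * ((2 * int k - 1) * Q) - (2 * int k - 1) * int N"
    unfolding l_def by (simp add: algebra_simps)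
  then have N: "(2 * int k - 1) * l = int N"
    unfolding Q by (simp add: algebra_simps)
  have "(2 * int k - 1) * (int k * l) = int k * ((2 * int k - 1) * l)"
    by (simp add: algebra_simps)
  then have "(2 * int k - 1) * (int k * l) = (2 * int k - 1) * Q"
    unfolding N Q .
  then have Ql: "Q = int k * l"
    using k_pos by simp
  have "0 \<le> (2 * int k - 1) * l" unfolding N by simp
  then have "l \<ge> 0" using k_pos by (simp add: zero_le_mult_iff)
  then obtain l' where l': "l = int l'" by (metis nonneg_int_cases)
  have "int ((2 * k - 1) * l') = int N" using N unfolding l' of_nat_mult kk .
  then have Nl: "N = (2 * k - 1) * l'" by linarith
  have x: "?P \<otimes> D (- int j) = h \<otimes> D (int k * int l') \<otimes> t [^] (- 1::int)"
    using eq P h(2) unfolding Ql l' by (simp add: int_pow_neg inv_solve_right)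
  show ?thesis
  \<comment> \<open>For \<open>l' = 0\<close> no \<open>v\<close> is left at all, so the element is
    a power of \<open>t\<close>, and \<open>f = 0\<close> because \<open>N\<close> includes
    \<open>(2 * k + 1) * f\<close>.\<close>
  proof (cases "l' = 0")
    case True
    then have "N = 0" using Nl by simp
    then have "f = 0" "W 0 h" using h(1) unfolding N_def by auto
    from \<open>W 0 h\<close> obtain a where "h = t [^] (a::int)" by (cases rule: W.cases) auto
    then have "?P \<otimes> D (- int j) = t [^] (a + - 1)"
      unfolding x True using int_pow_mult[of t a "- 1"] by simp
    then show ?thesis using \<open>f = 0\<close> by blast
  next
    case False
    then have "inv (h \<otimes> D (int k * int l')) \<in> neg"
      using W_pos[of l' h] h(1) unfolding Nl by simp
    then have "t [^] (1::int) \<otimes> inv (h \<otimes> D (int k * int l')) \<in> neg"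
      by (rule neg_t_left)
    then show ?thesis
      unfolding x using h(2) by (simp add: inv_mult_group int_pow_neg)
  qed
qed

text \<open>Both bounds come from Delta^j Delta^-j = 1. With fewer blocks the unit would be negative
  by \<open>greedy_neg\<close>; with more, \<open>greedy_not_neg\<close> would make a power of
  \<open>t\<close> negative.\<close>

lemma dpt_\<Delta>:
  assumes "j \<ge> 1"
  shows "dpt G M (Mon t) (Mon s) (D (int j)) = (2 * k - 1) * j + 1"
proof -
  have DM: "D (int j) \<in> M" by (rule D_M) simp
  obtain n ns where a: "D (int j) = val s t ns \<otimes> t [^] (n::nat)" "greedy s t ns"
    by (rule greedy_form[OF DM])
  let ?d = "(length ns + 1) div 2"
  let ?P = "val s t ns"
  have P: "?P \<in> carrier G" using val_M[of s t] by simp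
  have "?P \<otimes> t [^] n \<otimes> D (- int j) = \<one>"
    unfolding a(1)[symmetric] D_add by simp
  then have "\<not> ?d \<le> (2 * k - 1) * j"
    using greedy_neg[of ns j n] assms neg_not_t[of 0] by auto
  then obtain f where f: "?d = (2 * k - 1) * j + 1 + f"
    using le_Suc_ex[of "(2 * k - 1) * j + 1" ?d] by auto
  have "?P \<otimes> D (- int j) \<otimes> t [^] n = \<one>"
    using \<open>?P \<otimes> t [^] n \<otimes> D (- int j) = \<one>\<close> P by (simp add: mult_D_right)
  then have "inv (?P \<otimes> D (- int j)) = t [^] int n"
    using P inv_unique'[of "?P \<otimes> D (- int j)" "t [^] n"] inv_comm by (simp add: int_pow_int)
  then have "f = 0"
    using greedy_not_neg[OF a(2) f] neg_not_t[of "int n"] by auto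
  then show ?thesis
    unfolding a(1) dpt_greedy[OF a(2)] f by simp
qed

text \<open>By \<open>dpt_\<Delta>\<close> the strict inequality of depths means at most
  \<open>(2 * k - 1) * j\<close> blocks, precisely the hypothesis of \<open>greedy_neg\<close>; its
  failure is the hypothesis of \<open>greedy_not_neg\<close>.\<close>

theorem HG1_negative_iff:
  assumes "\<alpha> \<in> carrier G"
  shows "HG1_negative G M \<Delta> (Mon s) (Mon t) \<alpha> \<longleftrightarrow> \<alpha> \<in> neg"
proof
  assume "HG1_negative G M \<Delta> (Mon s) (Mon t) \<alpha>"
  then obtain a j where a: "a \<in> M" "\<alpha> = a \<otimes> D (- j)" "j \<ge> 1"
    "dpt G M (Mon t) (Mon s) a < dpt G M (Mon t) (Mon s) (D j)"
    unfolding HG1_negative_def is_Delta_form_def unmovable_def by blast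
  obtain j' where j': "j = int j'" "j' \<ge> 1"
    using a(3) by (metis nonneg_int_cases of_nat_1 of_nat_le_iff order_trans zero_le_one)
  obtain n ns where ns: "a = val s t ns \<otimes> t [^] (n::nat)" "greedy s t ns"
    using greedy_form[OF a(1)] by blast
  have "(length ns + 1) div 2 \<le> (2 * k - 1) * j'"
    using a(4) unfolding ns(1) dpt_greedy[OF ns(2)] j'(1) dpt_\<Delta>[OF j'(2)] by simp
  then show "\<alpha> \<in> neg"
    using greedy_neg j'(2) unfolding a(2) ns(1) j'(1) by blast
next
  assume neg: "\<alpha> \<in> neg"
  obtain a j where aj: "is_Delta_form G M \<Delta> \<alpha> a (- j)"
    using Delta_form_exists[OF assms] by blast
  then have a: "a \<in> M" "\<alpha> = a \<otimes> D (- j)"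
    unfolding is_Delta_form_def unmovable_def by auto
  have j: "j \<ge> 1"
  proof (rule ccontr)
    assume "\<not> j \<ge> 1"
    then have "\<alpha> \<in> M" unfolding a(2) using a(1) D_M[of "- j"] by simp
    then show False using neg M_not_neg by blast
  qed
  then obtain j' where j': "j = int j'" "j' \<ge> 1"
    by (metis nonneg_int_cases of_nat_1 of_nat_le_iff order_trans zero_le_one)
  obtain n ns where ns: "a = val s t ns \<otimes> t [^] (n::nat)" "greedy s t ns"
    using greedy_form[OF a(1)] by blast
  have P: "val s t ns \<in> carrier G" using val_M[of s t] by simp
  have \<alpha>: "\<alpha> = val s t ns \<otimes> D (- int j') \<otimes> t [^] (int n)"
    unfolding a(2) ns(1) j'(1) using P by (simp add: mult_D_right int_pow_int)
  have "(length ns + 1) div 2 \<le> (2 * k - 1) * j'"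
  proof (rule ccontr)
    assume "\<not> (length ns + 1) div 2 \<le> (2 * k - 1) * j'"
    then obtain f where f: "(length ns + 1) div 2 = (2 * k - 1) * j' + 1 + f"
      using le_Suc_ex[of "(2 * k - 1) * j' + 1" "(length ns + 1) div 2"] by auto
    from greedy_not_neg[OF ns(2) f] show False
    proof
      assume "inv (val s t ns \<otimes> D (- int j')) \<in> neg"
      then have "t [^] (- int n) \<otimes> inv (val s t ns \<otimes> D (- int j')) \<in> neg"
        by (rule neg_t_left)
      then have "inv \<alpha> \<in> neg"
        unfolding \<alpha> using P by (simp add: inv_mult_group int_pow_neg)
      then show False using neg_not_inv[OF neg] by blast
    next
      assume "f = 0 \<and> (\<exists>b::int. val s t ns \<otimes> D (- int j') = t [^] b)"
      then obtain b :: int where "\<alpha> = t [^] (b + int n)"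
        unfolding \<alpha> by (auto simp: int_pow_mult)
      then show False using neg neg_not_t by blast
    qed
  qed
  then have "dpt G M (Mon t) (Mon s) a < dpt G M (Mon t) (Mon s) (D j)"
    unfolding ns(1) dpt_greedy[OF ns(2)] j'(1) dpt_\<Delta>[OF j'(2)] by simp
  then show "HG1_negative G M \<Delta> (Mon s) (Mon t) \<alpha>"
    unfolding HG1_negative_def using aj j by blast
qed

end

section \<open>The Artin group of type \<open>I\<^sub>2(m)\<close>\<close>

lemma words_UNIV [simp]: "u \<in> words UNIV"
  by (auto simp: words_def)

lemma mult_presented_group_UNIV:
  "A \<otimes>\<^bsub>presented_group UNIV R\<^esub> B = pres_cong UNIV R `` {u @ v | u v. u \<in> A \<and> v \<in> B}"
  by (simp add: presented_group_def)

lemma mult_pres_cong_Image: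
  "(pres_cong UNIV R `` A) \<otimes>\<^bsub>presented_group UNIV R\<^esub> (pres_cong UNIV R `` B)
    = A \<otimes>\<^bsub>presented_group UNIV R\<^esub> B"
proof -
  have "(w, z) \<in> pres_cong UNIV R" if "(u, u') \<in> pres_cong UNIV R" "(v, v') \<in> pres_cong UNIV R"
    "(u' @ v', z) \<in> pres_cong UNIV R" "w = u @ v" for u u' v v' w z
    using that pres_cong_append pres_cong.trans by metis
  then show ?thesis
    unfolding mult_presented_group_UNIV
    by (auto intro!: pres_cong.refl) (blast intro: pres_cong.refl words_UNIV)+
qed

lemma pres_cong_Image_idem:
  "pres_cong UNIV R `` (pres_cong UNIV R `` A) = pres_cong UNIV R `` A"
proof (intro equalityI subsetI)
  fix x assume "x \<in> pres_cong UNIV R `` (pres_cong UNIV R `` A)"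
  then obtain a b where "a \<in> A" "(a, b) \<in> pres_cong UNIV R" "(b, x) \<in> pres_cong UNIV R" by blast
  then show "x \<in> pres_cong UNIV R `` A" using pres_cong.trans by (intro ImageI)
next
  fix x assume "x \<in> pres_cong UNIV R `` A"
  then show "x \<in> pres_cong UNIV R `` (pres_cong UNIV R `` A)"
    by (rule ImageI[OF pres_cong.refl[OF words_UNIV]])
qed

lemma pres_cong_Image_carrier:
  assumes "A \<in> carrier (presented_group UNIV R)"
  shows "pres_cong UNIV R `` A = A"
proof -
  obtain u where "A = pres_cong UNIV R `` {u}"
    using assms unfolding carrier_presented_group word_class_def by blast
  then show ?thesis by (simp only: pres_cong_Image_idem)
qed

text \<open>All concatenations of a word of \<open>A\<close> with a word of \<open>B\<close> lie in
  one class. Cancelling a fixed word on one side shows that the words of \<open>A\<close>, and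
  likewise those of \<open>B\<close>, are equivalent; both sets are nonempty because a class
  is.\<close>

lemma carrier_pres_cong_Image:
  assumes "A \<otimes>\<^bsub>presented_group UNIV R\<^esub> B \<in> carrier (presented_group UNIV R)"
  shows "pres_cong UNIV R `` A \<in> carrier (presented_group UNIV R)
    \<and> pres_cong UNIV R `` B \<in> carrier (presented_group UNIV R)"
proof -
  interpret group "presented_group UNIV R" by (rule group_presented_group)
  let ?c = "word_class UNIV R"
  obtain w where w: "pres_cong UNIV R `` {u @ v | u v. u \<in> A \<and> v \<in> B} = ?c w"
    using assms unfolding carrier_presented_group mult_presented_group_UNIV by blast
  have wc: "?c u = ?c v \<longleftrightarrow> (u, v) \<in> pres_cong UNIV R" for u v
    by (rule word_class_eq_iff) simp_all
  have "w \<in> ?c w" unfolding word_class_def by (simp add: pres_cong.refl)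
  then obtain u v where uv: "u \<in> A" "v \<in> B" using w by blast
  have cw: "?c (u @ v) = ?c w" if "u \<in> A" "v \<in> B" for u v
  proof -
    have "u @ v \<in> pres_cong UNIV R `` {u @ v | u v. u \<in> A \<and> v \<in> B}"
      using that by (intro ImageI[OF pres_cong.refl[OF words_UNIV]]) blast
    then have "(w, u @ v) \<in> pres_cong UNIV R" unfolding w word_class_def by simp
    then show ?thesis unfolding wc by (rule pres_cong.sym)
  qed
  have cl: "?c u \<in> carrier (presented_group UNIV R)" for u
    unfolding carrier_presented_group by simp
  have mult: "?c u \<otimes>\<^bsub>presented_group UNIV R\<^esub> ?c v = ?c (u @ v)" for u v
    by (rule mult_word_class) simp_all
  have A: "?c u' = ?c u" if "u' \<in> A" for u'
    using cw[OF that uv(2)] cw[OF uv] cl right_cancel[of "?c v" "?c u'" "?c u"] by (simp add: mult)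
  have B: "?c v' = ?c v" if "v' \<in> B" for v'
    using cw[OF uv(1) that] cw[OF uv] cl Units_l_cancel[of "?c u" "?c v'" "?c v"]
    by (simp add: mult)
  have "pres_cong UNIV R `` A = ?c u" "pres_cong UNIV R `` B = ?c v"
    using A B uv unfolding word_class_def by blast+
  then show ?thesis using cl by simp
qed

definition word_deg :: "'a word \<Rightarrow> int" where
  "word_deg w = (\<Sum>p\<leftarrow>w. if snd p then 1 else - 1)"

lemma word_deg_append: "word_deg (u @ v) = word_deg u + word_deg v"
  by (simp add: word_deg_def)

lemma word_deg_cong:
  assumes "(u, v) \<in> pres_cong UNIV R" "\<And>l r. (l, r) \<in> R \<Longrightarrow> word_deg l = word_deg r"
  shows "word_deg u = word_deg v"
proof -
  let ?f = "\<lambda>p i. (if snd p then 1 else - 1) + i :: int"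
  have fold: "foldr ?f w j = word_deg w + j" for w :: "'a word" and j
    unfolding word_deg_def by (induction w) simp_all
  have "foldr ?f u 0 = foldr ?f v 0"
    by (rule pres_cong_action[OF assms(1), where X = UNIV]) (auto simp: fold dest: assms(2))
  then show ?thesis by (simp add: fold)
qed

lemma length_alt_word: "length (alt_word x y n) = n"
  by (induction n arbitrary: x y) simp_all

lemma word_deg_pos_word: "word_deg (pos_word xs) = int (length xs)"
  by (induction xs) (simp_all add: word_deg_def pos_word_def)

lemma map_alt_word: "map f (alt_word x y n) = alt_word (f x) (f y) n"
  by (induction n arbitrary: x y) simp_all

text \<open>Both sides of the single relation have the same length, so the exponent sum does not
  depend on the representative chosen by \<open>SOME\<close>.\<close>

lemma dihedral_artin_artin_I2:
  assumes "k \<ge> 1"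
  shows "dihedral_artin (artin_I2 (2 * k + 1)) (artin_s (2 * k + 1)) (artin_t (2 * k + 1)) k
    (\<lambda>A. word_deg (SOME u. u \<in> A)) (\<lambda>A. pres_cong UNIV (artin_rels (2 * k + 1)) `` A)"
proof -
  let ?R = "artin_rels (2 * k + 1)"
  let ?deg = "\<lambda>A. word_deg (SOME u. u \<in> A) :: int"
  interpret group "artin_I2 (2 * k + 1)"
    unfolding artin_I2_def by (rule group_presented_group)
  have deg: "?deg (word_class UNIV ?R u) = word_deg u" for u :: "st word"
  proof -
    have "u \<in> word_class UNIV ?R u" unfolding word_class_def by (simp add: pres_cong.refl)
    then have "(SOME v. v \<in> word_class UNIV ?R u) \<in> word_class UNIV ?R u" by (rule someI)
    then have "(u, SOME v. v \<in> word_class UNIV ?R u) \<in> pres_cong UNIV ?R"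
      unfolding word_class_def by simp
    then have "word_deg u = word_deg (SOME v. v \<in> word_class UNIV ?R u)"
      by (rule word_deg_cong) (auto simp: artin_rels_def word_deg_pos_word length_alt_word)
    then show ?thesis by simp
  qed
  have UNIV_st: "(UNIV :: st set) = {gen_s, gen_t}"
    using st.exhaust by auto
  have gens: "artin_s (2 * k + 1) = pres_gen UNIV ?R gen_s" "artin_t (2 * k + 1) = pres_gen UNIV ?R gen_t"
    by (simp_all add: artin_s_def artin_t_def)
  show ?thesis
  proof (unfold_locales)
    show "artin_s (2 * k + 1) \<in> carrier (artin_I2 (2 * k + 1))"
      "artin_t (2 * k + 1) \<in> carrier (artin_I2 (2 * k + 1))"
      unfolding gens artin_I2_def by (simp_all add: pres_gen_closed)
    have "(pos_word (alt_word gen_s gen_t (2 * k + 1)), pos_word (alt_word gen_t gen_s (2 * k + 1))) \<in> ?R"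
      by (simp add: artin_rels_def)
    from presented_group_relation[OF this subset_UNIV subset_UNIV]
    show "list_prod (artin_I2 (2 * k + 1)) (alt_word (artin_s (2 * k + 1)) (artin_t (2 * k + 1)) (2 * k + 1))
      = list_prod (artin_I2 (2 * k + 1)) (alt_word (artin_t (2 * k + 1)) (artin_s (2 * k + 1)) (2 * k + 1))"
      unfolding map_alt_word gens artin_I2_def .
    show "carrier (artin_I2 (2 * k + 1))
      = generate (artin_I2 (2 * k + 1)) {artin_s (2 * k + 1), artin_t (2 * k + 1)}"
      unfolding artin_I2_def gens carrier_presented_group_generate by (subst UNIV_st) simp
    show "?deg (artin_s (2 * k + 1)) = 1" "?deg (artin_t (2 * k + 1)) = 1"
      unfolding gens pres_gen_eq deg by (simp_all add: word_deg_def)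
  next
    fix x y assume "x \<in> carrier (artin_I2 (2 * k + 1))" "y \<in> carrier (artin_I2 (2 * k + 1))"
    then obtain u v where uv: "x = word_class UNIV ?R u" "y = word_class UNIV ?R v"
      unfolding artin_I2_def carrier_presented_group by blast
    have xy: "x \<otimes>\<^bsub>artin_I2 (2 * k + 1)\<^esub> y = word_class UNIV ?R (u @ v)"
      unfolding artin_I2_def uv by (rule mult_word_class) (rule words_UNIV)+
    show "?deg (x \<otimes>\<^bsub>artin_I2 (2 * k + 1)\<^esub> y) = ?deg x + ?deg y"
      unfolding xy unfolding uv deg by (rule word_deg_append)
  next
    fix x y
    show "pres_cong UNIV ?R `` x \<otimes>\<^bsub>artin_I2 (2 * k + 1)\<^esub> pres_cong UNIV ?R `` y = x \<otimes>\<^bsub>artin_I2 (2 * k + 1)\<^esub> y"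
      unfolding artin_I2_def by (rule mult_pres_cong_Image)
    show "pres_cong UNIV ?R `` (x \<otimes>\<^bsub>artin_I2 (2 * k + 1)\<^esub> y) = x \<otimes>\<^bsub>artin_I2 (2 * k + 1)\<^esub> y"
      unfolding artin_I2_def mult_presented_group_UNIV by (rule pres_cong_Image_idem)
  next
    fix x assume "x \<in> carrier (artin_I2 (2 * k + 1))"
    then show "pres_cong UNIV ?R `` x = x"
      unfolding artin_I2_def by (rule pres_cong_Image_carrier)
  next
    fix x y assume "x \<otimes>\<^bsub>artin_I2 (2 * k + 1)\<^esub> y \<in> carrier (artin_I2 (2 * k + 1))"
    then show "pres_cong UNIV ?R `` x \<in> carrier (artin_I2 (2 * k + 1))
      \<and> pres_cong UNIV ?R `` y \<in> carrier (artin_I2 (2 * k + 1))"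
      unfolding artin_I2_def by (rule carrier_pres_cong_Image)
  qed (rule assms)
qed

theorem proposition6p4:
  fixes k m :: nat
    and \<iota> :: "st word set \<Rightarrow> nat word set"
    and \<alpha> :: "st word set"
  assumes "m = 2 * k + 1" and "m \<ge> 5"
    and "\<iota> \<in> hom (artin_I2 m) (braid_group (2 * k + 1))"
    and "\<iota> (artin_s m) =
      list_prod (braid_group (2 * k + 1)) (map (\<lambda>i. braid_gen (2 * k + 1) (2 * i + 1)) [0..<k])"
    and "\<iota> (artin_t m) =
      list_prod (braid_group (2 * k + 1)) (map (\<lambda>i. braid_gen (2 * k + 1) (2 * i)) [1..<k + 1])"
    and "\<alpha> \<in> carrier (artin_I2 m)"
  shows "HG1_negative (artin_I2 m) (artin_M m) (artin_Delta m) (artin_N m) (artin_M1 m) \<alpha>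
    \<longleftrightarrow> r1_negative (2 * k + 1) (\<iota> \<alpha>)"
proof -
  define n where "n = 2 * k + 1"
  have k: "k \<ge> 2" and n3: "n \<ge> 3" using assms(1,2) unfolding n_def by linarith+
  let ?G = "artin_I2 m" and ?B = "braid_group n" and ?s = "artin_s m" and ?t = "artin_t m"
  interpret G: dihedral_artin ?G ?s ?t k
    "\<lambda>A. word_deg (SOME u. u \<in> A)" "\<lambda>A. pres_cong UNIV (artin_rels m) `` A"
    unfolding assms(1) by (rule dihedral_artin_artin_I2) (use k in linarith)
  interpret B: braid_like_odd ?B "braid_gen n" n k
    by (intro braid_like_odd.intro braid_like_odd_axioms.intro braid_like_braid_group)
      (use k n3 n_def in auto)
  interpret \<iota>: group_hom ?G ?B \<iota>
    using assms(3) unfolding n_def[symmetric]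
    by (intro group_hom.intro group_hom_axioms.intro G.is_group B.is_group)
  have \<iota>s: "\<iota> ?s = B.S" and \<iota>t: "\<iota> ?t = B.T"
    unfolding assms(4,5) B.parity_prod_def n_def[symmetric] by (simp_all add: comp_def del: upt_Suc)
  have Neg_K: "\<nu> \<notin> B.K" if "\<nu> \<in> B.Neg" for \<nu>
    using Neg_not_K[OF n3 that] .
  have K_list: "list_prod ?B (map (braid_gen n) js) \<in> B.K" if "set js \<subseteq> {2..<n}" for js
    using that by (induction js) (auto intro!: B.K_mult B.r_in_K)
  have T_K: "B.T [^]\<^bsub>?B\<^esub> (a::int) \<in> B.K" for a
  proof -
    have "set (B.parity_list False) \<subseteq> {2..<n}"
      unfolding B.set_parity_list by (auto elim!: evenE)
    then show ?thesis
      unfolding B.parity_prod_eq by (intro B.K_pow K_list)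
  qed
  \<comment> \<open>The two factors Omega are expanded in the two different ways, to match the
    product computed in \<open>full_twist\<close>.\<close>
  have \<iota>\<Delta>: "\<iota> G.\<Delta> = ((B.S \<otimes>\<^bsub>?B\<^esub> B.T) [^]\<^bsub>?B\<^esub> k \<otimes>\<^bsub>?B\<^esub> B.S)
      \<otimes>\<^bsub>?B\<^esub> ((B.T \<otimes>\<^bsub>?B\<^esub> B.S) [^]\<^bsub>?B\<^esub> k \<otimes>\<^bsub>?B\<^esub> B.T)"
  proof -
    have "\<iota> G.\<Omega> = (B.S \<otimes>\<^bsub>?B\<^esub> B.T) [^]\<^bsub>?B\<^esub> k \<otimes>\<^bsub>?B\<^esub> B.S"
      unfolding G.\<Omega>_eq(1) by (simp add: \<iota>.hom_nat_pow \<iota>s \<iota>t)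
    moreover have "\<iota> G.\<Omega> = (B.T \<otimes>\<^bsub>?B\<^esub> B.S) [^]\<^bsub>?B\<^esub> k \<otimes>\<^bsub>?B\<^esub> B.T"
      unfolding G.\<Omega>_eq(2) by (simp add: \<iota>.hom_nat_pow \<iota>s \<iota>t)
    ultimately show ?thesis
      unfolding G.\<Delta>_eq \<iota>.hom_mult[OF G.\<Omega>_closed G.\<Omega>_closed] by simp
  qed
  interpret C: dihedral_artin_cone ?G ?s ?t k
    "\<lambda>A. word_deg (SOME u. u \<in> A)" "\<lambda>A. pres_cong UNIV (artin_rels m) `` A"
    "{x \<in> carrier ?G. \<iota> x \<in> B.Neg}"
  proof (unfold_locales, goal_cases)
    case (2 x y)
    then show ?case using B.Neg_mult by simp
  next
    case (3 x a)
    then show ?case using B.Neg_K_left[OF _ T_K] by (simp add: \<iota>.hom_int_pow \<iota>t)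
  next
    case (4 x a)
    then show ?case using B.Neg_K_right[OF _ T_K] by (simp add: \<iota>.hom_int_pow \<iota>t)
  next
    case (5 a)
    then show ?case using Neg_K T_K by (auto simp: \<iota>.hom_int_pow \<iota>t)
  next
    case 6
    \<comment> \<open>The first generator is the only factor of \<open>B.S\<close> outside
      \<open>B.K\<close>, so the inverse of \<open>B.S\<close> contains a single inverse of
      it.\<close>
    have "[0..<k] = 0 # [1..<k]" using k by (simp add: upt_conv_Cons)
    then have "B.S = braid_gen n 1 \<otimes>\<^bsub>?B\<^esub>
        list_prod ?B (map (braid_gen n) (map (\<lambda>i. 2 * i + 1) [1..<k]))" (is "_ = _ \<otimes>\<^bsub>?B\<^esub> ?L")
      unfolding B.parity_prod_def by simp
    moreover have L: "?L \<in> B.K"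
      by (rule K_list) (auto simp: n_def)
    ultimately have "inv\<^bsub>?B\<^esub> B.S = inv\<^bsub>?B\<^esub> ?L \<otimes>\<^bsub>?B\<^esub> inv\<^bsub>?B\<^esub> braid_gen n 1 \<otimes>\<^bsub>?B\<^esub> \<one>\<^bsub>?B\<^esub>"
      by (simp add: B.inv_mult_group)
    then have "inv\<^bsub>?B\<^esub> B.S \<in> B.Neg"
      using B.Neg.base[OF B.K_inv[OF L] B.K_one] by simp
    then show ?case by (simp add: \<iota>s)
  next
    case (7 ps)
    let ?f = "\<lambda>(x::int, y::int). ?s [^]\<^bsub>?G\<^esub> x \<otimes>\<^bsub>?G\<^esub> ?t [^]\<^bsub>?G\<^esub> y"
    let ?g = "\<lambda>(x::int, y::int). B.S [^]\<^bsub>?B\<^esub> x \<otimes>\<^bsub>?B\<^esub> B.T [^]\<^bsub>?B\<^esub> y"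
    have "list_prod ?G (map ?f qs) \<in> carrier ?G \<and> \<iota> (list_prod ?G (map ?f qs)) = list_prod ?B (map ?g qs)" for qs
      by (induction qs) (auto simp: \<iota>.hom_int_pow \<iota>s \<iota>t)
    then show ?case
      using B.blocks_below_full_twist[OF 7] by (simp add: \<iota>\<Delta>)
  qed simp
  have "artin_M m = G.M" "artin_N m = G.Mon ?s" "artin_M1 m = G.Mon ?t" "artin_Delta m = G.\<Delta>"
    unfolding artin_M_def artin_N_def artin_M1_def artin_Delta_def artin_Omega_def
      G.M_def G.Mon_def G.\<Delta>_def G.\<Omega>_def by (simp_all add: assms(1))
  then show ?thesis
    using C.HG1_negative_iff[OF assms(6)] assms(6) r1_negative_iff[OF n3, of "\<iota> \<alpha>"]
    unfolding n_def by simp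
qed

end
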